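(* Let $\alpha,\beta\in(0,1)$ and let $\Lambda^{ri}_{\alpha,\beta}$ be the measure on $\mathcal{Q}$ defined by $\Lambda^{ri}_{\alpha,\beta}(\mathrm{d}\bm{x}):=\tilde\nu_{\alpha}(\mathrm{d}\bm{x})+\delta_{y^{\beta}}(\mathrm{d}\bm{x})$, where $\tilde\nu_\alpha(\mathrm{d}\bm{x}):=\nu_\alpha(\mathrm{d}x_1)\otimes\delta_\infty(\mathrm{d}x_2)\otimes\delta_\infty(\mathrm{d}x_3)\otimes\cdots$, $\nu_\alpha(\mathrm{d}\mathfrak{z}):=\frac{\alpha}{\Gamma(1-\alpha)}\frac{\mathrm{d}\mathfrak{z}}{\mathfrak{z}^{\alpha+1}}$ on $(0,\infty)$, and $y^\beta=(y^\beta_n)_{n\ge1}$ with $y^\beta_n:=(\log n)^\beta$. Let $\gamma:=\dfrac{\beta}{\alpha\beta+1-\alpha}$. Then the branching subordinator $Y$ with characteristic couple $(0,\Lambda^{ri}_{\alpha,\beta})$ satisfies, $\mathbb{P}$-almost surely, $$0<\liminf_{t\to\infty}\frac{\underline{Y}(t)}{t^{\gamma}}\le\limsup_{t\to\infty}\frac{\underline{Y}(t)}{t^{\gamma}}<\infty.$$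
   Context: **The space $\mathcal{Q}$.** $\mathcal{Q}$ is the set of non-decreasing sequences $\bm{x}=(x_n)_{n\ge1}$ in $[0,\infty]$ with $\lim_n x_n=\infty$, identified with the point measures $\sum_{n:x_n<\infty}\delta_{x_n}$ on $[0,\infty)$ giving finite mass to each $[0,a]$; it carries the vague topology and its Borel $\sigma$-field. $\emptyset:=(\infty,\infty,\ldots)$, $(0,\emptyset):=(0,\infty,\infty,\ldots)$, $\mathcal{Q}^{\star}:=\{\bm{x}\in\mathcal{Q};\ x_2<\infty\}$. **Characteristic couples.** Below $d\ge0$ and $\Lambda$ is a measure on $\mathcal{Q}$ with $\Lambda(\{(0,\emptyset)\})+\Lambda(\{\emptyset\})=0$, $\int_{\mathcal{Q}}(1\wedge x_1)\Lambda(\mathrm{d}\bm{x})<\infty$, $\Lambda(\mathcal{Q}^{\star})\in(0,\infty]$ and $\int_{\mathcal{Q}}|\sharp\{n\ge 1; x_n<a\}-1|\Lambda(\mathrm{d}\bm{x})<\infty$ for all $a>0$; the measure $\Lambda^{ri}_{\alpha,\beta}$ satisfies these conditions. **Truncation.** For $a>0$, $T_a:\mathcal{Q}\to\mathcal{Q}$ keeps $x_1$ unchanged and, for $i\ge2$, keeps $x_i$ if $x_i<a$ and replaces it by $\infty$ if $x_i\ge a$. $\Lambda^a(\mathrm{d}\bm{x}):=\mathds{1}_{\{\bm{x}\ne(0,\emptyset)\}}(T_a\Lambda)(\mathrm{d}\bm{x})$, with $T_a\Lambda$ the image measure. Then $\Lambda^a(\mathcal{Q}^\star)=\Lambda(\{x_2<a\})<\infty$,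 and one fixes $a_0(\Lambda)\ge0$ such that $\Lambda^a(\mathcal{Q}^\star)>0$ for all $a>a_0(\Lambda)$. **Truncated branching subordinator $Y^a$** ($a>a_0(\Lambda)$). At time $0$ there is one particle $\varnothing$, at position $0$. Particles never die. A particle $u$ born at time $\mathfrak{b}_u$ has, independently of the other particles, a subordinator $\xi_u$ started at $0$ with drift $d$ and Lévy measure the image of $\Lambda^a(\cdot\cap(\mathcal{Q}\setminus\mathcal{Q}^\star))$ under $\bm{x}\mapsto x_1$, and an independent Poisson point process $\mathcal{P}_u$ of points $(s,\bm{x})$ on $[\mathfrak{b}_u,\infty)\times\mathcal{Q}^\star$ with intensity $\mathrm{d}s\otimes\Lambda^a(\cdot\cap\mathcal{Q}^\star)$. For $t\ge\mathfrak{b}_u$ its position $Y^a_u(t)$ is its birth position plus $\xi_u(t-\mathfrak{b}_u)$ plus the sum of $x_1$ over points $(s,\bm{x})\in\mathcal{P}_u$ with $s\le t$. At each point $(s,\bm{x})\in\mathcal{P}_u$ (a branching), for each $i\ge2$ with $x_i<\infty$ a child of $u$ is born at time $s$ at position $Y^a_u(s-)+x_i$. $\mathcal{N}^a(t)$ is the (a.s. finite) set of particles born by time $t$; for $u\in\mathcal{N}^a(t)$ and $s<\mathfrak{b}_u$, $Y^a_u(s)$ is the position at time $s$ of the most recent ancestor of $u$ alive at time $s$. $Y^a(t):=\sum_{u\in\mathcal{N}^a(t)}\delta_{Y^a_u(t)}$. **Branching subordinator $Y$.** The $Y^a$ are constructed jointly so that for $a\le a'$, $Y^a$ is obtained from $Y^{a'}$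 by removing, at each branching, every newborn child whose birth position is at distance $\ge a$ from the pre-branching position of its parent, together with all its descendants. The branching subordinator with characteristic couple $(d,\Lambda)$ is $Y(t):=\lim_{a\to\infty}\uparrow Y^a(t)$, with particle set $\mathcal{N}(t):=\bigcup_a\mathcal{N}^a(t)$ and positions $Y_u(t)$. The leftmost position is $\underline{Y}(t):=\min_{u\in\mathcal{N}(t)}Y_u(t)$. *)

theory Defs
  imports "HOL-Probability.Probability" "HOL-Library.Sublist"
begin

section \<open>The space of point configurations\<close>

text \<open>
  Sequences are indexed from 0, so the coordinate written $x_n$ in the literature ($n \ge 1$) is
  \<open>x (n - 1)\<close>; in particular \<open>x 0\<close> and \<open>x 1\<close> are $x_1$ and $x_2$.
\<close>

type_synonym config = "nat \<Rightarrow> ennreal"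

definition config_space :: "config set" where
  "config_space = {x. mono x \<and> x \<longlonglongrightarrow> \<infinity>}"

text \<open>
  The vague topology: the coarsest one for which the integral of \<open>f\<close> against the point measure
  of \<open>x\<close> is continuous in \<open>x\<close>, for each continuous \<open>f\<close> with compact support in $[0,\infty)$.
  The sum has finitely many nonzero terms.
\<close>

definition config_integral :: "(real \<Rightarrow> real) \<Rightarrow> config \<Rightarrow> real" where
  "config_integral f x = (\<Sum>\<^sub>\<infinity>n\<in>{n. x n < \<infinity>}. f (enn2real (x n)))"

definition vague_topology :: "config topology" where
  "vague_topology = topology_generated_by
     {{x \<in> config_space. config_integral f x \<in> U} | f U.
        continuous_on {0..} f \<and> (\<exists>c. \<forall>z>c. f z = 0) \<and> open U}"

definition Q_borel :: "config measure" where
  "Q_borel = sigma config_space {U. openin vague_topology U}"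

definition empty_config :: config where
  "empty_config = (\<lambda>_. \<infinity>)"

definition one_point :: "ennreal \<Rightarrow> config" where
  "one_point z = (\<lambda>n. if n = 0 then z else \<infinity>)"

definition Q_star :: "config set" where
  "Q_star = {x \<in> config_space. x 1 < \<infinity>}"

section \<open>Characteristic couples and truncation\<close>

definition characteristic_couple :: "real \<Rightarrow> config measure \<Rightarrow> bool" where
  "characteristic_couple d \<Lambda> \<longleftrightarrow>
     0 \<le> d \<and> sets \<Lambda> = sets Q_borel \<and>
     emeasure \<Lambda> {one_point 0} + emeasure \<Lambda> {empty_config} = 0 \<and>
     (\<integral>\<^sup>+x. min 1 (x 0) \<partial>\<Lambda>) < \<infinity> \<and>
     0 < emeasure \<Lambda> Q_star \<and>
     (\<forall>a>0. (\<integral>\<^sup>+x. ennreal \<bar>real (card {n. x n < ennreal a}) - 1\<bar> \<partial>\<Lambda>) < \<infinity>)"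

definition trunc :: "real \<Rightarrow> config \<Rightarrow> config" where
  "trunc a x = (\<lambda>n. if n = 0 \<or> x n < ennreal a then x n else \<infinity>)"

definition trunc_measure :: "config measure \<Rightarrow> real \<Rightarrow> config measure" where
  "trunc_measure \<Lambda> a =
     density (distr \<Lambda> Q_borel (trunc a)) (indicator (- {one_point 0}))"

section \<open>Subordinators and Poisson point processes\<close>

text \<open>
  A subordinator is described by its Laplace exponent; left limits exist by monotonicity.
\<close>

definition subordinator ::
  "'w measure \<Rightarrow> real \<Rightarrow> real measure \<Rightarrow> (real \<Rightarrow> 'w \<Rightarrow> real) \<Rightarrow> bool" where
  "subordinator M d \<nu> \<xi> \<longleftrightarrow>
     (\<forall>t\<ge>0. \<xi> t \<in> borel_measurable M) \<and>
     (AE \<omega> in M. \<xi> 0 \<omega> = 0 \<and> mono_on {0..} (\<lambda>t. \<xi> t \<omega>) \<and>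
        (\<forall>t\<ge>0. continuous (at_right t) (\<lambda>t. \<xi> t \<omega>))) \<and>
     (\<forall>r. 0 \<le> r 0 \<and> mono r \<longrightarrow>
        prob_space.indep_vars M (\<lambda>_. borel) (\<lambda>i \<omega>. \<xi> (r (Suc i)) \<omega> - \<xi> (r i) \<omega>)
          (UNIV :: nat set)) \<and>
     (\<forall>s\<ge>0. \<forall>t\<ge>s. distr M borel (\<lambda>\<omega>. \<xi> t \<omega> - \<xi> s \<omega>) = distr M borel (\<xi> (t - s))) \<and>
     (\<forall>t\<ge>0. \<forall>q\<ge>0. (\<integral>\<omega>. exp (- q * \<xi> t \<omega>) \<partial>M) =
        exp (- t * (d * q + (\<integral>z. 1 - exp (- q * z) \<partial>\<nu>))))"

definition count_in :: "('w \<Rightarrow> 'e set) \<Rightarrow> 'e set \<Rightarrow> 'w \<Rightarrow> ennreal" where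
  "count_in \<eta> A \<omega> = emeasure (count_space UNIV) (\<eta> \<omega> \<inter> A)"

text \<open>
  A Poisson point process is represented by its random set of points.  This is adequate for the
  intensities used below: their time component is Lebesgue measure, so there are almost surely no
  multiple points.
\<close>

definition poisson_point_process ::
  "'w measure \<Rightarrow> 'e measure \<Rightarrow> ('w \<Rightarrow> 'e set) \<Rightarrow> bool" where
  "poisson_point_process M E \<eta> \<longleftrightarrow>
     (\<forall>\<omega>\<in>space M. \<eta> \<omega> \<subseteq> space E) \<and>
     (\<forall>A\<in>sets E. count_in \<eta> A \<in> borel_measurable M) \<and>
     (\<forall>A\<in>sets E. emeasure E A < \<infinity> \<longrightarrow>
        (\<forall>k. measure M {\<omega> \<in> space M. count_in \<eta> A \<omega> = of_nat k} =
          exp (- measure E A) * measure E A ^ k / fact k)) \<and>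
     (\<forall>A\<in>sets E. emeasure E A = \<infinity> \<longrightarrow> (AE \<omega> in M. count_in \<eta> A \<omega> = \<infinity>)) \<and>
     (\<forall>A. range A \<subseteq> sets E \<and> disjoint_family A \<longrightarrow>
        prob_space.indep_vars M (\<lambda>_. borel) (\<lambda>i. count_in \<eta> (A i)) (UNIV :: nat set))"

section \<open>Particle systems\<close>

text \<open>
  A particle is named by its ancestral line, youngest first: it is the list of pairs
  (birth time, index) of the particle itself, of its parent, and so on up to a child of the root;
  the root is the empty list.  The index is the position in the configuration \<open>x\<close> of the
  coordinate that gave birth to the particle.  Truncation changes neither indices nor times, so
  these names are compatible between different truncation levels.

  The positions of a particle before its birth are those of its ancestors.
\<close>

type_synonym particle = "(real \<times> nat) list"

record particle_system =
  particles :: "particle set"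
  position :: "particle \<Rightarrow> real \<Rightarrow> real"

primrec name_time :: "particle \<Rightarrow> real" where
  "name_time [] = 0"
| "name_time (c # u) = fst c"

definition population :: "particle_system \<Rightarrow> real \<Rightarrow> particle set" where
  "population Z t = {u \<in> particles Z. name_time u \<le> t}"

definition leftmost :: "particle_system \<Rightarrow> real \<Rightarrow> real" where
  "leftmost Z t = (LEAST y. \<exists>u\<in>population Z t. y = position Z u t)"

text \<open>
  The driving noise is indexed by potential particles: \<open>(k, i) # u\<close> stands for the child with index
  \<open>i\<close> produced at the \<open>k\<close>-th branching (\<open>k = 0, 1, \<dots>\<close>) of \<open>u\<close>.  The branchings \<open>P u\<close> have times
  counted from the birth of \<open>u\<close>; shifting by the birth time gives the point process of \<open>u\<close> on
  $[\mathfrak{b}_u,\infty)$.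
\<close>

type_synonym slot = "(nat \<times> nat) list"

definition kth_branching :: "(real \<times> config) set \<Rightarrow> nat \<Rightarrow> real \<times> config" where
  "kth_branching p k = (THE b. b \<in> p \<and> card {c \<in> p. fst c < fst b} = k)"

primrec birth_time :: "(slot \<Rightarrow> (real \<times> config) set) \<Rightarrow> slot \<Rightarrow> real" where
  "birth_time P [] = 0"
| "birth_time P (c # u) = birth_time P u + fst (kth_branching (P u) (fst c))"

primrec born :: "(slot \<Rightarrow> (real \<times> config) set) \<Rightarrow> slot \<Rightarrow> bool" where
  "born P [] = True"
| "born P (c # u) =
     (born P u \<and> 1 \<le> snd c \<and> snd (kth_branching (P u) (fst c)) (snd c) < \<infinity>)"

primrec particle_name :: "(slot \<Rightarrow> (real \<times> config) set) \<Rightarrow> slot \<Rightarrow> particle" where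
  "particle_name P [] = []"
| "particle_name P (c # u) = (birth_time P (c # u), snd c) # particle_name P u"

definition displacement ::
  "(slot \<Rightarrow> real \<Rightarrow> real) \<Rightarrow> (slot \<Rightarrow> (real \<times> config) set) \<Rightarrow> slot \<Rightarrow> real \<Rightarrow> real" where
  "displacement xi P u t = xi u (t - birth_time P u) +
     (\<Sum>b \<in> {b \<in> P u. birth_time P u + fst b \<le> t}. enn2real (snd b 0))"

primrec trajectory ::
  "(slot \<Rightarrow> real \<Rightarrow> real) \<Rightarrow> (slot \<Rightarrow> (real \<times> config) set) \<Rightarrow> slot \<Rightarrow> real \<Rightarrow> real" where
  "trajectory xi P [] = displacement xi P []"
| "trajectory xi P (c # u) = (\<lambda>t.
     if t < birth_time P (c # u) then trajectory xi P u t
     else Lim (at_left (birth_time P (c # u))) (trajectory xi P u)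
        + enn2real (snd (kth_branching (P u) (fst c)) (snd c))
        + displacement xi P (c # u) t)"

definition driven_by ::
  "(slot \<Rightarrow> real \<Rightarrow> real) \<Rightarrow> (slot \<Rightarrow> (real \<times> config) set) \<Rightarrow> particle_system \<Rightarrow> bool" where
  "driven_by xi P Z \<longleftrightarrow>
     particles Z = particle_name P ` {v. born P v} \<and>
     (\<forall>v. born P v \<longrightarrow> (\<forall>t\<ge>0. position Z (particle_name P v) t = trajectory xi P v t))"

section \<open>Branching subordinators\<close>

text \<open>The index \<open>Inl v\<close> refers to the events of $\xi_v$ and \<open>Inr v\<close> to those of $\mathcal{P}_v$.\<close>

definition noise_events ::
  "'w measure \<Rightarrow> 'e measure \<Rightarrow> (slot \<Rightarrow> real \<Rightarrow> 'w \<Rightarrow> real) \<Rightarrow> (slot \<Rightarrow> 'w \<Rightarrow> 'e set) \<Rightarrow>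
   slot + slot \<Rightarrow> 'w set set" where
  "noise_events M E \<xi> P j = (case j of
     Inl v \<Rightarrow> sigma_sets (space M)
       {\<xi> v t -` B \<inter> space M | t B. 0 \<le> t \<and> B \<in> sets borel}
   | Inr v \<Rightarrow> sigma_sets (space M)
       {count_in (P v) A -` B \<inter> space M | A B. A \<in> sets E \<and> B \<in> sets borel})"

definition branching_intensity :: "config measure \<Rightarrow> real \<Rightarrow> (real \<times> config) measure" where
  "branching_intensity \<Lambda> a =
     restrict_space lborel {0..} \<Otimes>\<^sub>M restrict_space (trunc_measure \<Lambda> a) Q_star"

definition nonbranching_levy_measure :: "config measure \<Rightarrow> real \<Rightarrow> real measure" where
  "nonbranching_levy_measure \<Lambda> a =
     distr (restrict_space (trunc_measure \<Lambda> a) (config_space - Q_star)) borel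
       (\<lambda>x. enn2real (x 0))"

definition truncated_branching_subordinator ::
  "'w measure \<Rightarrow> real \<Rightarrow> config measure \<Rightarrow> real \<Rightarrow> ('w \<Rightarrow> particle_system) \<Rightarrow> bool" where
  "truncated_branching_subordinator M d \<Lambda> a Z \<longleftrightarrow> (\<exists>\<xi> P.
     (\<forall>v. subordinator M d (nonbranching_levy_measure \<Lambda> a) (\<xi> v)) \<and>
     (\<forall>v. poisson_point_process M (branching_intensity \<Lambda> a) (P v)) \<and>
     prob_space.indep_sets M (noise_events M (branching_intensity \<Lambda> a) \<xi> P) UNIV \<and>
     (AE \<omega> in M. driven_by (\<lambda>v t. \<xi> v t \<omega>) (\<lambda>v. P v \<omega>) (Z \<omega>)))"

text \<open>
  \<open>pruned a Z' Z\<close>: \<open>Z\<close> arises from \<open>Z'\<close> by removing, with all its descendants, each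
  child \<open>c # v\<close> born at distance at least \<open>a\<close> from the pre-branching position of its parent \<open>v\<close>.
\<close>

definition pruned :: "real \<Rightarrow> particle_system \<Rightarrow> particle_system \<Rightarrow> bool" where
  "pruned a Z' Z \<longleftrightarrow>
     particles Z = {u \<in> particles Z'. \<forall>c v. suffix (c # v) u \<longrightarrow>
       \<not> a \<le> dist (position Z' (c # v) (fst c)) (Lim (at_left (fst c)) (position Z' v))} \<and>
     (\<forall>u\<in>particles Z. \<forall>t\<ge>0. position Z u t = position Z' u t)"

definition branching_subordinator ::
  "'w measure \<Rightarrow> real \<Rightarrow> config measure \<Rightarrow> ('w \<Rightarrow> particle_system) \<Rightarrow> bool" where
  "branching_subordinator M d \<Lambda> Y \<longleftrightarrow> characteristic_couple d \<Lambda> \<and> (\<exists>a0\<ge>0. \<exists>Ya.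
     (\<forall>a>a0. 0 < emeasure (trunc_measure \<Lambda> a) Q_star) \<and>
     (\<forall>a>a0. truncated_branching_subordinator M d \<Lambda> a (Ya a)) \<and>
     (AE \<omega> in M. \<forall>a a'. a0 < a \<and> a \<le> a' \<longrightarrow> pruned a (Ya a' \<omega>) (Ya a \<omega>)) \<and>
     (AE \<omega> in M. particles (Y \<omega>) = (\<Union>a\<in>{a0<..}. particles (Ya a \<omega>)) \<and>
        (\<forall>a>a0. \<forall>u\<in>particles (Ya a \<omega>). \<forall>t\<ge>0.
           position (Y \<omega>) u t = position (Ya a \<omega>) u t)))"

section \<open>The measure $\Lambda^{ri}_{\alpha,\beta}$\<close>

definition stable_levy_measure :: "real \<Rightarrow> real measure" where
  "stable_levy_measure \<alpha> = density lborel
     (\<lambda>z. ennreal (indicator {0<..} z * (\<alpha> / Gamma (1 - \<alpha>) / z powr (\<alpha> + 1))))"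

text \<open>
  The image under \<open>one_point\<close> is the product of the stable measure with
  $\delta_\infty\otimes\delta_\infty\otimes\cdots$.
\<close>

definition stable_config_measure :: "real \<Rightarrow> config measure" where
  "stable_config_measure \<alpha> =
     distr (stable_levy_measure \<alpha>) Q_borel (\<lambda>z. one_point (ennreal z))"

definition log_config :: "real \<Rightarrow> config" where
  "log_config \<beta> = (\<lambda>n. ennreal (ln (real (Suc n)) powr \<beta>))"

definition Lambda_ri :: "real \<Rightarrow> real \<Rightarrow> config measure" where
  "Lambda_ri \<alpha> \<beta> = measure_of config_space (sets Q_borel)
     (\<lambda>A. emeasure (stable_config_measure \<alpha>) A + emeasure (return Q_borel (log_config \<beta>)) A)"

end

theory Submission
  imports Defs "HOL-Real_Asymp.Real_Asymp"
begin

text \<open>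
  Lower bound: truncate at level \<open>a = c t\<^sup>\<gamma>\<close>, which does not affect particles below \<open>a\<close>, and bound the
  expected number of particles below \<open>a\<close> at time \<open>t\<close> by the exponential moment
  \<open>exp (q a) E (\<Sum> exp (- q Y\<^sub>u(t)))\<close>.  The choice \<open>q = 2 a powr (1 / \<beta> - 1)\<close> keeps
  \<open>\<Sum>\<^sub>n exp (- q (ln n) powr \<beta>)\<close> below \<open>\<Sum>\<^sub>n 1 / n\<^sup>2\<close>, so the stable subordinator wins and for small
  \<open>c\<close> the moment is summable over integer times.

  Upper bound: the first branching of the root already puts about \<open>exp (b powr (1 / \<beta>))\<close> children at
  distance at most \<open>b = C t\<^sup>\<gamma>\<close>.  The lower tail of the stable law makes it overwhelmingly likely,
  for large \<open>C\<close>, that the subordinator of one of them stays below \<open>b\<close> up to time \<open>t\<close>.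

  The exponent \<open>\<gamma>\<close> is the one for which both exponential rates are of order \<open>t powr (\<gamma> / \<beta>)\<close>.
  Borel--Cantelli and the monotonicity of the leftmost position conclude.
\<close>


section \<open>Measurability on the configuration space\<close>

text \<open>Birth times are random, while the noises are controlled only at deterministic times;
  this is the obstacle in the first moment. The time from each birth to the next one in a line of
  descent is therefore sorted into cells of length \<open>h\<close>. As motions are nondecreasing,
  reading each subordinator at the left end of its cell bounds positions from below and leaves one
  subordinator value and one Poisson event per ancestor. These noises are independent, so the
  expectation attached to a path is a product, and the sum over all paths is dominated by a
  geometric series. Rounding costs a bounded factor per generation if \<open>h\<close> is small.

  The second obstacle is that each truncation level may have its own noise: levels are linked only
  by the pruning of named particles. Whatever is compared between levels is therefore expressed by
  names and positions alone. Almost sure facts about single levels are collected over a countable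
  set of levels; the pruning relation itself holds for all levels at once.\<close>

lemma continuous_on_extended_by_zero:
  fixes f :: "real \<Rightarrow> real"
  assumes f: "continuous_on {0..} f" and c: "\<And>z. z > c \<Longrightarrow> f z = 0"
  shows "continuous_on UNIV (\<lambda>x::ennreal. if x < \<infinity> then f (enn2real x) else 0)" (is "continuous_on _ ?g")
proof -
  have 1: "continuous_on {x::ennreal. x < \<infinity>} ?g"
  proof -
    have "continuous_on {x::ennreal. x < \<infinity>} enn2real"
      unfolding continuous_on_def by (auto intro!: tendsto_enn2real tendsto_ident_at simp: less_top)
    then have "continuous_on {x::ennreal. x < \<infinity>} (\<lambda>x. f (enn2real x))"
      by (intro continuous_on_compose2[OF f]) auto
    then show ?thesis by (subst continuous_on_cong[OF refl, where g = "\<lambda>x. f (enn2real x)"]) auto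
  qed
  have "?g x = 0" if "x > ennreal (max c 0)" for x
  proof (cases "x < \<infinity>")
    case True
    then obtain r where r: "0 \<le> r" "x = ennreal r" by (cases x) auto
    with that have "r > c" by (auto simp: ennreal_less_iff max_def split: if_splits)
    then show ?thesis using r c by simp
  qed simp
  then have 2: "continuous_on {x. x > ennreal (max c 0)} ?g"
    by (subst continuous_on_cong[OF refl, where g = "\<lambda>x. 0"]) auto
  \<comment> \<open>Both sets are open and together they cover the type; the second one, on which
    the function is 0, is a neighbourhood of infinity.\<close>
  have "continuous_on ({x::ennreal. x < \<infinity>} \<union> {x. x > ennreal (max c 0)}) ?g"
    using open_lessThan[of "\<infinity>::ennreal"] open_greaterThan[of "ennreal (max c 0)"]
    by (intro continuous_on_open_Un 1 2) (auto simp: lessThan_def greaterThan_def)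
  moreover have "{x::ennreal. x < \<infinity>} \<union> {x. x > ennreal (max c 0)} = UNIV"
    by (auto simp: less_top[symmetric])
  ultimately show ?thesis by simp
qed

lemma config_space_eventually_above:
  assumes "x \<in> config_space" "c < \<infinity>"
  obtains N where "\<And>n. n \<ge> N \<Longrightarrow> x n > c"
proof -
  have "eventually (\<lambda>n. x n > c) sequentially"
    using assms order_tendstoD(1)[of x \<infinity> sequentially c] by (auto simp: config_space_def)
  then show ?thesis using that by (auto simp: eventually_sequentially)
qed

text \<open>Monotonicity puts every coordinate from \<open>N\<close> on beyond the support of
  \<open>f\<close>, so the integral reads only the first \<open>N\<close> coordinates. In this form
  it is visibly continuous for the product topology.\<close>

lemma config_integral_eq_sum:
  assumes x: "mono x" and N: "x N > ennreal (max c 0)" and c: "\<And>z. z > c \<Longrightarrow> f z = 0"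
  shows "config_integral f x = (\<Sum>n<N. if x n < \<infinity> then f (enn2real (x n)) else 0)"
proof -
  have "f (enn2real (x n)) = 0" if n: "n \<ge> N" "x n < \<infinity>" for n
  proof -
    have "x n > ennreal (max c 0)" using monoD[OF x n(1)] N by (rule less_le_trans[rotated])
    moreover obtain r where r: "0 \<le> r" "x n = ennreal r" using n(2) by (cases "x n") auto
    ultimately have "r > c" by (auto simp: ennreal_less_iff max_def split: if_splits)
    then show ?thesis using r c by simp
  qed
  then have "config_integral f x
      = (\<Sum>\<^sub>\<infinity>n\<in>{..<N}. if x n < \<infinity> then f (enn2real (x n)) else 0)"
    unfolding config_integral_def by (intro infsum_cong_neutral) auto
  then show ?thesis by simp
qed

text \<open>How many coordinates an integral reads depends on \<open>x\<close>, so a subbasic vague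
  set is cut into pieces on which \<open>x N\<close> exceeds the support bound. Each piece comes
  from an open set of the product topology, and on it the integral is a continuous function of
  finitely many coordinates.\<close>

lemma openin_vague_topologyD:
  assumes "openin vague_topology U"
  shows "\<exists>V. open V \<and> U = config_space \<inter> V"
  using assms unfolding vague_topology_def openin_topology_generated_by_iff
proof induction
  case (Int a b)
  then obtain V W where "open V" "a = config_space \<inter> V" "open W" "b = config_space \<inter> W" by auto
  then show ?case by (intro exI[of _ "V \<inter> W"]) auto
next
  case (UN K)
  then obtain V where "\<And>k. k \<in> K \<Longrightarrow> open (V k) \<and> k = config_space \<inter> V k" by metis
  then show ?case by (intro exI[of _ "\<Union>k\<in>K. V k"]) auto
next
  case (Basis s)
  then obtain f U c where s: "s = {x \<in> config_space. config_integral f x \<in> U}"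
    and f: "continuous_on {0..} f" and c: "\<forall>z>c. f z = 0" and U: "open U" by auto
  define g where "g = (\<lambda>x::ennreal. if x < \<infinity> then f (enn2real x) else 0)"
  define V where "V N = {x::config. x N > ennreal (max c 0)} \<inter> {x. (\<Sum>n<N. g (x n)) \<in> U}" for N
  have "open (V N)" for N
  proof -
    have "continuous_on UNIV (\<lambda>x::config. \<Sum>n<N. g (x n))"
      using continuous_on_extended_by_zero[OF f] c unfolding g_def[symmetric]
      by (intro continuous_on_sum continuous_on_compose2[OF _ continuous_on_product_coordinates]) auto
    then have "open {x::config. (\<Sum>n<N. g (x n)) \<in> U}"
      using U continuous_on_open_vimage[of UNIV "\<lambda>x::config. \<Sum>n<N. g (x n)"]
      by (simp add: vimage_def)
    moreover have "open {x::config. x N > ennreal (max c 0)}"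
      by (intro open_Collect_less continuous_on_const continuous_on_product_coordinates)
    ultimately show ?thesis unfolding V_def by auto
  qed
  moreover have "s = config_space \<inter> (\<Union>N. V N)"
  proof -
    have "x \<in> s \<longleftrightarrow> (\<exists>N. x \<in> V N)" if x: "x \<in> config_space" for x
    proof -
      have *: "config_integral f x = (\<Sum>n<N. g (x n))" if "x N > ennreal (max c 0)" for N
        unfolding g_def using x c that by (intro config_integral_eq_sum) (auto simp: config_space_def)
      obtain N where "x N > ennreal (max c 0)"
        using config_space_eventually_above[OF x, of "ennreal (max c 0)"] by auto
      with * have "x \<in> s \<longleftrightarrow> (\<exists>N. ennreal (max c 0) < x N \<and> config_integral f x \<in> U)"
        using x by (auto simp: s)
      then show ?thesis using * by (simp add: V_def cong: conj_cong)
    qed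
    then show ?thesis by (auto simp: s)
  qed
  ultimately show ?case by (intro exI[of _ "\<Union>N. V N"]) auto
qed auto

lemma space_Q_borel [simp]: "space Q_borel = config_space"
  unfolding Q_borel_def
  by (rule space_measure_of) (auto dest!: openin_vague_topologyD)

lemma sets_Q_borel': "sets Q_borel = sigma_sets config_space {U. openin vague_topology U}"
  unfolding Q_borel_def
  by (rule sets_measure_of) (auto dest!: openin_vague_topologyD)

text \<open>As indices start at 0, \<open>x n < a\<close> says that more than \<open>n\<close> atoms
  lie below \<open>a\<close>. The number of these atoms is the supremum of the integrals of the
  continuous functions \<open>f k\<close>, which increase to the indicator of
  \<open>z < a\<close>.\<close>

lemma coordinate_less_in_Q_borel:
  assumes "a \<ge> 0"
  shows "{x \<in> config_space. x n < ennreal a} \<in> sets Q_borel"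
proof -
  define f where "f k z = max 0 (min 1 (real k * (a - z)))" for k :: nat and z :: real
  have f0: "f k z = 0" if "z \<ge> a" for k z
    using that mult_nonneg_nonpos[of "real k" "a - z"] by (simp add: f_def)
  have "{x \<in> config_space. x n < ennreal a} =
      (\<Union>k. {x \<in> config_space. config_integral (f k) x \<in> {real n<..}})"
  proof -
    have "x n < ennreal a \<longleftrightarrow> (\<exists>k. config_integral (f k) x > real n)"
      if x: "x \<in> config_space" for x
    proof -
      obtain N where N: "\<And>i. i \<ge> N \<Longrightarrow> x i > ennreal (max a 0)"
        using config_space_eventually_above[OF x, of "ennreal (max a 0)"] by auto
      have mono: "mono x" using x by (simp add: config_space_def)
      have *: "config_integral (f k) x = (\<Sum>i<N. if x i < \<infinity> then f k (enn2real (x i)) else 0)" for k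
        by (rule config_integral_eq_sum[OF mono N]) (auto simp: f0)
      show ?thesis
      proof
        assume less: "x n < ennreal a"
        have nN: "n < N"
        proof (rule ccontr)
          assume "\<not> n < N"
          then have "ennreal a < x n" using N[of n] assms by simp
          then show False using less by simp
        qed
        obtain r where r: "0 \<le> r" "x n = ennreal r" "r < a"
          using less by (cases "x n") (auto simp: ennreal_less_iff)
        \<comment> \<open>This makes \<open>f k\<close> equal to 1 on the interval up to
          \<open>r\<close>, which contains the coordinates with index at most
          \<open>n\<close>.\<close>
        obtain k :: nat where k: "real k > 1 / (a - r)" using reals_Archimedean2 by blast
        have "f k (enn2real (x i)) = 1 \<and> x i < \<infinity>" if "i \<le> n" for i
        proof -
          have le: "x i \<le> ennreal r" using monoD[OF mono that] r by simp
          then have "enn2real (x i) \<le> r" by (simp add: enn2real_leI r)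
          then have "a - r \<le> a - enn2real (x i)" by simp
          then have "real k * (a - r) \<le> real k * (a - enn2real (x i))" by (intro mult_left_mono) auto
          moreover have "1 < real k * (a - r)" using k r by (simp add: field_simps)
          ultimately show ?thesis using le by (auto simp: f_def le_less_trans)
        qed
        then have "real (Suc n) = (\<Sum>i\<le>n. if x i < \<infinity> then f k (enn2real (x i)) else 0)" by simp
        also have "\<dots> \<le> config_integral (f k) x"
          unfolding * using nN by (intro sum_mono2) (auto simp: f_def)
        finally show "\<exists>k. config_integral (f k) x > real n" by (intro exI[of _ k]) simp
      next
        assume "\<exists>k. config_integral (f k) x > real n"
        then obtain k where k: "config_integral (f k) x > real n" by auto
        show "x n < ennreal a"
        proof (rule ccontr)
          assume "\<not> x n < ennreal a"
          then have ge: "x i \<ge> ennreal a" if "i \<ge> n" for i using monoD[OF mono that] by auto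
          have "f k (enn2real (x i)) = 0" if "i \<ge> n" "x i < \<infinity>" for i
          proof -
            have "enn2real (ennreal a) \<le> enn2real (x i)"
              using ge[OF that(1)] that(2) by (intro enn2real_mono) auto
            then have "a \<le> enn2real (x i)" using assms by simp
            then show ?thesis by (simp add: f0)
          qed
          then have "config_integral (f k) x \<le> (\<Sum>i<N. if i < n then 1 else 0)"
            unfolding * by (intro sum_mono) (auto simp: f_def)
          also have "\<dots> = real (card ({..<N} \<inter> {..<n}))" by (simp add: sum.If_cases lessThan_def)
          also have "\<dots> \<le> real n"
            using card_mono[of "{..<n}" "{..<N} \<inter> {..<n}"] by simp
          finally show False using k by simp
        qed
      qed
    qed
    then show ?thesis by auto
  qed
  moreover have "{x \<in> config_space. config_integral (f k) x \<in> {real n<..}} \<in> sets Q_borel" for k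
  proof -
    have "continuous_on {0..} (f k)" unfolding f_def by (intro continuous_intros)
    moreover have "\<forall>z>a. f k z = 0" by (auto simp: f0)
    ultimately have "openin vague_topology {x \<in> config_space. config_integral (f k) x \<in> {real n<..}}"
      unfolding vague_topology_def openin_topology_generated_by_iff
      by (intro generate_topology_on.Basis CollectI exI[of _ "f k"] exI[of _ "{real n<..}"]
          conjI refl exI[of _ a]) auto
    then show ?thesis by (auto simp: sets_Q_borel')
  qed
  ultimately show ?thesis by simp
qed

lemma measurable_coordinate_Q_borel [measurable]: "(\<lambda>x. x n) \<in> borel_measurable Q_borel"
proof (rule borel_measurableI_less)
  fix y :: ennreal
  show "{x \<in> space Q_borel. x n < y} \<in> sets Q_borel"
  proof (cases y)
    case (real r)
    then show ?thesis using coordinate_less_in_Q_borel[of r n] by simp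
  next
    case top
    have "{x \<in> space Q_borel. x n < y} = (\<Union>k::nat. {x \<in> config_space. x n < ennreal (real k)})"
    proof -
      have "\<exists>k::nat. x n < ennreal (real k)" if lt: "x n < \<infinity>" for x :: config
      proof -
        obtain r where r: "0 \<le> r" "x n = ennreal r" using lt by (cases "x n") auto
        obtain k :: nat where "r < real k" using reals_Archimedean2 by blast
        then show ?thesis using r by (auto simp: ennreal_less_iff)
      qed
      then show ?thesis using top by (auto simp: less_top[symmetric] top_unique)
    qed
    then show ?thesis using coordinate_less_in_Q_borel by auto
  qed
qed

text \<open>One inclusion holds because vaguely open sets are traces of product-open ones, the other
  because all coordinates are vaguely Borel. Measurability into \<open>Q_borel\<close> can then be
  tested coordinate by coordinate.\<close>

lemma sets_Q_borel: "sets Q_borel = sets (restrict_space borel config_space)"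
proof
  show "sets Q_borel \<subseteq> sets (restrict_space borel config_space)"
  proof -
    have "sigma_sets config_space {U. openin vague_topology U}
        \<subseteq> sigma_sets (space (restrict_space borel config_space)) (sets (restrict_space borel config_space))"
      by (simp add: space_restrict_space, rule sigma_sets_mono')
        (auto dest!: openin_vague_topologyD simp: sets_restrict_space)
    then show ?thesis unfolding sets_Q_borel' sets.sigma_sets_eq .
  qed
  have "(\<lambda>x. x) \<in> borel_measurable Q_borel"
    by (rule measurable_coordinatewise_then_product) simp
  then show "sets (restrict_space borel config_space) \<subseteq> sets Q_borel"
    by (auto simp: sets_restrict_space measurable_def Int_commute)
qed

lemma measurable_into_Q_borel:
  assumes "\<And>n. (\<lambda>x. f x n) \<in> borel_measurable N" "f \<in> space N \<rightarrow> config_space"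
  shows "f \<in> measurable N Q_borel"
proof -
  have "f \<in> borel_measurable N"
    by (rule measurable_coordinatewise_then_product) (fact assms(1))
  then have "f \<in> measurable N (restrict_space borel config_space)"
    using assms(2) by (intro measurable_restrict_space2) auto
  then show ?thesis by (simp cong: measurable_cong_sets add: sets_Q_borel)
qed

lemma singleton_in_Q_borel:
  assumes "y \<in> config_space"
  shows "{y} \<in> sets Q_borel"
proof -
  have "{y} = {x \<in> space Q_borel. \<forall>n. x n = y n}" using assms by auto
  also have "\<dots> \<in> sets Q_borel" by measurable
  finally show ?thesis .
qed

lemma Q_star_in_Q_borel [measurable]: "Q_star \<in> sets Q_borel"
proof -
  have "Q_star = {x \<in> space Q_borel. x 1 < \<infinity>}" by (auto simp: Q_star_def)
  also have "\<dots> \<in> sets Q_borel" by measurable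
  finally show ?thesis .
qed

section \<open>One-point and truncated configurations\<close>

lemma one_point_in_config_space: "one_point z \<in> config_space"
proof -
  have "(one_point z \<longlongrightarrow> \<infinity>) sequentially"
    by (rule Lim_transform_eventually[OF tendsto_const])
      (auto simp: one_point_def eventually_sequentially intro!: exI[of _ 1])
  then show ?thesis by (auto simp: config_space_def one_point_def mono_def)
qed

lemma measurable_one_point [measurable]: "(\<lambda>z. one_point (ennreal z)) \<in> measurable borel Q_borel"
  by (rule measurable_into_Q_borel) (auto simp: one_point_in_config_space, simp add: one_point_def)

lemma one_point_notin_Q_star: "one_point z \<notin> Q_star"
  by (auto simp: Q_star_def one_point_def)

lemma trunc_in_config_space:
  assumes "x \<in> config_space"
  shows "trunc a x \<in> config_space"
proof -
  have m: "mono x" and l: "x \<longlonglongrightarrow> \<infinity>" using assms by (auto simp: config_space_def)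
  have "mono (trunc a x)"
    using m by (auto simp: mono_def trunc_def) (meson order.strict_trans1)+
  moreover obtain N where N: "\<And>n. n \<ge> N \<Longrightarrow> x n > ennreal a"
    using config_space_eventually_above[OF assms, of "ennreal a"] by auto
  have "trunc a x n = \<infinity>" if "n \<ge> Suc N" for n
    using N[of n] that by (auto simp: trunc_def)
  then have "eventually (\<lambda>n. trunc a x n = \<infinity>) sequentially"
    unfolding eventually_sequentially by blast
  ultimately show ?thesis
    by (simp add: config_space_def tendsto_eventually)
qed

lemma measurable_trunc [measurable]: "trunc a \<in> measurable Q_borel Q_borel"
  by (rule measurable_into_Q_borel) (auto simp: trunc_in_config_space, simp add: trunc_def)

lemma trunc_one_point [simp]: "trunc a (one_point z) = one_point z"
  by (auto simp: trunc_def one_point_def)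

section \<open>The measure $\Lambda^{ri}_{\alpha,\beta}$ and its truncations\<close>

lemma log_config_in_config_space:
  assumes "0 < \<beta>"
  shows "log_config \<beta> \<in> config_space"
proof -
  have "mono (log_config \<beta>)"
    using assms by (auto simp: mono_def log_config_def intro!: ennreal_leI powr_mono2)
  moreover have "filterlim (\<lambda>n. ln (real (Suc n)) powr \<beta>) at_top sequentially"
    using assms by (intro filterlim_compose[OF real_powr_at_top] filterlim_compose[OF ln_at_top]
        filterlim_compose[OF filterlim_real_sequentially] filterlim_Suc) auto
  then have "log_config \<beta> \<longlonglongrightarrow> \<infinity>"
  proof (intro order_tendstoI)
    fix l :: ennreal assume "l < \<infinity>"
    then obtain r where r: "0 \<le> r" "l = ennreal r" by (cases l) auto
    assume "filterlim (\<lambda>n. ln (real (Suc n)) powr \<beta>) at_top sequentially"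
    then have "eventually (\<lambda>n. r < ln (real (Suc n)) powr \<beta>) sequentially"
      by (auto simp: filterlim_at_top_dense)
    then show "eventually (\<lambda>n. l < log_config \<beta> n) sequentially"
      by eventually_elim (use r in \<open>auto simp: log_config_def ennreal_less_iff\<close>)
  qed auto
  ultimately show ?thesis by (auto simp: config_space_def)
qed

lemma log_config_0 [simp]: "log_config \<beta> 0 = 0"
  by (simp add: log_config_def)

lemma sets_stable_levy_measure [simp, measurable_cong]: "sets (stable_levy_measure \<alpha>) = sets borel"
  by (simp add: stable_levy_measure_def)

lemma space_stable_levy_measure [simp]: "space (stable_levy_measure \<alpha>) = UNIV"
  by (simp add: stable_levy_measure_def)

lemma AE_stable_levy_measure_pos: "AE z in stable_levy_measure \<alpha>. z > 0"
  unfolding stable_levy_measure_def by (subst AE_density) (auto simp: indicator_def)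

lemma sets_Lambda_ri [simp, measurable_cong]: "sets (Lambda_ri \<alpha> \<beta>) = sets Q_borel"
  unfolding Lambda_ri_def
  using sets.space_closed[of Q_borel] sets.sigma_sets_eq[of Q_borel]
  by (subst sets_measure_of) simp_all

lemma space_Lambda_ri [simp]: "space (Lambda_ri \<alpha> \<beta>) = config_space"
  using sets_eq_imp_space_eq[OF sets_Lambda_ri] by simp

text \<open>\<open>measure_of\<close> returns the prescribed set function only once that function is
  known to be countably additive; this is what has to be checked for the sum.\<close>

lemma emeasure_Lambda_ri:
  assumes "A \<in> sets Q_borel"
  shows "emeasure (Lambda_ri \<alpha> \<beta>) A
    = emeasure (stable_levy_measure \<alpha>) {z. one_point (ennreal z) \<in> A} + indicator A (log_config \<beta>)"
proof -
  have "emeasure (Lambda_ri \<alpha> \<beta>) A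
    = emeasure (stable_config_measure \<alpha>) A + emeasure (return Q_borel (log_config \<beta>)) A"
    unfolding Lambda_ri_def
  proof (rule emeasure_measure_of_sigma)
    show "sigma_algebra config_space (sets Q_borel)"
      using sets.sigma_algebra_axioms[of Q_borel] by simp
    show "positive (sets Q_borel)
      (\<lambda>A. emeasure (stable_config_measure \<alpha>) A + emeasure (return Q_borel (log_config \<beta>)) A)"
      by (simp add: positive_def)
    show "countably_additive (sets Q_borel)
      (\<lambda>A. emeasure (stable_config_measure \<alpha>) A + emeasure (return Q_borel (log_config \<beta>)) A)"
    proof (unfold countably_additive_def, safe)
      fix A :: "nat \<Rightarrow> config set"
      assume A: "range A \<subseteq> sets Q_borel" "disjoint_family A"
      have "(\<Sum>i. emeasure (stable_config_measure \<alpha>) (A i)) = emeasure (stable_config_measure \<alpha>) (\<Union>i. A i)"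
        "(\<Sum>i. emeasure (return Q_borel (log_config \<beta>)) (A i)) = emeasure (return Q_borel (log_config \<beta>)) (\<Union>i. A i)"
        using A by (auto intro!: suminf_emeasure simp: stable_config_measure_def simp del: emeasure_return)
      then show "(\<Sum>i. emeasure (stable_config_measure \<alpha>) (A i) + emeasure (return Q_borel (log_config \<beta>)) (A i))
        = emeasure (stable_config_measure \<alpha>) (\<Union>i. A i) + emeasure (return Q_borel (log_config \<beta>)) (\<Union>i. A i)"
        by (simp add: suminf_add[symmetric] del: emeasure_return)
    qed
  qed fact
  also have "emeasure (stable_config_measure \<alpha>) A
    = emeasure (stable_levy_measure \<alpha>) {z. one_point (ennreal z) \<in> A}"
    unfolding stable_config_measure_def
    using assms by (subst emeasure_distr) (auto simp: vimage_def cong: measurable_cong_sets)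
  finally show ?thesis using assms by simp
qed

lemma sets_trunc_measure [simp, measurable_cong]: "sets (trunc_measure \<Lambda> a) = sets Q_borel"
  by (simp add: trunc_measure_def)

lemma space_trunc_measure [simp]: "space (trunc_measure \<Lambda> a) = config_space"
  using sets_eq_imp_space_eq[OF sets_trunc_measure] by simp

lemma emeasure_trunc_measure:
  assumes "A \<in> sets Q_borel" "sets \<Lambda> = sets Q_borel"
  shows "emeasure (trunc_measure \<Lambda> a) A
    = emeasure \<Lambda> {x \<in> config_space. trunc a x \<in> A - {one_point 0}}"
proof -
  have 1: "{one_point 0} \<in> sets Q_borel"
    by (intro singleton_in_Q_borel one_point_in_config_space)
  have 2: "space \<Lambda> = config_space" using sets_eq_imp_space_eq[OF assms(2)] by simp
  have 3: "config_space - {one_point 0} \<in> sets Q_borel"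
    using sets.compl_sets[OF 1] by simp
  have "(indicator (- {one_point 0}) :: config \<Rightarrow> ennreal) \<in> borel_measurable Q_borel"
    using 3 by (subst borel_measurable_indicator_iff) (simp add: Diff_eq[symmetric] Int_commute Int_absorb)
  then have "emeasure (trunc_measure \<Lambda> a) A
    = (\<integral>\<^sup>+x. indicator (- {one_point 0}) x * indicator A x \<partial>distr \<Lambda> Q_borel (trunc a))"
    unfolding trunc_measure_def using assms by (subst emeasure_density) auto
  also have "\<dots> = (\<integral>\<^sup>+x. indicator (A - {one_point 0}) x \<partial>distr \<Lambda> Q_borel (trunc a))"
    by (intro nn_integral_cong) (auto simp: indicator_def)
  also have "\<dots> = emeasure (distr \<Lambda> Q_borel (trunc a)) (A - {one_point 0})"
    using assms 1 by (intro nn_integral_indicator) auto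
  also have "\<dots> = emeasure \<Lambda> {x \<in> config_space. trunc a x \<in> A - {one_point 0}}"
    using assms 1 2 by (subst emeasure_distr)
      (auto simp: vimage_def Int_def conj_commute cong: measurable_cong_sets intro!: arg_cong2[where f = emeasure])
  finally show ?thesis .
qed

text \<open>Truncation fixes one-point configurations, so only the atom
  \<open>log_config \<beta>\<close> is moved.\<close>

lemma emeasure_trunc_Lambda_ri:
  assumes "A \<in> sets Q_borel" "0 < \<beta>"
  shows "emeasure (trunc_measure (Lambda_ri \<alpha> \<beta>) a) A
    = emeasure (stable_levy_measure \<alpha>) {z. one_point (ennreal z) \<in> A - {one_point 0}}
      + indicator (A - {one_point 0}) (trunc a (log_config \<beta>))"
proof -
  have 1: "{one_point 0} \<in> sets Q_borel"
    by (intro singleton_in_Q_borel one_point_in_config_space)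
  have "{x \<in> config_space. trunc a x \<in> A - {one_point 0}}
    = trunc a -` (A - {one_point 0}) \<inter> space Q_borel" by auto
  also have "\<dots> \<in> sets Q_borel" using assms 1 by (intro measurable_sets[OF measurable_trunc]) auto
  finally show ?thesis
    using assms by (subst emeasure_trunc_measure)
      (auto simp: emeasure_Lambda_ri one_point_in_config_space log_config_in_config_space indicator_def
        intro!: arg_cong2[where f = emeasure])
qed

lemma one_point_inject: "one_point z = one_point w \<longleftrightarrow> z = w"
  by (auto simp: one_point_def dest: fun_cong[of _ _ 0])

lemma trunc_log_config_in_Q_star:
  assumes "0 < \<beta>" "ln 2 powr \<beta> < a"
  shows "trunc a (log_config \<beta>) \<in> Q_star"
proof -
  have "trunc a (log_config \<beta>) 1 < \<infinity>"
    using assms by (simp add: trunc_def log_config_def ennreal_less_iff numeral_2_eq_2[symmetric])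
  then show ?thesis
    using assms by (simp add: Q_star_def trunc_in_config_space log_config_in_config_space)
qed

text \<open>The stable part charges only one-point configurations, and for this range of
  \<open>a\<close> the second point of the logarithmic configuration, at
  \<open>ln 2 powr \<beta>\<close>, survives truncation. Hence branchings occur at rate 1 and always
  with the same configuration.\<close>

lemma restrict_trunc_Lambda_ri_Q_star:
  assumes "0 < \<beta>" "ln 2 powr \<beta> < a"
  shows "restrict_space (trunc_measure (Lambda_ri \<alpha> \<beta>) a) Q_star
    = return (restrict_space Q_borel Q_star) (trunc a (log_config \<beta>))"
proof (rule measure_eqI)
  show "sets (restrict_space (trunc_measure (Lambda_ri \<alpha> \<beta>) a) Q_star)
    = sets (return (restrict_space Q_borel Q_star) (trunc a (log_config \<beta>)))"
    by (simp cong: sets_restrict_space_cong)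
next
  fix A assume "A \<in> sets (restrict_space (trunc_measure (Lambda_ri \<alpha> \<beta>) a) Q_star)"
  then have A: "A \<in> sets Q_borel" "A \<subseteq> Q_star"
    by (auto simp: sets_restrict_space)
  then have "one_point z \<notin> A" for z using one_point_notin_Q_star by auto
  moreover have "A \<in> sets (restrict_space Q_borel Q_star)"
    using A by (auto simp: sets_restrict_space image_iff intro!: bexI[of _ A])
  moreover have "Q_star \<inter> config_space = Q_star" by (auto simp: Q_star_def)
  ultimately show "emeasure (restrict_space (trunc_measure (Lambda_ri \<alpha> \<beta>) a) Q_star) A
    = emeasure (return (restrict_space Q_borel Q_star) (trunc a (log_config \<beta>))) A"
    using A assms one_point_notin_Q_star[of 0] trunc_log_config_in_Q_star[OF assms]
    by (subst emeasure_restrict_space) (auto simp: emeasure_trunc_Lambda_ri indicator_def)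
qed

lemma emeasure_branching_intensity:
  assumes "0 < \<beta>" "ln 2 powr \<beta> < a"
    and I: "I \<in> sets borel" "I \<subseteq> {0..}" and S: "S \<in> sets Q_borel" "S \<subseteq> Q_star"
  shows "I \<times> S \<in> sets (branching_intensity (Lambda_ri \<alpha> \<beta>) a)"
    and "emeasure (branching_intensity (Lambda_ri \<alpha> \<beta>) a) (I \<times> S)
      = emeasure lborel I * indicator S (trunc a (log_config \<beta>))"
proof -
  have 1: "I \<in> sets (restrict_space lborel {0..})"
    using I by (auto simp: sets_restrict_space image_iff intro!: bexI[of _ I])
  have 2: "S \<in> sets (restrict_space Q_borel Q_star)"
    using S by (auto simp: sets_restrict_space image_iff intro!: bexI[of _ S])
  have 3: "trunc a (log_config \<beta>) \<in> space (restrict_space Q_borel Q_star)"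
    using trunc_log_config_in_Q_star[OF assms(1,2)] by (simp add: space_restrict_space Q_star_def)
  \<comment> \<open>A probability measure is sigma-finite, which the product formula for rectangles
    requires of the second factor.\<close>
  interpret prob_space "return (restrict_space Q_borel Q_star) (trunc a (log_config \<beta>))"
    using 3 by (rule prob_space_return)
  show "I \<times> S \<in> sets (branching_intensity (Lambda_ri \<alpha> \<beta>) a)"
    unfolding branching_intensity_def restrict_trunc_Lambda_ri_Q_star[OF assms(1,2)]
    using 1 2 by (intro pair_measureI) auto
  show "emeasure (branching_intensity (Lambda_ri \<alpha> \<beta>) a) (I \<times> S)
      = emeasure lborel I * indicator S (trunc a (log_config \<beta>))"
    unfolding branching_intensity_def restrict_trunc_Lambda_ri_Q_star[OF assms(1,2)]
    using 1 2 I by (subst emeasure_pair_measure_Times) (auto simp: emeasure_restrict_space)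
qed

lemma space_branching_intensity:
  assumes "0 < \<beta>" "ln 2 powr \<beta> < a"
  shows "space (branching_intensity (Lambda_ri \<alpha> \<beta>) a) = {0..} \<times> Q_star"
  by (auto simp: branching_intensity_def space_pair_measure space_restrict_space Q_star_def)

text \<open>The first coordinate is untouched by truncation and the truncated atom lies in
  \<open>Q_star\<close>, so at every such level the subordinators have the same stable law.\<close>

lemma nonbranching_levy_measure_Lambda_ri:
  assumes "0 < \<beta>" "ln 2 powr \<beta> < a"
  shows "nonbranching_levy_measure (Lambda_ri \<alpha> \<beta>) a = stable_levy_measure \<alpha>"
proof (rule measure_eqI)
  show "sets (nonbranching_levy_measure (Lambda_ri \<alpha> \<beta>) a) = sets (stable_levy_measure \<alpha>)"
    by (simp add: nonbranching_levy_measure_def)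
next
  fix B assume "B \<in> sets (nonbranching_levy_measure (Lambda_ri \<alpha> \<beta>) a)"
  then have B [measurable]: "B \<in> sets borel" by (simp add: nonbranching_levy_measure_def)
  have R: "config_space - Q_star \<in> sets Q_borel" "(config_space - Q_star) \<inter> config_space = config_space - Q_star"
    using sets.compl_sets[OF Q_star_in_Q_borel] by auto
  have m: "(\<lambda>x. enn2real (x 0)) \<in> borel_measurable (restrict_space (trunc_measure (Lambda_ri \<alpha> \<beta>) a) (config_space - Q_star))"
    by (intro measurable_restrict_space1) (simp cong: measurable_cong_sets)
  define C where "C = {x \<in> config_space - Q_star. enn2real (x 0) \<in> B}"
  have "C = (\<lambda>x. enn2real (x 0)) -` B \<inter> space Q_borel \<inter> (config_space - Q_star)"
    by (auto simp: C_def)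
  also have "\<dots> \<in> sets Q_borel" using R by (intro sets.Int measurable_sets[of _ _ borel]) auto
  finally have C: "C \<in> sets Q_borel" .
  have "emeasure (nonbranching_levy_measure (Lambda_ri \<alpha> \<beta>) a) B
    = emeasure (trunc_measure (Lambda_ri \<alpha> \<beta>) a) C"
    unfolding nonbranching_levy_measure_def using R
    by (subst emeasure_distr[OF m B], subst emeasure_restrict_space)
      (auto simp: C_def space_restrict_space intro!: arg_cong2[where f = emeasure])
  also have "\<dots> = emeasure (stable_levy_measure \<alpha>) {z. one_point (ennreal z) \<in> C - {one_point 0}}"
    using C assms trunc_log_config_in_Q_star[OF assms]
    by (subst emeasure_trunc_Lambda_ri) (auto simp: C_def)
  also have "\<dots> = emeasure (stable_levy_measure \<alpha>) B"
  proof (rule emeasure_eq_AE)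
    \<comment> \<open>For \<open>z > 0\<close> the conversion to extended reals and back is the
      identity and \<open>one_point 0\<close> is not met; almost every \<open>z\<close> is
      positive.\<close>
    show "AE z in stable_levy_measure \<alpha>. (z \<in> {z. one_point (ennreal z) \<in> C - {one_point 0}}) = (z \<in> B)"
      using AE_stable_levy_measure_pos
      by eventually_elim
        (auto simp: C_def one_point_in_config_space one_point_notin_Q_star one_point_inject,
          auto simp: one_point_def)
    have "{z. one_point (ennreal z) \<in> C - {one_point 0}}
      = (\<lambda>z. one_point (ennreal z)) -` (C - {one_point 0}) \<inter> space borel" by auto
    also have "\<dots> \<in> sets borel"
      using C by (intro measurable_sets[OF measurable_one_point] sets.Diff singleton_in_Q_borel
          one_point_in_config_space)
    finally show "{z. one_point (ennreal z) \<in> C - {one_point 0}} \<in> sets (stable_levy_measure \<alpha>)"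
      by simp
  qed simp
  finally show "emeasure (nonbranching_levy_measure (Lambda_ri \<alpha> \<beta>) a) B = emeasure (stable_levy_measure \<alpha>) B" .
qed

section \<open>Laplace exponent of the stable subordinator\<close>

definition stable_exponent :: "real \<Rightarrow> real" where
  "stable_exponent \<alpha> = (\<integral>z. 1 - exp (- z) \<partial>stable_levy_measure \<alpha>)"

text \<open>Self-similarity: substituting \<open>z / q\<close> for \<open>z\<close> extracts
  \<open>q powr (\<alpha> + 1)\<close> from the density and \<open>1 / q\<close> from Lebesgue
  measure.\<close>

lemma integral_stable_levy_measure:
  assumes "0 < \<alpha>" "\<alpha> < 1" "0 < q"
  shows "(\<integral>z. 1 - exp (- q * z) \<partial>stable_levy_measure \<alpha>) = stable_exponent \<alpha> * q powr \<alpha>"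
proof -
  define c where "c = \<alpha> / Gamma (1 - \<alpha>)"
  have c: "c > 0" using assms by (auto simp: c_def Gamma_real_pos)
  define f where "f z = indicator {0<..} z * (c / z powr (\<alpha> + 1))" for z :: real
  have [measurable]: "f \<in> borel_measurable borel" unfolding f_def by measurable
  have *: "stable_levy_measure \<alpha> = density lborel (\<lambda>z. ennreal (f z))"
    by (simp add: stable_levy_measure_def f_def c_def)
  have f0: "f z \<ge> 0" for z using c by (simp add: f_def)
  have "(\<integral>z. 1 - exp (- q * z) \<partial>stable_levy_measure \<alpha>) = (\<integral>z. f z * (1 - exp (- q * z)) \<partial>lborel)"
    unfolding * using f0 by (subst integral_real_density) auto
  also have "\<dots> = \<bar>1 / q\<bar> *\<^sub>R (\<integral>z. f (0 + (1/q) * z) * (1 - exp (- q * (0 + (1/q) * z))) \<partial>lborel)"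
    using assms by (subst lborel_integral_real_affine[where c = "1 / q" and t = 0]) auto
  also have "(\<lambda>z. f (0 + (1/q) * z) * (1 - exp (- q * (0 + (1/q) * z))))
    = (\<lambda>z. q powr (\<alpha> + 1) * (f z * (1 - exp (- z))))"
    using assms by (auto simp: f_def indicator_def powr_divide zero_less_divide_iff)
  also have "(\<integral>z. q powr (\<alpha> + 1) * (f z * (1 - exp (- z))) \<partial>lborel)
    = q powr (\<alpha> + 1) * stable_exponent \<alpha>"
    unfolding stable_exponent_def * using f0 by (subst integral_real_density) auto
  finally show ?thesis using assms by (simp add: powr_add)
qed

text \<open>A Bochner integral that diverges has the value 0, so integrability must come first. It
  is read off from the condition on \<open>min 1 (x 0)\<close> in the characteristic couple, since
  \<open>1 - exp (- z)\<close> is at most \<open>min 1 z\<close>.\<close>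

lemma stable_exponent_pos:
  assumes "0 < \<alpha>" "\<alpha> < 1" "0 < \<beta>" and couple: "characteristic_couple 0 (Lambda_ri \<alpha> \<beta>)"
  shows "0 < stable_exponent \<alpha>"
proof -
  \<comment> \<open>A level above \<open>ln 2 powr \<beta>\<close>, where the stable measure is an
    image of the truncated measure.\<close>
  define a where "a = ln 2 powr \<beta> + 1"
  define T where "T = trunc_measure (Lambda_ri \<alpha> \<beta>) a"
  have R: "config_space - Q_star \<in> sets Q_borel" "(config_space - Q_star) \<inter> config_space = config_space - Q_star"
    using sets.compl_sets[OF Q_star_in_Q_borel] by auto
  have [measurable_cong]: "sets T = sets Q_borel" by (simp add: T_def)
  have ind: "(indicator (- {one_point 0}) :: config \<Rightarrow> ennreal) \<in> borel_measurable Q_borel"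
    using sets.compl_sets[OF singleton_in_Q_borel[OF one_point_in_config_space[of 0]]]
    by (subst borel_measurable_indicator_iff) (simp add: Diff_eq[symmetric] Int_commute Int_absorb)
  have "(\<integral>\<^sup>+z. min 1 (ennreal z) \<partial>stable_levy_measure \<alpha>)
    = (\<integral>\<^sup>+x. min 1 (ennreal (enn2real (x 0))) \<partial>restrict_space T (config_space - Q_star))"
    using assms
    by (subst nonbranching_levy_measure_Lambda_ri[of \<beta> a, symmetric])
      (auto simp: a_def nonbranching_levy_measure_def T_def cong: measurable_cong_sets
        intro!: nn_integral_distr measurable_restrict_space1)
  also have "\<dots> \<le> (\<integral>\<^sup>+x. min 1 (x 0) \<partial>T)"
  proof (subst nn_integral_restrict_space)
    show "(config_space - Q_star) \<inter> space T \<in> sets T" using R by (simp add: T_def)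
    have "ennreal (enn2real x) \<le> x" for x by (cases x) auto
    then show "(\<integral>\<^sup>+x. min 1 (ennreal (enn2real (x 0))) * indicator (config_space - Q_star) x \<partial>T)
      \<le> (\<integral>\<^sup>+x. min 1 (x 0) \<partial>T)"
      by (intro nn_integral_mono) (auto simp: indicator_def intro: min.mono order_trans min.coboundedI2)
  qed
  also have "\<dots> = (\<integral>\<^sup>+x. indicator (- {one_point 0}) x * min 1 (x 0) \<partial>distr (Lambda_ri \<alpha> \<beta>) Q_borel (trunc a))"
    unfolding T_def trunc_measure_def
    using ind by (subst nn_integral_density) (auto cong: measurable_cong_sets)
  also have "\<dots> \<le> (\<integral>\<^sup>+x. min 1 (x 0) \<partial>distr (Lambda_ri \<alpha> \<beta>) Q_borel (trunc a))"
    by (intro nn_integral_mono) (auto simp: indicator_def)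
  also have "\<dots> = (\<integral>\<^sup>+x. min 1 (trunc a x 0) \<partial>Lambda_ri \<alpha> \<beta>)"
    by (subst nn_integral_distr) (auto cong: measurable_cong_sets)
  also have "\<dots> = (\<integral>\<^sup>+x. min 1 (x 0) \<partial>Lambda_ri \<alpha> \<beta>)" by (simp add: trunc_def)
  also have "\<dots> < \<infinity>" using couple by (simp add: characteristic_couple_def)
  finally have fin: "(\<integral>\<^sup>+z. min 1 (ennreal z) \<partial>stable_levy_measure \<alpha>) < \<infinity>" .
  have pos: "AE z in stable_levy_measure \<alpha>. 0 < 1 - exp (- z)"
    using AE_stable_levy_measure_pos by eventually_elim simp
  have "integrable (stable_levy_measure \<alpha>) (\<lambda>z. 1 - exp (- z))"
  proof (rule integrableI_bounded)
    have "(\<integral>\<^sup>+z. ennreal (norm (1 - exp (- z))) \<partial>stable_levy_measure \<alpha>)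
      \<le> (\<integral>\<^sup>+z. min 1 (ennreal z) \<partial>stable_levy_measure \<alpha>)"
    proof (rule nn_integral_mono_AE, use AE_stable_levy_measure_pos in eventually_elim)
      case (elim z)
      have "1 - exp (- z) \<le> z" using exp_ge_add_one_self[of "- z"] by simp
      then show ?case using elim by (auto simp: min_def intro!: ennreal_leI)
    qed
    then show "(\<integral>\<^sup>+z. ennreal (norm (1 - exp (- z))) \<partial>stable_levy_measure \<alpha>) < \<infinity>"
      using fin by (rule le_less_trans)
  qed simp
  moreover have "stable_exponent \<alpha> \<noteq> 0"
  proof
    assume "stable_exponent \<alpha> = 0"
    then have "AE z in stable_levy_measure \<alpha>. 1 - exp (- z) = 0"
      unfolding stable_exponent_def using pos calculation
      by (subst (asm) integral_nonneg_eq_0_iff_AE) (auto elim!: eventually_mono)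
    then have "AE z in stable_levy_measure \<alpha>. False" using pos by eventually_elim auto
    \<comment> \<open>A vanishing integral makes the stable measure null, although its density is
      positive on the unit interval, which has positive length.\<close>
    then have "AE z in lborel. (0::real) < z \<longrightarrow> \<not> 0 < ennreal (\<alpha> / Gamma (1 - \<alpha>) / z powr (\<alpha> + 1))"
      unfolding stable_levy_measure_def by (subst (asm) AE_density) (auto elim!: eventually_mono)
    then have "AE z in lborel. z \<notin> {0<..<1::real}"
      using assms by (rule_tac AE_mp) (auto simp: Gamma_real_pos)
    then have "emeasure lborel {0<..<1::real} = 0"
      by (subst (asm) AE_iff_measurable[OF _ refl]) (auto simp: greaterThanLessThan_def greaterThan_def lessThan_def Int_def)
    then show False by simp
  qed
  moreover have "stable_exponent \<alpha> \<ge> 0"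
    unfolding stable_exponent_def using pos by (intro integral_nonneg_AE) (auto elim!: eventually_mono)
  ultimately show ?thesis by simp
qed

section \<open>Pathwise properties\<close>

text \<open>One realisation of the noise. All branchings carry the same configuration
  \<open>y\<close> because the intensity is Lebesgue measure times a point mass.\<close>

locale branching_path =
  fixes xi :: "slot \<Rightarrow> real \<Rightarrow> real" and P :: "slot \<Rightarrow> (real \<times> config) set" and y :: config
  assumes xi_0 [simp]: "xi v 0 = 0"
    and xi_mono: "0 \<le> s \<Longrightarrow> s \<le> t \<Longrightarrow> xi v s \<le> xi v t"
    and y_0 [simp]: "y 0 = 0"
    and points: "P v \<subseteq> {0<..} \<times> {y}"
    and infinite_points: "infinite (P v)"
    and finite_points: "finite {b \<in> P v. fst b \<le> s}"
begin

abbreviation "B \<equiv> birth_time P"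
abbreviation "X \<equiv> trajectory xi P"

definition "T v k = fst (kth_branching (P v) k)"
definition "N v s = card {b \<in> P v. fst b \<le> s}"

section \<open>Enumeration of the branching times of one particle\<close>

lemma point_eqI: "b \<in> P v \<Longrightarrow> c \<in> P v \<Longrightarrow> fst b = fst c \<Longrightarrow> b = c"
  using points[of v] by (cases b; cases c) auto

lemma finite_points_less: "finite {b \<in> P v. fst b < s}"
  by (rule finite_subset[OF _ finite_points[of v s]]) auto

lemma next_point: "\<exists>b\<in>P v. s < fst b \<and> (\<forall>c\<in>P v. s < fst c \<longrightarrow> fst b \<le> fst c)"
proof -
  have "infinite (P v - {b \<in> P v. fst b \<le> s})"
    using infinite_points finite_points by (simp add: Diff_infinite_finite)
  then have "P v - {b \<in> P v. fst b \<le> s} \<noteq> {}" by (metis finite.emptyI)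
  then obtain b where b: "b \<in> P v" "s < fst b" by force
  let ?A = "{c \<in> P v. s < fst c \<and> fst c \<le> fst b}"
  have "finite ?A" by (rule finite_subset[OF _ finite_points[of v "fst b"]]) auto
  then have fin: "finite (fst ` ?A)" by simp
  have "b \<in> ?A" using b by auto
  then have ne: "fst ` ?A \<noteq> {}" by blast
  obtain c where c: "c \<in> ?A" "fst c = Min (fst ` ?A)" using Min_in[OF fin ne] by fastforce
  have "fst c \<le> fst d" if "d \<in> P v" "s < fst d" for d
  proof (cases "fst d \<le> fst b")
    case True
    then have "fst d \<in> fst ` ?A" using that by auto
    then show ?thesis using fin c by simp
  next
    case False
    then show ?thesis using c by auto
  qed
  then show ?thesis using c(1) by blast
qed

lemma ex_kth_branching: "\<exists>b\<in>P v. card {c \<in> P v. fst c < fst b} = k"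
proof (induction k)
  case 0
  obtain b where b: "b \<in> P v" "\<forall>c\<in>P v. 0 < fst c \<longrightarrow> fst b \<le> fst c" using next_point[of v 0] by auto
  then have "{c \<in> P v. fst c < fst b} = {}" using points[of v] by force
  then show ?case using b by (metis card.empty)
next
  case (Suc k)
  then obtain b where b: "b \<in> P v" "card {c \<in> P v. fst c < fst b} = k" by auto
  obtain d where d: "d \<in> P v" "fst b < fst d" "\<forall>c\<in>P v. fst b < fst c \<longrightarrow> fst d \<le> fst c"
    using next_point[of v "fst b"] by auto
  have "{c \<in> P v. fst c < fst d} = insert b {c \<in> P v. fst c < fst b}"
  proof (intro set_eqI iffI)
    fix c assume c: "c \<in> {c \<in> P v. fst c < fst d}"
    then have "fst c \<le> fst b" using d by force
    then show "c \<in> insert b {c \<in> P v. fst c < fst b}" using c b point_eqI[of c v b] by force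
  qed (use b d in auto)
  then show ?case using b d finite_points_less by (intro bexI[of _ d]) auto
qed

text \<open>The definite description in \<open>kth_branching\<close> is meaningful because the
  number of earlier points strictly increases with time and two points at the same time
  coincide.\<close>

lemma kth_branching:
  "kth_branching (P v) k \<in> P v" "card {c \<in> P v. fst c < T v k} = k"
proof -
  have less: "card {c \<in> P v. fst c < fst b} < card {c \<in> P v. fst c < fst d}"
    if "b \<in> P v" "fst b < fst d" for b d
  proof (rule psubset_card_mono[OF finite_points_less])
    have "b \<in> {c \<in> P v. fst c < fst d}" "b \<notin> {c \<in> P v. fst c < fst b}" using that by auto
    then show "{c \<in> P v. fst c < fst b} \<subset> {c \<in> P v. fst c < fst d}" using that by force
  qed
  have "\<exists>!b. b \<in> P v \<and> card {c \<in> P v. fst c < fst b} = k"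
  proof (rule ex_ex1I)
    fix b d
    assume "b \<in> P v \<and> card {c \<in> P v. fst c < fst b} = k" "d \<in> P v \<and> card {c \<in> P v. fst c < fst d} = k"
    then show "b = d" using less[of b d] less[of d b] point_eqI[of b v d] by (cases "fst b" "fst d" rule: linorder_cases) auto
  qed (use ex_kth_branching[of v k] in auto)
  then have "kth_branching (P v) k \<in> P v \<and> card {c \<in> P v. fst c < fst (kth_branching (P v) k)} = k"
    unfolding kth_branching_def by (rule theI')
  then show "kth_branching (P v) k \<in> P v" "card {c \<in> P v. fst c < T v k} = k"
    by (auto simp: T_def)
qed

lemma snd_kth_branching [simp]: "snd (kth_branching (P v) k) = y"
  using kth_branching(1)[of v k] points[of v] by auto

lemma fst_kth_branching [simp]: "fst (kth_branching (P v) k) = T v k"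
  by (simp add: T_def)

lemma T_pos: "0 < T v k"
  using subsetD[OF points kth_branching(1), of v k] by (simp add: mem_Times_iff)

text \<open>Counting from 0, \<open>T v k\<close> is the time of the point with exactly
  \<open>k\<close> predecessors. The equivalence turns statements about random branching times into
  counts at fixed times, which are what the Poisson process controls.\<close>

lemma N_le_iff: "N v s \<le> k \<longleftrightarrow> s < T v k"
proof
  assume "s < T v k"
  then have "N v s \<le> card {c \<in> P v. fst c < T v k}"
    unfolding N_def by (intro card_mono finite_points_less) auto
  then show "N v s \<le> k" by (simp add: kth_branching)
next
  assume le: "N v s \<le> k"
  show "s < T v k"
  proof (rule ccontr)
    assume "\<not> s < T v k"
    then have "insert (kth_branching (P v) k) {c \<in> P v. fst c < T v k} \<subseteq> {c \<in> P v. fst c \<le> s}"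
      using kth_branching(1)[of v k] by auto
    then have "card (insert (kth_branching (P v) k) {c \<in> P v. fst c < T v k}) \<le> N v s"
      unfolding N_def by (intro card_mono finite_points)
    then show False using le finite_points_less by (simp add: kth_branching)
  qed
qed

lemma T_0_le: "T v 0 \<le> T v k"
proof (rule ccontr)
  assume "\<not> T v 0 \<le> T v k"
  then have "kth_branching (P v) k \<in> {c \<in> P v. fst c < T v 0}" using kth_branching(1)[of v k] by auto
  moreover have "{c \<in> P v. fst c < T v 0} = {}"
    using kth_branching(2)[of v 0] finite_points_less by simp
  ultimately show False by auto
qed

section \<open>Birth times and trajectories along a line of descent\<close>

lemma birth_time_Cons [simp]: "B (c # u) = B u + T u (fst c)"
  by simp

declare birth_time.simps(2) [simp del]

lemma birth_time_nonneg: "0 \<le> B v"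
  by (induction v) (auto intro: add_nonneg_nonneg less_imp_le[OF T_pos])

lemma birth_time_suffix: "suffix w v \<Longrightarrow> B w \<le> B v"
  by (induction v) (auto simp: suffix_Cons intro: add_increasing2 less_imp_le[OF T_pos])

lemma birth_time_pos: "0 < B (c # u)"
  using birth_time_nonneg[of u] T_pos[of u "fst c"] by simp

lemma born_suffix: "suffix w v \<Longrightarrow> born P v \<Longrightarrow> born P w"
  by (induction v) (auto simp: suffix_Cons)

text \<open>As \<open>y 0 = 0\<close>, a branching does not move the parent: during its own life a
  particle follows its subordinator alone.\<close>

lemma displacement_eq: "displacement xi P v t = xi v (t - B v)"
proof -
  have "(\<Sum>b\<in>{b \<in> P v. B v + fst b \<le> t}. enn2real (snd b 0)) = 0"
    using points[of v] by (intro sum.neutral) auto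
  then show ?thesis by (simp add: displacement_def)
qed

definition "start v = (case v of [] \<Rightarrow> 0
  | c # u \<Rightarrow> Lim (at_left (B v)) (X u) + enn2real (y (snd c)))"

lemma trajectory_after_birth: "B v \<le> t \<Longrightarrow> X v t = start v + xi v (t - B v)"
  by (cases v) (auto simp: start_def displacement_eq)

lemma trajectory_before_birth: "t < B (c # u) \<Longrightarrow> X (c # u) t = X u t"
  by simp

declare trajectory.simps [simp del]

lemma trajectory_mono_after_birth: "B v \<le> s \<Longrightarrow> s \<le> t \<Longrightarrow> X v s \<le> X v t"
  by (simp add: trajectory_after_birth xi_mono)

text \<open>\<open>Lim\<close> is a definite description, so a left limit has to be exhibited. After
  the birth of \<open>u\<close> its trajectory is nondecreasing and bounded by its value at the
  later time, hence it tends to the supremum.\<close>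

lemma trajectory_tendsto_at_left:
  "\<exists>L. (X u \<longlongrightarrow> L) (at_left (B (c # u))) \<and> L \<le> X u (B (c # u)) \<and>
     (\<forall>s. B u \<le> s \<longrightarrow> s < B (c # u) \<longrightarrow> X u s \<le> L)"
proof -
  let ?t = "B (c # u)"
  have less: "B u < ?t" using T_pos[of u "fst c"] by simp
  let ?A = "X u ` {B u..<?t}"
  have bdd: "bdd_above ?A"
    by (rule bdd_aboveI2[of _ _ "X u ?t"]) (use trajectory_mono_after_birth[of u _ ?t] in auto)
  have up: "X u s \<le> Sup ?A" if "B u \<le> s" "s < ?t" for s
    using bdd that by (intro cSup_upper) auto
  have "(X u \<longlongrightarrow> Sup ?A) (at_left ?t)"
  proof (rule increasing_tendsto)
    show "eventually (\<lambda>s. X u s \<le> Sup ?A) (at_left ?t)"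
      unfolding eventually_at_left[OF less] using up less by (auto intro!: exI[of _ "B u"])
    fix x assume "x < Sup ?A"
    then obtain s where s: "B u \<le> s" "s < ?t" "x < X u s"
      using less by (subst (asm) less_cSup_iff[OF _ bdd]) auto
    show "eventually (\<lambda>s. x < X u s) (at_left ?t)"
      unfolding eventually_at_left[OF less]
    proof (intro exI[of _ s] conjI allI impI)
      fix r assume "s < r"
      then have "X u s \<le> X u r" using s by (intro trajectory_mono_after_birth) auto
      then show "x < X u r" using s by simp
    qed (fact s)
  qed
  moreover have "Sup ?A \<le> X u ?t"
    using less trajectory_mono_after_birth[of u _ ?t] by (intro cSup_least) auto
  ultimately show ?thesis using up by blast
qed

lemma trajectory_Lim:
  shows trajectory_tendsto_Lim: "(X u \<longlongrightarrow> Lim (at_left (B (c # u))) (X u)) (at_left (B (c # u)))"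
    and trajectory_Lim_le: "Lim (at_left (B (c # u))) (X u) \<le> X u (B (c # u))"
    and trajectory_Lim_ge: "B u \<le> s \<Longrightarrow> s < B (c # u) \<Longrightarrow> X u s \<le> Lim (at_left (B (c # u))) (X u)"
proof -
  obtain L where L: "(X u \<longlongrightarrow> L) (at_left (B (c # u)))" "L \<le> X u (B (c # u))"
    "\<forall>s. B u \<le> s \<longrightarrow> s < B (c # u) \<longrightarrow> X u s \<le> L"
    using trajectory_tendsto_at_left by blast
  have *: "Lim (at_left (B (c # u))) (X u) = L"
    using L(1) by (intro tendsto_Lim) (auto simp: trivial_limit_at_left_real)
  show "(X u \<longlongrightarrow> Lim (at_left (B (c # u))) (X u)) (at_left (B (c # u)))"
    "Lim (at_left (B (c # u))) (X u) \<le> X u (B (c # u))"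
    "B u \<le> s \<Longrightarrow> s < B (c # u) \<Longrightarrow> X u s \<le> Lim (at_left (B (c # u))) (X u)"
    unfolding * using L by auto
qed

lemma trajectory_at_birth: "X v (B v) = start v"
  by (simp add: trajectory_after_birth)

lemma trajectory_mono: "0 \<le> s \<Longrightarrow> s \<le> t \<Longrightarrow> X v s \<le> X v t"
proof (induction v arbitrary: s t)
  case Nil
  then show ?case by (simp add: trajectory_mono_after_birth)
next
  case (Cons c u)
  let ?b = "B (c # u)"
  consider "?b \<le> s" | "t < ?b" | "s < ?b" "?b \<le> t" by linarith
  then show ?case
  proof cases
    case 1
    then show ?thesis using Cons by (intro trajectory_mono_after_birth)
  next
    case 2
    then show ?thesis using Cons by (simp add: trajectory_before_birth del: birth_time_Cons)
  next
    case 3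
    \<comment> \<open>The left limit dominates the trajectory of \<open>u\<close> only from the
      birth of \<open>u\<close> on, while \<open>s\<close> may be earlier.\<close>
    have less: "max s (B u) < ?b" using 3 T_pos[of u "fst c"] by simp
    have "X (c # u) s = X u s" using 3 by (intro trajectory_before_birth)
    also have "\<dots> \<le> X u (max s (B u))" using Cons by simp
    also have "\<dots> \<le> Lim (at_left ?b) (X u)" by (rule trajectory_Lim_ge) (use less in auto)
    also have "\<dots> \<le> start (c # u)" by (simp add: start_def)
    also have "\<dots> = X (c # u) ?b" by (rule trajectory_at_birth[symmetric])
    also have "\<dots> \<le> X (c # u) t" using 3 by (intro trajectory_mono_after_birth) auto
    finally show ?thesis .
  qed
qed

lemma trajectory_0: "X v 0 = 0"
proof (induction v)
  case Nil
  show ?case using trajectory_after_birth[of "[]" 0] by (simp add: start_def)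
next
  case (Cons c u)
  then show ?case using birth_time_pos[of c u] by (simp add: trajectory_before_birth del: birth_time_Cons)
qed

lemma trajectory_nonneg: "0 \<le> t \<Longrightarrow> 0 \<le> X v t"
  using trajectory_mono[of 0 t v] by (simp add: trajectory_0)

lemma ancestor_at:
  assumes "0 \<le> s"
  shows "\<exists>w. suffix w v \<and> B w \<le> s \<and> X w s = X v s"
proof (induction v)
  case Nil
  then show ?case using assms by auto
next
  case (Cons c u)
  show ?case
  proof (cases "B (c # u) \<le> s")
    case True
    then show ?thesis by (intro exI[of _ "c # u"]) auto
  next
    case False
    then show ?thesis using Cons trajectory_before_birth[of s c u]
      by (auto simp: suffix_Cons)
  qed
qed

lemma trajectory_at_ancestor_birth: "suffix w v \<Longrightarrow> X v (B w) = X w (B w)"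
proof (induction v)
  case (Cons c u)
  show ?case
  proof (cases "w = c # u")
    case False
    then have w: "suffix w u" using Cons.prems by (auto simp: suffix_Cons)
    then have "B w < B (c # u)" using birth_time_suffix[OF w] T_pos[of u "fst c"] by simp
    then show ?thesis using Cons w by (simp add: trajectory_before_birth del: birth_time_Cons)
  qed simp
qed simp

lemma start_Cons_ge: "B u \<le> s \<Longrightarrow> s < B (c # u) \<Longrightarrow> X u s + enn2real (y (snd c)) \<le> start (c # u)"
  using trajectory_Lim_ge[of u s c] by (simp add: start_def)

text \<open>Positions start at 0 and never decrease, so each single offset in the line of descent
  bounds the later positions from below. This is why truncation at \<open>a\<close> leaves the
  particles below \<open>a\<close> untouched.\<close>

lemma child_distance_le_trajectory:
  assumes "suffix (c # w) v" "B v \<le> t"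
  shows "enn2real (y (snd c)) \<le> X v t"
proof -
  have "B w < B (c # w)" using T_pos by simp
  then have "X w (B w) + enn2real (y (snd c)) \<le> start (c # w)" by (intro start_Cons_ge) auto
  then have "enn2real (y (snd c)) \<le> start (c # w)"
    using trajectory_nonneg[OF birth_time_nonneg, of w w] by simp
  also have "\<dots> = X v (B (c # w))"
    using trajectory_at_ancestor_birth[OF assms(1)] trajectory_at_birth[of "c # w"] by simp
  also have "\<dots> \<le> X v t"
    using birth_time_suffix[OF assms(1)] assms(2) birth_time_nonneg[of "c # w"]
    by (intro trajectory_mono) auto
  finally show ?thesis .
qed

text \<open>
  A list of triples \<open>((k, i), j)\<close> names a slot together with, for each of its branchings, the cell
  \<open>(j h, (j + 1) h]\<close> that contains the branching time counted from the birth of the parent.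
\<close>

definition "in_cell h u c \<longleftrightarrow> N u (real (snd c) * h) \<le> fst (fst c) \<and> fst (fst c) < N u ((real (snd c) + 1) * h)"

primrec in_cells :: "real \<Rightarrow> ((nat \<times> nat) \<times> nat) list \<Rightarrow> bool" where
  "in_cells h [] \<longleftrightarrow> True"
| "in_cells h (c # z) \<longleftrightarrow> in_cells h z \<and> in_cell h (map fst z) c"

text \<open>A lower bound for the birth position that reads each subordinator at the left end of a
  cell, a deterministic time once the list is fixed.\<close>

primrec skeleton :: "real \<Rightarrow> ((nat \<times> nat) \<times> nat) list \<Rightarrow> real" where
  "skeleton h [] = 0"
| "skeleton h (c # z) = skeleton h z + xi (map fst z) (real (snd c) * h) + enn2real (y (snd (fst c)))"

text \<open>Rounding the time before each next birth down to the left end of its cell can only lower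
  the position, by monotonicity. Each generation loses at most one cell, whence the term
  \<open>length z\<close> in the upper bound for the birth time.\<close>

lemma ex_cells:
  assumes "h > 0"
  shows "\<exists>z. map fst z = v \<and> in_cells h z \<and> real (sum_list (map snd z)) * h \<le> B v \<and>
    B v \<le> real (sum_list (map snd z) + length z) * h \<and> skeleton h z \<le> start v"
proof (induction v)
  case Nil
  then show ?case by (simp add: start_def)
next
  case (Cons c u)
  then obtain z where z: "map fst z = u" "in_cells h z" "real (sum_list (map snd z)) * h \<le> B u"
    "B u \<le> real (sum_list (map snd z) + length z) * h" "skeleton h z \<le> start u" by auto
  define t where "t = T u (fst c)"
  \<comment> \<open>Cells are open on the left, so the index is the ceiling minus 1; it is
    nonnegative because branching times are positive.\<close>
  define j where "j = nat (\<lceil>t / h\<rceil> - 1)"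
  have "0 < t / h" using T_pos assms by (simp add: t_def)
  then have "real j = of_int \<lceil>t / h\<rceil> - 1" by (simp add: j_def)
  then have "real j < t / h" "t / h \<le> real j + 1" by linarith+
  then have j: "real j * h < t" "t \<le> (real j + 1) * h"
    using assms by (auto simp: field_simps)
  have "in_cell h u (c, j)"
    using j N_le_iff[of u "real j * h" "fst c"] N_le_iff[of u "(real j + 1) * h" "fst c"]
    by (auto simp: in_cell_def t_def)
  moreover have "skeleton h ((c, j) # z) \<le> start (c # u)"
  proof -
    have "start u + xi u (real j * h) = X u (B u + real j * h)"
      using assms by (simp add: trajectory_after_birth)
    moreover have "X u (B u + real j * h) + enn2real (y (snd c)) \<le> start (c # u)"
      using j assms by (intro start_Cons_ge) (auto simp: t_def)
    ultimately show ?thesis using z by simp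
  qed
  moreover have "real (sum_list (map snd ((c, j) # z))) * h \<le> B (c # u)"
    "B (c # u) \<le> real (sum_list (map snd ((c, j) # z)) + length ((c, j) # z)) * h"
    using z j by (auto simp: algebra_simps t_def)
  ultimately show ?case using z by (intro exI[of _ "(c, j) # z"]) auto
qed

text \<open>The upper bound for the birth time guarantees the last particle a life of this length;
  \<open>max 0\<close> keeps the argument in the range where \<open>xi\<close> is monotone.\<close>

lemma trajectory_ge_skeleton:
  assumes "h > 0" "B v \<le> t"
  shows "\<exists>z. map fst z = v \<and> in_cells h z \<and> real (sum_list (map snd z)) * h \<le> t \<and>
    skeleton h z + xi v (max 0 (t - real (sum_list (map snd z) + length z) * h)) \<le> X v t"
proof -
  obtain z where z: "map fst z = v" "in_cells h z" "real (sum_list (map snd z)) * h \<le> B v"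
    "B v \<le> real (sum_list (map snd z) + length z) * h" "skeleton h z \<le> start v"
    using ex_cells[OF assms(1), of v] by auto
  have "xi v (max 0 (t - real (sum_list (map snd z) + length z) * h)) \<le> xi v (t - B v)"
    using z assms by (intro xi_mono) auto
  then show ?thesis using z assms by (intro exI[of _ z]) (auto simp: trajectory_after_birth)
qed

lemma name_time_particle_name [simp]: "name_time (particle_name P v) = B v"
  by (cases v) auto

lemma length_particle_name [simp]: "length (particle_name P v) = length v"
  by (induction v) auto

lemma suffix_particle_name: "suffix w (particle_name P v) \<Longrightarrow> \<exists>w'. suffix w' v \<and> w = particle_name P w'"
proof (induction v)
  case (Cons c u)
  then show ?case by (auto simp: suffix_Cons intro: exI[of _ "c # u"])
qed auto

end

section \<open>Particle names and positions in a driven system\<close>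

locale driven_path = branching_path +
  fixes Z :: particle_system
  assumes driven: "driven_by xi P Z"
begin

lemma particlesE:
  assumes "u \<in> particles Z"
  obtains v where "u = particle_name P v" "born P v" "\<And>t. 0 \<le> t \<Longrightarrow> position Z u t = X v t"
  using driven assms by (auto simp: driven_by_def)

lemma particle_name_in_particles: "born P v \<Longrightarrow> particle_name P v \<in> particles Z"
  using driven by (auto simp: driven_by_def)

lemma position_particle_name: "born P v \<Longrightarrow> 0 \<le> t \<Longrightarrow> position Z (particle_name P v) t = X v t"
  using driven by (auto simp: driven_by_def)

lemma position_mono: "u \<in> particles Z \<Longrightarrow> 0 \<le> s \<Longrightarrow> s \<le> t \<Longrightarrow> position Z u s \<le> position Z u t"
  by (elim particlesE) (simp add: trajectory_mono)

lemma ancestor_in_population: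
  assumes "u \<in> particles Z" "0 \<le> s"
  shows "\<exists>w\<in>population Z s. position Z w s = position Z u s"
proof -
  obtain v where v: "u = particle_name P v" "born P v" "\<And>t. 0 \<le> t \<Longrightarrow> position Z u t = X v t"
    using assms(1) by (rule particlesE) blast
  obtain w where "suffix w v" "B w \<le> s" "X w s = X v s" using ancestor_at[OF assms(2)] by blast
  then show ?thesis using v assms(2) born_suffix[of w v]
    by (intro bexI[of _ "particle_name P w"])
      (auto simp: population_def particle_name_in_particles position_particle_name)
qed

lemma root_in_particles: "[] \<in> particles Z"
  using particle_name_in_particles[of "[]"] by simp

text \<open>The distance on the left is the one tested by pruning. It equals the offset of an
  ancestor, and no later position in the line falls below such an offset.\<close>

lemma distance_at_birth_le_position:
  assumes "u \<in> particles Z" "suffix (c # w) u" "name_time u \<le> t"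
  shows "dist (position Z (c # w) (fst c)) (Lim (at_left (fst c)) (position Z w)) \<le> position Z u t"
proof -
  obtain v where v: "u = particle_name P v" "born P v" "\<And>t. 0 \<le> t \<Longrightarrow> position Z u t = X v t"
    using assms(1) by (rule particlesE) blast
  obtain x where x: "suffix x v" "c # w = particle_name P x"
    using suffix_particle_name assms(2) v(1) by blast
  then obtain d r where dr: "x = d # r" by (cases x) auto
  have c: "fst c = B (d # r)" and w: "w = particle_name P r" using x dr by auto
  have born: "born P (d # r)" "born P r" using born_suffix[OF x(1)] v(2) dr by auto
  have t: "0 \<le> t" "B v \<le> t" using assms(3) v(1) birth_time_nonneg[of v] by auto
  have p1: "position Z (c # w) (fst c) = Lim (at_left (B (d # r))) (X r) + enn2real (y (snd d))"
    using born birth_time_nonneg[of "d # r"] x dr c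
    by (simp add: position_particle_name trajectory_at_birth start_def del: birth_time_Cons particle_name.simps)
  \<comment> \<open>\<open>position\<close> and \<open>trajectory\<close> are known to agree only at
    nonnegative times; this determines the left limit because the birth time is positive.\<close>
  have "eventually (\<lambda>s. X r s = position Z w s) (at_left (B (d # r)))"
    unfolding eventually_at_left[OF birth_time_pos[of d r]] using born
    by (intro exI[of _ 0]) (auto simp: w position_particle_name birth_time_pos simp del: birth_time_Cons)
  then have "(position Z w \<longlongrightarrow> Lim (at_left (B (d # r))) (X r)) (at_left (B (d # r)))"
    using trajectory_tendsto_Lim[where u = r and c = d] by (rule Lim_transform_eventually[rotated])
  then have p2: "Lim (at_left (fst c)) (position Z w) = Lim (at_left (B (d # r))) (X r)"
    unfolding c by (intro tendsto_Lim) (auto simp: trivial_limit_at_left_real)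
  have "enn2real (y (snd d)) \<le> X v t"
    using x(1) dr t by (intro child_distance_le_trajectory) auto
  then show ?thesis using v t by (simp add: p1 p2 dist_real_def)
qed

lemma first_branching_le: "[(s, i)] \<in> particles Z \<Longrightarrow> T [] 0 \<le> s"
proof (elim particlesE)
  fix v assume v: "[(s, i)] = particle_name P v"
  have "length v = length [(s, i)]" unfolding v by simp
  then obtain c where "v = [c]" by (cases v) auto
  then show ?thesis using v T_0_le[of "[]" "fst c"] by simp
qed

lemma first_child_in_particles: "1 \<le> i \<Longrightarrow> y i < \<infinity> \<Longrightarrow> [(T [] 0, i)] \<in> particles Z"
  using particle_name_in_particles[of "[(0, i)]"] by simp

lemma first_child_position_le:
  assumes "1 \<le> i" "y i < \<infinity>" "T [] 0 \<le> t"
  shows "position Z [(T [] 0, i)] t \<le> position Z [] (T [] 0) + enn2real (y i) + xi [(0, i)] (t - T [] 0)"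
proof -
  have "position Z [(T [] 0, i)] t = X [(0, i)] t"
    using position_particle_name[of "[(0, i)]" t] assms T_pos[of "[]" 0] by simp
  also have "\<dots> = start [(0, i)] + xi [(0, i)] (t - T [] 0)"
    using assms by (simp add: trajectory_after_birth)
  also have "start [(0, i)] \<le> X [] (T [] 0) + enn2real (y i)"
    using trajectory_Lim_le[of "(0, i)" "[]"] by (simp add: start_def)
  also have "X [] (T [] 0) = position Z [] (T [] 0)"
    using position_particle_name[of "[]" "T [] 0"] T_pos[of "[]" 0] by simp
  finally show ?thesis by simp
qed

end

section \<open>Sums over lists\<close>

lemma nn_integral_count_space_list:
  fixes f :: "'c list \<Rightarrow> ennreal"
  shows "(\<integral>\<^sup>+z. f z \<partial>count_space UNIV)
    = f [] + (\<integral>\<^sup>+z. \<integral>\<^sup>+c. f (c # z) \<partial>count_space UNIV \<partial>count_space UNIV)"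
proof -
  let ?g = "\<lambda>p::'c list \<times> 'c. snd p # fst p"
  have bij: "bij_betw ?g UNIV (range ?g)" by (rule inj_on_imp_bij_betw) (auto simp: inj_on_def prod_eq_iff)
  have *: "f z = f [] * indicator {[]} z + f z * indicator (range ?g) z" for z
  proof (cases z)
    case (Cons c u)
    then have "z = ?g (u, c)" by simp
    then have "z \<in> range ?g" by blast
    then show ?thesis using Cons by simp
  qed (auto simp: indicator_def)
  have "(\<integral>\<^sup>+z. f z \<partial>count_space UNIV)
    = (\<integral>\<^sup>+z. f [] * indicator {[]} z + f z * indicator (range ?g) z \<partial>count_space UNIV)"
    by (intro nn_integral_cong *)
  also have "\<dots> = f [] + (\<integral>\<^sup>+z. f z * indicator (range ?g) z \<partial>count_space UNIV)"
    by (subst nn_integral_add) (auto simp: nn_integral_cmult_indicator)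
  also have "(\<integral>\<^sup>+z. f z * indicator (range ?g) z \<partial>count_space UNIV) = (\<integral>\<^sup>+z. f z \<partial>count_space (range ?g))"
    by (simp add: nn_integral_count_space_indicator)
  also have "\<dots> = (\<integral>\<^sup>+p. f (?g p) \<partial>count_space UNIV)"
    by (rule nn_integral_bij_count_space[OF bij, symmetric])
  also have "\<dots> = (\<integral>\<^sup>+z. \<integral>\<^sup>+c. f (c # z) \<partial>count_space UNIV \<partial>count_space UNIV)"
    using nn_integral_fst_count_space[of "\<lambda>p. f (?g p)"] by simp
  finally show ?thesis .
qed

text \<open>The extensions of a list by one element carry together at most half of its weight, so
  the sums over lists shorter than \<open>g\<close> satisfy
  \<open>L (g + 1) \<le> 1 + L g / 2\<close>. The cut at \<open>g\<close> starts the induction from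
  a finite value; monotone convergence removes it.\<close>

lemma nn_integral_list_weights_le_2:
  fixes W :: "'c list \<Rightarrow> ennreal"
  assumes Nil: "W [] = 1" and Cons: "\<And>c z. W (c # z) = W z * w z c"
    and le: "\<And>z. (\<integral>\<^sup>+c. w z c \<partial>count_space UNIV) \<le> ennreal (1 / 2)"
  shows "(\<integral>\<^sup>+z. W z \<partial>count_space UNIV) \<le> 2"
proof -
  define L where "L g = (\<integral>\<^sup>+z. W z * indicator {z. length z < g} z \<partial>count_space UNIV)" for g
  have "L g \<le> 2" for g
  proof (induction g)
    case (Suc g)
    have "L (Suc g) = 1 + (\<integral>\<^sup>+z. \<integral>\<^sup>+c. (W z * indicator {z. length z < g} z) * w z c
        \<partial>count_space UNIV \<partial>count_space UNIV)"
      unfolding L_def by (subst nn_integral_count_space_list)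
        (auto simp: Nil Cons indicator_def intro!: arg_cong2[where f = plus] nn_integral_cong)
    also have "\<dots> = 1 + (\<integral>\<^sup>+z. (W z * indicator {z. length z < g} z) * (\<integral>\<^sup>+c. w z c \<partial>count_space UNIV)
        \<partial>count_space UNIV)"
      by (subst nn_integral_cmult) auto
    also have "\<dots> \<le> 1 + (\<integral>\<^sup>+z. (W z * indicator {z. length z < g} z) * ennreal (1 / 2) \<partial>count_space UNIV)"
      by (intro add_left_mono nn_integral_mono mult_left_mono le) auto
    also have "\<dots> = 1 + L g * ennreal (1 / 2)"
      unfolding L_def by (subst nn_integral_multc) auto
    also have "\<dots> \<le> 1 + 2 * ennreal (1 / 2)"
      by (intro add_left_mono mult_right_mono Suc) auto
    also have "\<dots> = ennreal (1 + 2 * (1 / 2))"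
      by (subst ennreal_plus, simp, simp, subst ennreal_mult) auto
    also have "\<dots> = 2" by simp
    finally show ?case .
  qed (simp add: L_def)
  moreover have "(\<integral>\<^sup>+z. W z \<partial>count_space UNIV) = (SUP g. L g)"
    unfolding L_def
  proof (subst nn_integral_monotone_convergence_SUP[symmetric])
    show "incseq (\<lambda>g z. W z * indicator {z. length z < g} z)"
      by (auto simp: incseq_def le_fun_def indicator_def)
    have "W z = (SUP g. W z * indicator {z. length z < g} z)" for z
    proof (rule antisym)
      have "W z = W z * indicator {z. length z < Suc (length z)} z" by simp
      also have "\<dots> \<le> (SUP g. W z * indicator {z. length z < g} z)" by (rule SUP_upper2[of "Suc (length z)"]) auto
      finally show "W z \<le> (SUP g. W z * indicator {z. length z < g} z)" .
      show "(SUP g. W z * indicator {z. length z < g} z) \<le> W z"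
        by (rule SUP_least) (auto simp: indicator_def)
    qed
    then show "(\<integral>\<^sup>+z. W z \<partial>count_space UNIV)
      = (\<integral>\<^sup>+z. (SUP g. W z * indicator {z. length z < g} z) \<partial>count_space UNIV)" by simp
  qed auto
  ultimately show ?thesis by (simp add: SUP_le_iff)
qed

section \<open>Poisson counts\<close>

lemma poisson_mean_sums:
  assumes "0 \<le> r"
  shows "(\<lambda>n. real n * (exp (- r) * r ^ n / fact n)) sums r"
proof -
  have "(\<lambda>n. (exp (- r) * r) * (r ^ n / fact n)) sums ((exp (- r) * r) * exp r)"
    using exp_converges[of r] by (intro sums_mult) (simp add: divide_inverse mult.commute)
  then have "(\<lambda>n. real (Suc n) * (exp (- r) * r ^ Suc n / fact (Suc n))) sums r"
    by (simp add: field_simps exp_minus del: of_nat_Suc)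
  then show ?thesis by (subst (asm) sums_Suc_iff) simp
qed

context
  fixes M :: "'w measure" and E :: "'e measure" and \<eta> :: "'w \<Rightarrow> 'e set"
  assumes M: "prob_space M" and ppp: "poisson_point_process M E \<eta>"
begin

interpretation prob_space M by (rule M)

lemma measurable_count_in: "A \<in> sets E \<Longrightarrow> count_in \<eta> A \<in> borel_measurable M"
  using ppp by (simp add: poisson_point_process_def)

lemma prob_count_in:
  "A \<in> sets E \<Longrightarrow> emeasure E A < \<infinity> \<Longrightarrow>
    prob {\<omega> \<in> space M. count_in \<eta> A \<omega> = of_nat k} = exp (- measure E A) * measure E A ^ k / fact k"
  using ppp by (simp add: poisson_point_process_def)

lemma AE_no_points:
  assumes "A \<in> sets E" "emeasure E A = 0"
  shows "AE \<omega> in M. \<eta> \<omega> \<inter> A = {}"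
proof -
  have "prob {\<omega> \<in> space M. count_in \<eta> A \<omega> = of_nat 0} = 1"
    using assms by (subst prob_count_in) (auto simp: measure_def)
  moreover have "{\<omega> \<in> space M. count_in \<eta> A \<omega> = of_nat 0} \<in> events"
    using measurable_count_in[OF assms(1)] by measurable
  ultimately have "AE \<omega> in M. \<omega> \<in> {\<omega> \<in> space M. count_in \<eta> A \<omega> = of_nat 0}"
    by (subst AE_in_set_eq_1) auto
  then show ?thesis by eventually_elim (simp add: count_in_def emeasure_count_space_eq_0)
qed

lemma AE_infinite_points:
  assumes "A \<in> sets E" "emeasure E A = \<infinity>"
  shows "AE \<omega> in M. infinite (\<eta> \<omega>)"
proof -
  have "AE \<omega> in M. count_in \<eta> A \<omega> = \<infinity>"
    using ppp assms by (simp add: poisson_point_process_def)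
  then show ?thesis
    by eventually_elim (auto simp: count_in_def emeasure_count_space)
qed

text \<open>The probabilities of the finite counts add up to 1, which leaves no mass for
  infinity.\<close>

lemma AE_count_in_nat:
  assumes A: "A \<in> sets E" "emeasure E A < \<infinity>"
  shows "AE \<omega> in M. \<exists>k. count_in \<eta> A \<omega> = of_nat k"
proof -
  let ?S = "\<lambda>k. {\<omega> \<in> space M. count_in \<eta> A \<omega> = of_nat k}"
  have meas: "?S k \<in> events" for k using measurable_count_in[OF A(1)] by measurable
  have "(\<lambda>k. prob (?S k)) sums prob (\<Union>k. ?S k)"
    using meas by (intro finite_measure_UNION) (auto simp: disjoint_family_on_def)
  moreover have "(\<lambda>k. prob (?S k)) sums 1"
  proof -
    have "(\<lambda>k. exp (- measure E A) * (measure E A ^ k / fact k)) sums (exp (- measure E A) * exp (measure E A))"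
      using exp_converges[of "measure E A"] by (intro sums_mult) (simp add: divide_inverse mult.commute)
    then show ?thesis using A by (simp add: prob_count_in exp_minus)
  qed
  ultimately have "prob (\<Union>k. ?S k) = 1" by (rule sums_unique2)
  then have "AE \<omega> in M. \<omega> \<in> (\<Union>k. ?S k)" using meas by (subst AE_in_set_eq_1) auto
  then show ?thesis by eventually_elim auto
qed

lemma AE_finite_points:
  assumes "A \<in> sets E" "emeasure E A < \<infinity>"
  shows "AE \<omega> in M. finite (\<eta> \<omega> \<inter> A)"
  using AE_count_in_nat[OF assms]
  by eventually_elim (auto simp: count_in_def emeasure_count_space split: if_splits)

lemma nn_integral_count_in:
  assumes A: "A \<in> sets E" "emeasure E A < \<infinity>"
  shows "(\<integral>\<^sup>+\<omega>. count_in \<eta> A \<omega> \<partial>M) = emeasure E A"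
proof -
  let ?S = "\<lambda>k. {\<omega> \<in> space M. count_in \<eta> A \<omega> = of_nat k}"
  have meas: "?S k \<in> events" for k using measurable_count_in[OF A(1)] by measurable
  have "(\<integral>\<^sup>+\<omega>. count_in \<eta> A \<omega> \<partial>M) = (\<integral>\<^sup>+\<omega>. (\<Sum>k. of_nat k * indicator (?S k) \<omega>) \<partial>M)"
  proof (intro nn_integral_cong_AE, use AE_count_in_nat[OF A] AE_space in eventually_elim)
    case (elim \<omega>)
    then obtain n where n: "count_in \<eta> A \<omega> = of_nat n" by auto
    have "(\<Sum>k. of_nat k * indicator (?S k) \<omega> :: ennreal) = (\<Sum>k\<in>{n}. of_nat k * indicator (?S k) \<omega>)"
      using n by (intro suminf_finite) auto
    then show ?case using n elim by simp
  qed
  also have "\<dots> = (\<Sum>k. \<integral>\<^sup>+\<omega>. of_nat k * indicator (?S k) \<omega> \<partial>M)"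
    using meas by (intro nn_integral_suminf) auto
  also have "\<dots> = (\<Sum>k. ennreal (real k * (exp (- measure E A) * measure E A ^ k / fact k)))"
  proof (intro suminf_cong)
    fix k
    have "(\<integral>\<^sup>+\<omega>. of_nat k * indicator (?S k) \<omega> \<partial>M) = of_nat k * ennreal (prob (?S k))"
      using meas by (subst nn_integral_cmult_indicator) (auto simp: emeasure_eq_measure)
    also have "\<dots> = of_nat k * ennreal (exp (- measure E A) * measure E A ^ k / fact k)"
      by (simp only: prob_count_in[OF A])
    also have "\<dots> = ennreal (real k * (exp (- measure E A) * measure E A ^ k / fact k))"
      by (subst ennreal_mult') (auto simp: ennreal_of_nat_eq_real_of_nat)
    finally show "(\<integral>\<^sup>+\<omega>. of_nat k * indicator (?S k) \<omega> \<partial>M)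
      = ennreal (real k * (exp (- measure E A) * measure E A ^ k / fact k))" .
  qed
  also have "\<dots> = ennreal (measure E A)"
    using poisson_mean_sums[of "measure E A"] by (intro suminf_ennreal_eq) auto
  also have "\<dots> = emeasure E A" using A by (simp add: measure_def less_top)
  finally show ?thesis .
qed

end

section \<open>A single truncation level\<close>

text \<open>The bound \<open>level\<close> ensures that each branching has at least one child after
  truncation, so that branching times form a Poisson process of rate 1 and the subordinators are
  stable.\<close>

locale truncated_system = prob_space M for M :: "'w measure" +
  fixes \<alpha> \<beta> a :: real and \<xi> :: "slot \<Rightarrow> real \<Rightarrow> 'w \<Rightarrow> real"
    and P :: "slot \<Rightarrow> 'w \<Rightarrow> (real \<times> config) set" and Z :: "'w \<Rightarrow> particle_system"
  assumes alpha: "0 < \<alpha>" "\<alpha> < 1" and beta: "0 < \<beta>" and level: "ln 2 powr \<beta> < a"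
    and subordinators: "subordinator M 0 (nonbranching_levy_measure (Lambda_ri \<alpha> \<beta>) a) (\<xi> v)"
    and branchings: "poisson_point_process M (branching_intensity (Lambda_ri \<alpha> \<beta>) a) (P v)"
    and independent: "indep_sets (noise_events M (branching_intensity (Lambda_ri \<alpha> \<beta>) a) \<xi> P) UNIV"
    and driven: "AE \<omega> in M. driven_by (\<lambda>v t. \<xi> v t \<omega>) (\<lambda>v. P v \<omega>) (Z \<omega>)"
begin

abbreviation "\<kappa> \<equiv> stable_exponent \<alpha>"
abbreviation "E \<equiv> branching_intensity (Lambda_ri \<alpha> \<beta>) a"

definition "y = trunc a (log_config \<beta>)"

lemma y_in_Q_star: "y \<in> Q_star"
  unfolding y_def using beta level by (rule trunc_log_config_in_Q_star)

lemma y_0: "y 0 = 0"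
  by (simp add: y_def trunc_def)

lemma y_finite_iff: "1 \<le> i \<Longrightarrow> y i < \<infinity> \<longleftrightarrow> ln (real (Suc i)) powr \<beta> < a"
  by (auto simp: y_def trunc_def log_config_def ennreal_less_iff)

lemma y_eq: "y i < \<infinity> \<Longrightarrow> y i = ennreal (ln (real (Suc i)) powr \<beta>)"
  by (auto simp: y_def trunc_def log_config_def split: if_splits)

subsection \<open>Noise\<close>

lemma nn_integral_exp_subordinator:
  assumes "0 \<le> t" "0 \<le> q"
  shows "(\<integral>\<^sup>+\<omega>. ennreal (exp (- q * \<xi> v t \<omega>)) \<partial>M) = ennreal (exp (- (t * (\<kappa> * q powr \<alpha>))))"
proof (cases "q = 0")
  case False
  then have "0 < q" using assms by simp
  then have "(\<integral>\<omega>. exp (- q * \<xi> v t \<omega>) \<partial>M) = exp (- (t * (\<kappa> * q powr \<alpha>)))"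
    using subordinators[of v] assms integral_stable_levy_measure[OF alpha, of q]
    by (simp add: subordinator_def nonbranching_levy_measure_Lambda_ri[OF beta level])
  \<comment> \<open>A function that is not integrable would have integral 0, whereas the value just
    found is an exponential.\<close>
  moreover from this have "integrable M (\<lambda>\<omega>. exp (- q * \<xi> v t \<omega>))"
    using not_integrable_integral_eq[of M "\<lambda>\<omega>. exp (- q * \<xi> v t \<omega>)"] by fastforce
  ultimately show ?thesis by (subst nn_integral_eq_integral) auto
qed (simp add: emeasure_space_1)

lemma emeasure_time_set:
  assumes "I \<in> sets borel" "I \<subseteq> {0..}"
  shows "I \<times> Q_star \<in> sets E" "emeasure E (I \<times> Q_star) = emeasure lborel I"
  using emeasure_branching_intensity[OF beta level assms Q_star_in_Q_borel] y_in_Q_star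
  by (auto simp: y_def)

definition "branch_count v s \<omega> = count_in (P v) ({0..s} \<times> Q_star) \<omega>"

text \<open>There are countably many slots, so the exceptional null sets can be united. Marks other
  than \<open>y\<close> and points at time 0 have intensity 0, the half-line has infinite intensity
  and each bounded interval a finite one.\<close>

lemma AE_driven_path: "AE \<omega> in M. driven_path (\<lambda>v t. \<xi> v t \<omega>) (\<lambda>v. P v \<omega>) y (Z \<omega>)"
proof -
  have 1: "AE \<omega> in M. \<forall>v. \<xi> v 0 \<omega> = 0 \<and> mono_on {0..} (\<lambda>t. \<xi> v t \<omega>)"
    unfolding AE_all_countable using subordinators by (auto simp: subordinator_def)
  have y: "{y} \<in> sets Q_borel" using y_in_Q_star by (intro singleton_in_Q_borel) (simp add: Q_star_def)
  have "AE \<omega> in M. P v \<omega> \<inter> ({0..} \<times> (Q_star - {y})) = {}" for v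
    using emeasure_branching_intensity[OF beta level, of "{0..}" "Q_star - {y}"] y Q_star_in_Q_borel
    by (intro AE_no_points[OF prob_space_axioms branchings]) (auto simp: y_def)
  then have 2: "AE \<omega> in M. \<forall>v. P v \<omega> \<inter> ({0..} \<times> (Q_star - {y})) = {}"
    unfolding AE_all_countable by blast
  have "AE \<omega> in M. P v \<omega> \<inter> ({0} \<times> Q_star) = {}" for v
    using emeasure_time_set[of "{0}"] by (intro AE_no_points[OF prob_space_axioms branchings]) auto
  then have 3: "AE \<omega> in M. \<forall>v. P v \<omega> \<inter> ({0} \<times> Q_star) = {}"
    unfolding AE_all_countable by blast
  have "AE \<omega> in M. infinite (P v \<omega>)" for v
  proof (rule AE_infinite_points[OF prob_space_axioms branchings])
    show "{0..} \<times> Q_star \<in> sets E" by (rule emeasure_time_set) auto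
    have "\<forall>n. ennreal (real n) \<le> emeasure lborel {0::real..}"
    proof
      fix n
      have "ennreal (real n) = emeasure lborel {0..real n}" by simp
      also have "\<dots> \<le> emeasure lborel {0::real..}" by (intro emeasure_mono) auto
      finally show "ennreal (real n) \<le> emeasure lborel {0::real..}" .
    qed
    then have "emeasure lborel {0::real..} = \<infinity>"
    proof (rule contrapos_pp)
      assume "emeasure lborel {0::real..} \<noteq> \<infinity>"
      then obtain n where "emeasure lborel {0::real..} < of_nat n"
        using ennreal_Ex_less_of_nat[of "emeasure lborel {0::real..}"] by (auto simp: less_top)
      then show "\<not> (\<forall>n. ennreal (real n) \<le> emeasure lborel {0::real..})"
        by (auto simp: ennreal_of_nat_eq_real_of_nat not_le)
    qed
    then show "emeasure E ({0..} \<times> Q_star) = \<infinity>" by (subst emeasure_time_set) auto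
  qed
  then have 4: "AE \<omega> in M. \<forall>v. infinite (P v \<omega>)" unfolding AE_all_countable by blast
  have "AE \<omega> in M. finite (P v \<omega> \<inter> ({0..real n} \<times> Q_star))" for v and n :: nat
    using emeasure_time_set[of "{0..real n}"]
    by (intro AE_finite_points[OF prob_space_axioms branchings]) auto
  then have 5: "AE \<omega> in M. \<forall>v n. finite (P v \<omega> \<inter> ({0..real n} \<times> Q_star))"
    unfolding AE_all_countable by blast
  have 6: "P v \<omega> \<subseteq> {0..} \<times> Q_star" if "\<omega> \<in> space M" for v \<omega>
    using branchings[of v] that space_branching_intensity[OF beta level]
    by (auto simp: poisson_point_process_def)
  from 1 2 3 4 5 driven AE_space show ?thesis
  proof eventually_elim
    case (elim \<omega>)
    have sub: "P v \<omega> \<subseteq> {0<..} \<times> {y}" for v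
    proof
      fix b assume b: "b \<in> P v \<omega>"
      then have "b \<in> {0..} \<times> Q_star" using 6 elim by blast
      moreover have "b \<notin> {0..} \<times> (Q_star - {y})" "b \<notin> {0} \<times> Q_star" using elim b by blast+
      ultimately show "b \<in> {0<..} \<times> {y}" by (cases b) auto
    qed
    have fin: "finite {b \<in> P v \<omega>. fst b \<le> s}" for v s
    proof -
      obtain n :: nat where n: "s \<le> real n" using real_arch_simple by blast
      have "{b \<in> P v \<omega>. fst b \<le> s} \<subseteq> P v \<omega> \<inter> ({0..real n} \<times> Q_star)"
      proof
        fix b assume b: "b \<in> {b \<in> P v \<omega>. fst b \<le> s}"
        then have "b \<in> {0..} \<times> Q_star" using 6[of \<omega> v] elim by blast
        then show "b \<in> P v \<omega> \<inter> ({0..real n} \<times> Q_star)" using b n by (cases b) auto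
      qed
      then show ?thesis using elim finite_subset by blast
    qed
    show ?case
      by unfold_locales (use elim sub fin y_0 in \<open>auto simp: mono_on_def\<close>)
  qed
qed

lemma branch_count_eq:
  assumes "driven_path (\<lambda>v t. \<xi> v t \<omega>) (\<lambda>v. P v \<omega>) y (Z \<omega>)"
  shows "branch_count v s \<omega> = of_nat (branching_path.N (\<lambda>v. P v \<omega>) v s)"
proof -
  interpret driven_path "\<lambda>v t. \<xi> v t \<omega>" "\<lambda>v. P v \<omega>" y "Z \<omega>" by (rule assms)
  have "P v \<omega> \<inter> ({0..s} \<times> Q_star) = {b \<in> P v \<omega>. fst b \<le> s}"
    using points[of v] y_in_Q_star by force
  then show ?thesis using finite_points[of v s] by (simp add: branch_count_def count_in_def N_def)
qed

definition "noise_algebra j = sigma (space M) (noise_events M E \<xi> P j)"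

lemma noise_events_subset: "noise_events M E \<xi> P j \<subseteq> events"
  using independent by (auto simp: indep_sets_def)

lemma space_noise_algebra [simp]: "space (noise_algebra j) = space M"
  unfolding noise_algebra_def
  by (rule space_measure_of) (use noise_events_subset[of j] sets.space_closed in blast)

lemma sets_noise_algebra: "sets (noise_algebra j) = noise_events M E \<xi> P j"
proof -
  have "noise_events M E \<xi> P j = sigma_sets (space M) (noise_events M E \<xi> P j)"
    unfolding noise_events_def by (cases j) (auto simp only: sum.case intro!: sigma_sets_sigma_sets_eq[symmetric])
  then show ?thesis
    unfolding noise_algebra_def using noise_events_subset[of j] sets.space_closed
    by (subst sets_measure_of) blast+
qed

lemma measurable_noise_subordinator [measurable (raw)]:
  "0 \<le> t \<Longrightarrow> \<xi> v t \<in> borel_measurable (noise_algebra (Inl v))"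
  unfolding measurable_def sets_noise_algebra
  by (auto simp: noise_events_def intro!: sigma_sets.Basic)

lemma measurable_noise_count: "branch_count v s \<in> borel_measurable (noise_algebra (Inr v))"
proof -
  have "{0..s} \<times> Q_star \<in> sets E" by (rule emeasure_time_set) auto
  then show ?thesis
    unfolding measurable_def sets_noise_algebra branch_count_def
    by (auto simp: noise_events_def intro!: sigma_sets.Basic)
qed

lemma measurable_from_noise:
  "f \<in> borel_measurable (noise_algebra j) \<Longrightarrow> f \<in> borel_measurable M"
  using noise_events_subset[of j] by (auto simp: measurable_def sets_noise_algebra)

lemma nn_integral_prod_independent:
  fixes F :: "slot + slot \<Rightarrow> 'w \<Rightarrow> ennreal"
  assumes "finite I" "\<And>i. i \<in> I \<Longrightarrow> F i \<in> borel_measurable (noise_algebra i)"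
  shows "(\<integral>\<^sup>+\<omega>. (\<Prod>i\<in>I. F i \<omega>) \<partial>M) = (\<Prod>i\<in>I. \<integral>\<^sup>+\<omega>. F i \<omega> \<partial>M)"
proof (rule indep_vars_nn_integral)
  have "indep_sets (\<lambda>i. {F i -` A \<inter> space M |A. A \<in> sets borel}) I"
  proof (rule indep_sets_mono[OF independent])
    fix i assume "i \<in> I"
    then show "{F i -` A \<inter> space M |A. A \<in> sets borel} \<subseteq> noise_events M E \<xi> P i"
      using assms(2)[of i] by (auto simp: measurable_def sets_noise_algebra)
  qed simp
  then show "indep_vars (\<lambda>_. borel) F I"
    using assms measurable_from_noise by (auto simp: indep_vars_def2)
qed (use assms in auto)

end

section \<open>First moment of the truncated system\<close>

context truncated_system
begin

definition child_weight :: "real \<Rightarrow> nat \<Rightarrow> real" where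
  "child_weight q i = (if 1 \<le> i \<and> y i < \<infinity> then exp (- q * enn2real (y i)) else 0)"

text \<open>The counterpart of \<open>in_cell\<close> as an event: it involves counts at two fixed
  times only and so belongs to the noise of the Poisson process of \<open>u\<close> alone.\<close>

definition cell_event :: "real \<Rightarrow> slot \<Rightarrow> (nat \<times> nat) \<times> nat \<Rightarrow> 'w set" where
  "cell_event h u c = {\<omega> \<in> space M. branch_count u (real (snd c) * h) \<omega> \<le> of_nat (fst (fst c)) \<and>
     of_nat (fst (fst c)) < branch_count u ((real (snd c) + 1) * h) \<omega>}"

lemma cell_event_sets: "cell_event h u c \<in> sets (noise_algebra (Inr u))"
proof -
  have [measurable]: "branch_count u s \<in> borel_measurable (noise_algebra (Inr u))" for s
    by (rule measurable_noise_count)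
  have "cell_event h u c = {\<omega> \<in> space (noise_algebra (Inr u)).
     branch_count u (real (snd c) * h) \<omega> \<le> of_nat (fst (fst c)) \<and>
     of_nat (fst (fst c)) < branch_count u ((real (snd c) + 1) * h) \<omega>}"
    by (simp add: cell_event_def)
  also have "\<dots> \<in> sets (noise_algebra (Inr u))" by measurable
  finally show ?thesis .
qed

lemma cell_event_events [measurable]: "cell_event h u c \<in> events"
  using cell_event_sets[of h u c] noise_events_subset by (auto simp: sets_noise_algebra)

text \<open>Summing the indicators over \<open>k\<close> counts the branchings inside one cell, and
  branchings have rate 1.\<close>

lemma sum_emeasure_cell_event_le:
  assumes "0 < h"
  shows "(\<integral>\<^sup>+k. emeasure M (cell_event h u ((k, i), j)) \<partial>count_space UNIV) \<le> ennreal h"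
proof -
  let ?I = "{real j * h<..(real j + 1) * h}"
  have I: "?I \<times> Q_star \<in> sets E" "emeasure E (?I \<times> Q_star) = ennreal h"
  proof -
    have sub: "?I \<subseteq> {0..}"
    proof
      fix x assume "x \<in> ?I"
      moreover have "0 \<le> real j * h" using assms by simp
      ultimately show "x \<in> {0..}" by simp
    qed
    show "?I \<times> Q_star \<in> sets E" by (rule emeasure_time_set(1)[OF _ sub]) simp
    show "emeasure E (?I \<times> Q_star) = ennreal h"
      using assms by (subst emeasure_time_set(2)[OF _ sub]) (auto simp: algebra_simps)
  qed
  have "(\<integral>\<^sup>+k. emeasure M (cell_event h u ((k, i), j)) \<partial>count_space UNIV)
    = (\<integral>\<^sup>+k. \<integral>\<^sup>+\<omega>. indicator (cell_event h u ((k, i), j)) \<omega> \<partial>M \<partial>count_space UNIV)"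
    by simp
  also have "\<dots> = (\<integral>\<^sup>+\<omega>. \<integral>\<^sup>+k. indicator (cell_event h u ((k, i), j)) \<omega> \<partial>count_space UNIV \<partial>M)"
    by (rule nn_integral_count_space_nn_integral[symmetric]) auto
  also have "\<dots> \<le> (\<integral>\<^sup>+\<omega>. count_in (P u) (?I \<times> Q_star) \<omega> \<partial>M)"
  proof (intro nn_integral_mono_AE, use AE_driven_path AE_space in eventually_elim)
    case (elim \<omega>)
    interpret driven_path "\<lambda>v t. \<xi> v t \<omega>" "\<lambda>v. P v \<omega>" y "Z \<omega>" by (rule elim)
    let ?m = "N u (real j * h)" and ?n = "N u ((real j + 1) * h)"
    have "(\<integral>\<^sup>+k. indicator (cell_event h u ((k, i), j)) \<omega> \<partial>count_space UNIV)
      = (\<integral>\<^sup>+k. indicator {?m..<?n} k \<partial>count_space (UNIV :: nat set))"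
      using elim by (intro nn_integral_cong) (auto simp: cell_event_def branch_count_eq indicator_def)
    also have "\<dots> = of_nat (?n - ?m)" by simp
    also have "?n - ?m = card ({b \<in> P u \<omega>. fst b \<le> (real j + 1) * h} - {b \<in> P u \<omega>. fst b \<le> real j * h})"
      unfolding N_def using assms
      by (intro card_Diff_subset[symmetric] finite_points)
        (auto simp: algebra_simps intro: order_trans)
    also have "{b \<in> P u \<omega>. fst b \<le> (real j + 1) * h} - {b \<in> P u \<omega>. fst b \<le> real j * h}
      = P u \<omega> \<inter> (?I \<times> Q_star)"
      using points[of u] y_in_Q_star by force
    also have "of_nat (card (P u \<omega> \<inter> (?I \<times> Q_star))) = count_in (P u) (?I \<times> Q_star) \<omega>"
    proof -
      have "P u \<omega> \<inter> (?I \<times> Q_star) \<subseteq> {b \<in> P u \<omega>. fst b \<le> (real j + 1) * h}" by auto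
      then have "finite (P u \<omega> \<inter> (?I \<times> Q_star))" using finite_points by (rule finite_subset)
      then show ?thesis by (simp add: count_in_def)
    qed
    finally show ?case by simp
  qed
  also have "\<dots> = ennreal h"
    using nn_integral_count_in[OF prob_space_axioms branchings I(1)] I(2) by simp
  finally show ?thesis .
qed

text \<open>
  \<open>path_weight\<close> is the contribution of one named path of cells, and \<open>mean_weight\<close> its expectation up
  to the factor that is compensated by the last subordinator of the path.
\<close>

primrec path_weight :: "real \<Rightarrow> real \<Rightarrow> real \<Rightarrow> ((nat \<times> nat) \<times> nat) list \<Rightarrow> 'w \<Rightarrow> ennreal" where
  "path_weight q \<theta> h [] = (\<lambda>\<omega>. 1)"
| "path_weight q \<theta> h (c # z) = (\<lambda>\<omega>. path_weight q \<theta> h z \<omega> *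
     (indicator (cell_event h (map fst z) c) \<omega> *
      ennreal (exp (- q * \<xi> (map fst z) (real (snd c) * h) \<omega>)) *
      ennreal (child_weight q (snd (fst c)) * exp (- \<theta> * (real (snd c) * h)))))"

definition mean_factor where
  "mean_factor q \<theta> h z c = emeasure M (cell_event h (map fst z) c) *
     ennreal (child_weight q (snd (fst c)) * exp (- \<theta> * (real (snd c) * h) + \<kappa> * q powr \<alpha> * h))"

primrec mean_weight :: "real \<Rightarrow> real \<Rightarrow> real \<Rightarrow> ((nat \<times> nat) \<times> nat) list \<Rightarrow> ennreal" where
  "mean_weight q \<theta> h [] = 1"
| "mean_weight q \<theta> h (c # z) = mean_weight q \<theta> h z * mean_factor q \<theta> h z c"

lemma child_weight_nonneg: "0 \<le> child_weight q i"
  by (simp add: child_weight_def)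

text \<open>A path uses, for each strict ancestor of its last particle, one value of its
  subordinator and one event of its Poisson process. The slots of these ancestors are shorter than
  \<open>z\<close>, so the subordinator of the last particle is still free. The compensating
  exponential cancels the decay earned over the cells and leaves the factor
  \<open>exp (\<kappa> * q powr \<alpha> * h)\<close> for each generation.\<close>

lemma path_weight_factorization:
  assumes "0 < h" "0 \<le> q"
  shows "\<exists>I F. finite I \<and> (\<forall>u. Inl u \<in> I \<or> Inr u \<in> I \<longrightarrow> length u < length z) \<and>
    (\<forall>i\<in>I. F i \<in> borel_measurable (noise_algebra i)) \<and>
    (\<forall>\<omega>. path_weight q \<theta> h z \<omega> = (\<Prod>i\<in>I. F i \<omega>)) \<and>
    (\<Prod>i\<in>I. \<integral>\<^sup>+\<omega>. F i \<omega> \<partial>M) * ennreal (exp (\<kappa> * q powr \<alpha> * (real (sum_list (map snd z) + length z) * h)))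
      = mean_weight q \<theta> h z"
proof (induction z)
  case Nil
  show ?case by (intro exI[of _ "{}"]) simp
next
  case (Cons c z)
  then obtain I F where IF: "finite I" "\<forall>u. Inl u \<in> I \<or> Inr u \<in> I \<longrightarrow> length u < length z"
    "\<forall>i\<in>I. F i \<in> borel_measurable (noise_algebra i)"
    "\<forall>\<omega>. path_weight q \<theta> h z \<omega> = (\<Prod>i\<in>I. F i \<omega>)"
    "(\<Prod>i\<in>I. \<integral>\<^sup>+\<omega>. F i \<omega> \<partial>M) * ennreal (exp (\<kappa> * q powr \<alpha> * (real (sum_list (map snd z) + length z) * h)))
      = mean_weight q \<theta> h z" by auto
  define v where "v = map fst z"
  define w where "w = child_weight q (snd (fst c)) * exp (- \<theta> * (real (snd c) * h))"
  define s where "s = real (snd c) * h"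
  have s: "0 \<le> s" using assms by (simp add: s_def)
  have w: "0 \<le> w" by (simp add: w_def child_weight_nonneg)
  define f where "f \<omega> = ennreal (exp (- q * \<xi> v s \<omega>)) * ennreal w" for \<omega>
  define g :: "'w \<Rightarrow> ennreal" where "g = indicator (cell_event h v c)"
  define F' where "F' = F(Inl v := f, Inr v := g)"
  \<comment> \<open>The slot \<open>v\<close> has length \<open>length z\<close>, longer than all
    slots already used.\<close>
  have new: "Inl v \<notin> I" "Inr v \<notin> I" using IF(2) by (auto simp: v_def)
  have eq: "F' i = F i" if "i \<in> I" for i using new that by (auto simp: F'_def)
  have F'v: "F' (Inl v) = f" "F' (Inr v) = g" by (auto simp: F'_def)
  have prod: "(\<Prod>i\<in>insert (Inl v) (insert (Inr v) I). G (F' i)) = G f * (G g * (\<Prod>i\<in>I. G (F i)))"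
    for G :: "('w \<Rightarrow> ennreal) \<Rightarrow> ennreal"
    using new IF(1) by (simp add: F'v eq cong: prod.cong)
  have f_meas: "f \<in> borel_measurable (noise_algebra (Inl v))"
  proof -
    have [measurable]: "\<xi> v s \<in> borel_measurable (noise_algebra (Inl v))"
      using s by (rule measurable_noise_subordinator)
    show ?thesis unfolding f_def by measurable
  qed
  have g_meas: "g \<in> borel_measurable (noise_algebra (Inr v))"
    unfolding g_def using cell_event_sets by (intro borel_measurable_indicator)
  have int_f: "(\<integral>\<^sup>+\<omega>. f \<omega> \<partial>M) = ennreal (exp (- (s * (\<kappa> * q powr \<alpha>)))) * ennreal w"
  proof -
    have "\<xi> v s \<in> borel_measurable M"
      using measurable_noise_subordinator[OF s] by (rule measurable_from_noise)
    then show ?thesis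
      unfolding f_def using nn_integral_exp_subordinator[OF s assms(2), of v]
      by (subst nn_integral_multc) auto
  qed
  have int_g: "(\<integral>\<^sup>+\<omega>. g \<omega> \<partial>M) = emeasure M (cell_event h v c)"
    unfolding g_def by simp
  show ?case
  proof (intro exI[of _ "insert (Inl v) (insert (Inr v) I)"] exI[of _ F'] conjI allI ballI impI)
    show "finite (insert (Inl v) (insert (Inr v) I))" using IF by simp
    show "length u < length (c # z)" if "Inl u \<in> insert (Inl v) (insert (Inr v) I) \<or> Inr u \<in> insert (Inl v) (insert (Inr v) I)" for u
      using that IF(2) by (auto simp: v_def less_Suc_eq)
    show "F' i \<in> borel_measurable (noise_algebra i)" if "i \<in> insert (Inl v) (insert (Inr v) I)" for i
      using that IF(3) eq F'v f_meas g_meas by auto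
    show "path_weight q \<theta> h (c # z) \<omega> = (\<Prod>i\<in>insert (Inl v) (insert (Inr v) I). F' i \<omega>)" for \<omega>
      using prod[of "\<lambda>k. k \<omega>"] IF(4)
      by (simp add: f_def g_def v_def w_def s_def mult_ac)
    have "(\<Prod>i\<in>insert (Inl v) (insert (Inr v) I). \<integral>\<^sup>+\<omega>. F' i \<omega> \<partial>M) *
        ennreal (exp (\<kappa> * q powr \<alpha> * (real (sum_list (map snd (c # z)) + length (c # z)) * h)))
      = ((\<Prod>i\<in>I. \<integral>\<^sup>+\<omega>. F i \<omega> \<partial>M) * ennreal (exp (\<kappa> * q powr \<alpha> * (real (sum_list (map snd z) + length z) * h))))
        * (emeasure M (cell_event h v c) *
          (ennreal (exp (- (s * (\<kappa> * q powr \<alpha>)))) * ennreal w * ennreal (exp (\<kappa> * q powr \<alpha> * (s + h)))))"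
    proof -
      have "exp (\<kappa> * q powr \<alpha> * (real (sum_list (map snd (c # z)) + length (c # z)) * h))
        = exp (\<kappa> * q powr \<alpha> * (real (sum_list (map snd z) + length z) * h)) * exp (\<kappa> * q powr \<alpha> * (s + h))"
        by (simp add: s_def algebra_simps flip: exp_add)
      then show ?thesis
        using prod[of "\<lambda>k. \<integral>\<^sup>+\<omega>. k \<omega> \<partial>M"] by (simp add: int_f int_g ennreal_mult mult_ac)
    qed
    also have "ennreal (exp (- (s * (\<kappa> * q powr \<alpha>)))) * ennreal w * ennreal (exp (\<kappa> * q powr \<alpha> * (s + h)))
      = ennreal (child_weight q (snd (fst c)) * exp (- \<theta> * (real (snd c) * h) + \<kappa> * q powr \<alpha> * h))"
    proof -
      have "exp (- (s * (\<kappa> * q powr \<alpha>))) * w * exp (\<kappa> * q powr \<alpha> * (s + h))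
        = child_weight q (snd (fst c)) * exp (- \<theta> * (real (snd c) * h) + \<kappa> * q powr \<alpha> * h)"
        by (simp add: w_def s_def algebra_simps flip: exp_add)
      then show ?thesis using w by (simp flip: ennreal_mult)
    qed
    finally show "(\<Prod>i\<in>insert (Inl v) (insert (Inr v) I). \<integral>\<^sup>+\<omega>. F' i \<omega> \<partial>M) *
        ennreal (exp (\<kappa> * q powr \<alpha> * (real (sum_list (map snd (c # z)) + length (c # z)) * h)))
      = mean_weight q \<theta> h (c # z)"
      using IF(5) by (simp add: mean_factor_def v_def)
  qed
qed

definition final_time :: "real \<Rightarrow> real \<Rightarrow> ((nat \<times> nat) \<times> nat) list \<Rightarrow> real" where
  "final_time h t z = max 0 (t - real (sum_list (map snd z) + length z) * h)"

text \<open>The last subordinator runs for at least \<open>t\<close> minus the time charged to the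
  path, which includes one lost cell per generation. Its decay supplies the compensating factor, so
  that every path receives the same
  \<open>exp (- (t * (\<kappa> * q powr \<alpha>)))\<close>.\<close>

lemma nn_integral_path_weight_le:
  assumes "0 < h" "0 \<le> q" "0 \<le> \<kappa>"
  shows "(\<lambda>\<omega>. path_weight q \<theta> h z \<omega> * ennreal (exp (- q * \<xi> (map fst z) (final_time h t z) \<omega>))) \<in> borel_measurable M"
    (is ?meas)
    and "(\<integral>\<^sup>+\<omega>. path_weight q \<theta> h z \<omega> * ennreal (exp (- q * \<xi> (map fst z) (final_time h t z) \<omega>)) \<partial>M)
      \<le> ennreal (exp (- (t * (\<kappa> * q powr \<alpha>)))) * mean_weight q \<theta> h z" (is "?L \<le> _")
proof -
  obtain I F where IF: "finite I" "\<forall>u. Inl u \<in> I \<or> Inr u \<in> I \<longrightarrow> length u < length z"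
    "\<forall>i\<in>I. F i \<in> borel_measurable (noise_algebra i)"
    "\<forall>\<omega>. path_weight q \<theta> h z \<omega> = (\<Prod>i\<in>I. F i \<omega>)"
    "(\<Prod>i\<in>I. \<integral>\<^sup>+\<omega>. F i \<omega> \<partial>M) * ennreal (exp (\<kappa> * q powr \<alpha> * (real (sum_list (map snd z) + length z) * h)))
      = mean_weight q \<theta> h z"
    using path_weight_factorization[OF assms(1,2), where \<theta> = \<theta> and z = z] by (elim exE conjE) (rule that)
  define v where "v = map fst z"
  define s where "s = final_time h t z"
  have s: "0 \<le> s" by (simp add: s_def final_time_def)
  define f where "f \<omega> = ennreal (exp (- q * \<xi> v s \<omega>))" for \<omega>
  have f_meas: "f \<in> borel_measurable (noise_algebra (Inl v))"
  proof -
    have [measurable]: "\<xi> v s \<in> borel_measurable (noise_algebra (Inl v))"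
      using s by (rule measurable_noise_subordinator)
    show ?thesis unfolding f_def by measurable
  qed
  have new: "Inl v \<notin> I" using IF(2) by (auto simp: v_def)
  have eq: "(F(Inl v := f)) i = F i" if "i \<in> I" for i using new that by auto
  have meas: "(F(Inl v := f)) i \<in> borel_measurable (noise_algebra i)" if "i \<in> insert (Inl v) I" for i
    using that IF(3) f_meas by auto
  have *: "path_weight q \<theta> h z \<omega> * ennreal (exp (- q * \<xi> (map fst z) (final_time h t z) \<omega>))
    = (\<Prod>i\<in>insert (Inl v) I. (F(Inl v := f)) i \<omega>)" for \<omega>
    using new IF(1,4) eq by (simp add: f_def v_def s_def mult_ac cong: prod.cong)
  show ?meas
    unfolding * using meas measurable_from_noise by (intro borel_measurable_prod_ennreal) blast
  have "?L = (\<Prod>i\<in>insert (Inl v) I. \<integral>\<^sup>+\<omega>. (F(Inl v := f)) i \<omega> \<partial>M)"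
    unfolding * using IF(1) meas by (intro nn_integral_prod_independent) auto
  also have "\<dots> = (\<integral>\<^sup>+\<omega>. f \<omega> \<partial>M) * (\<Prod>i\<in>I. \<integral>\<^sup>+\<omega>. F i \<omega> \<partial>M)"
    using new IF(1) eq by (simp cong: prod.cong)
  also have "(\<integral>\<^sup>+\<omega>. f \<omega> \<partial>M) = ennreal (exp (- (s * (\<kappa> * q powr \<alpha>))))"
    unfolding f_def by (rule nn_integral_exp_subordinator[OF s assms(2)])
  also have "\<dots> \<le> ennreal (exp (- (t * (\<kappa> * q powr \<alpha>))) * exp (\<kappa> * q powr \<alpha> * (real (sum_list (map snd z) + length z) * h)))"
  proof -
    have "(t - real (sum_list (map snd z) + length z) * h) * (\<kappa> * q powr \<alpha>) \<le> s * (\<kappa> * q powr \<alpha>)"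
      using assms by (intro mult_right_mono) (auto simp: s_def final_time_def)
    then show ?thesis by (intro ennreal_leI) (simp add: algebra_simps flip: exp_add)
  qed
  also have "\<dots> * (\<Prod>i\<in>I. \<integral>\<^sup>+\<omega>. F i \<omega> \<partial>M) = ennreal (exp (- (t * (\<kappa> * q powr \<alpha>)))) * mean_weight q \<theta> h z"
    unfolding IF(5)[symmetric] by (simp add: ennreal_mult mult_ac)
  finally show "?L \<le> ennreal (exp (- (t * (\<kappa> * q powr \<alpha>)))) * mean_weight q \<theta> h z"
    by (simp add: mult_right_mono)
qed

end

lemma borel_measurable_nn_integral_count_space:
  fixes f :: "'i :: countable \<Rightarrow> 'a \<Rightarrow> ennreal"
  assumes "\<And>i. f i \<in> borel_measurable M"
  shows "(\<lambda>x. \<integral>\<^sup>+i. f i x \<partial>count_space UNIV) \<in> borel_measurable M"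
proof -
  interpret sigma_finite_measure "count_space (UNIV :: 'i set)"
    by (rule sigma_finite_measure_count_space_countable) simp
  have "(\<lambda>p. (\<lambda>i p. f i (fst p)) (snd p) p) \<in> borel_measurable (M \<Otimes>\<^sub>M count_space UNIV)"
    by (rule measurable_compose_countable'[where I = UNIV]) (auto intro: measurable_compose[OF _ assms])
  then show ?thesis
    by (intro borel_measurable_nn_integral) (simp add: case_prod_beta')
qed

lemma one_minus_exp_ge_half:
  assumes "0 \<le> x" "x \<le> (1::real)"
  shows "x / 2 \<le> 1 - exp (- x)"
proof -
  have "1 + x \<le> exp x" by (rule exp_ge_add_one_self)
  then have "(1 - x / 2) * (1 + x) \<le> (1 - x / 2) * exp x" using assms by (intro mult_left_mono) auto
  moreover have "1 \<le> (1 - x / 2) * (1 + x)" using assms mult_left_mono[of x 1 x] by (simp add: algebra_simps)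
  ultimately have "1 \<le> (1 - x / 2) * exp x" by simp
  then show ?thesis by (simp add: exp_minus field_simps)
qed

context truncated_system
begin

text \<open>Summation over \<open>k\<close> yields \<open>h\<close>, over the child index
  \<open>m\<close>, and over the cells a geometric series of ratio
  \<open>exp (- \<theta> * h)\<close>, at most \<open>2 / (\<theta> * h)\<close>. The cell length
  cancels and \<open>2 * exp 1 * m / \<theta>\<close> remains; this is the origin of the requirement
  \<open>4 * exp 1 * m \<le> \<theta>\<close>.\<close>

lemma nn_integral_mean_factor_le:
  assumes h: "0 < h" "h * \<theta> \<le> 1" "h * (\<kappa> * q powr \<alpha>) \<le> 1" and \<theta>: "0 < \<theta>" "4 * exp 1 * m \<le> \<theta>" and m: "0 \<le> m"
    and le: "(\<Sum>i. ennreal (child_weight q i)) \<le> ennreal m"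
  shows "(\<integral>\<^sup>+c. mean_factor q \<theta> h z c \<partial>count_space UNIV) \<le> ennreal (1 / 2)"
proof -
  let ?e = "\<lambda>j. exp (- \<theta> * (real j * h) + \<kappa> * q powr \<alpha> * h)"
  have "(\<integral>\<^sup>+c. mean_factor q \<theta> h z c \<partial>count_space UNIV)
    = (\<integral>\<^sup>+j. \<integral>\<^sup>+i. \<integral>\<^sup>+k. mean_factor q \<theta> h z ((k, i), j) \<partial>count_space UNIV \<partial>count_space UNIV \<partial>count_space UNIV)"
    by (simp add: nn_integral_snd_count_space[symmetric] flip: nn_integral_snd_count_space[of "\<lambda>(k, i). mean_factor q \<theta> h z ((k, i), _)"])
  also have "\<dots> \<le> (\<integral>\<^sup>+j. \<integral>\<^sup>+i. ennreal h * ennreal (?e j) * ennreal (child_weight q i) \<partial>count_space UNIV \<partial>count_space UNIV)"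
  proof (intro nn_integral_mono)
    fix i j :: nat
    have "(\<integral>\<^sup>+k. mean_factor q \<theta> h z ((k, i), j) \<partial>count_space UNIV)
      = (\<integral>\<^sup>+k. emeasure M (cell_event h (map fst z) ((k, i), j)) \<partial>count_space UNIV) * ennreal (child_weight q i * ?e j)"
      by (simp add: mean_factor_def nn_integral_multc)
    also have "\<dots> \<le> ennreal h * ennreal (child_weight q i * ?e j)"
      by (intro mult_right_mono sum_emeasure_cell_event_le h) auto
    also have "\<dots> = ennreal h * ennreal (?e j) * ennreal (child_weight q i)"
      by (simp add: ennreal_mult child_weight_nonneg mult_ac)
    finally show "(\<integral>\<^sup>+k. mean_factor q \<theta> h z ((k, i), j) \<partial>count_space UNIV)
      \<le> ennreal h * ennreal (?e j) * ennreal (child_weight q i)" .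
  qed
  also have "\<dots> \<le> (\<integral>\<^sup>+j. ennreal h * ennreal (?e j) * ennreal m \<partial>count_space UNIV)"
    using le by (intro nn_integral_mono) (simp add: nn_integral_cmult nn_integral_count_space_nat mult_left_mono)
  also have "\<dots> = (\<Sum>j. ennreal (h * m * exp (\<kappa> * q powr \<alpha> * h) * exp (- \<theta> * h) ^ j))"
  proof -
    have "?e j = exp (\<kappa> * q powr \<alpha> * h) * exp (- \<theta> * h) ^ j" for j
      by (simp add: algebra_simps flip: exp_of_nat_mult exp_add)
    then have "ennreal h * ennreal (?e j) * ennreal m
      = ennreal (h * m * exp (\<kappa> * q powr \<alpha> * h) * exp (- \<theta> * h) ^ j)" for j
      using h m by (simp add: mult_ac flip: ennreal_mult)
    then show ?thesis by (simp add: nn_integral_count_space_nat)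
  qed
  also have "\<dots> = ennreal (h * m * exp (\<kappa> * q powr \<alpha> * h) * (1 / (1 - exp (- \<theta> * h))))"
    using h m \<theta> by (intro suminf_ennreal_eq sums_mult geometric_sums) auto
  also have "\<dots> \<le> ennreal (1 / 2)"
  proof (rule ennreal_leI)
    have half: "\<theta> * h / 2 \<le> 1 - exp (- \<theta> * h)"
      using one_minus_exp_ge_half[of "\<theta> * h"] h \<theta> by (simp add: mult.commute)
    have pos: "0 < \<theta> * h / 2" using h \<theta> by simp
    have "exp (\<kappa> * q powr \<alpha> * h) \<le> exp 1" using h by (simp add: mult.commute)
    moreover have "1 / (1 - exp (- \<theta> * h)) \<le> 1 / (\<theta> * h / 2)"
      using half pos by (intro divide_left_mono mult_pos_pos) auto
    ultimately have "h * m * exp (\<kappa> * q powr \<alpha> * h) * (1 / (1 - exp (- \<theta> * h))) \<le> h * m * exp 1 * (1 / (\<theta> * h / 2))"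
      using h m half pos by (intro mult_mono) auto
    also have "\<dots> = 2 * exp 1 * m / \<theta>" using h \<theta> by simp
    also have "\<dots> \<le> 1 / 2" using \<theta> by (simp add: field_simps)
    finally show "h * m * exp (\<kappa> * q powr \<alpha> * h) * (1 / (1 - exp (- \<theta> * h))) \<le> 1 / 2" .
  qed
  finally show ?thesis .
qed

lemma path_weight_eq:
  assumes "driven_path (\<lambda>v t. \<xi> v t \<omega>) (\<lambda>v. P v \<omega>) y (Z \<omega>)" "\<omega> \<in> space M"
    and "branching_path.in_cells (\<lambda>v. P v \<omega>) h z" "born (\<lambda>v. P v \<omega>) (map fst z)"
  shows "path_weight q \<theta> h z \<omega> = ennreal (exp (- q * branching_path.skeleton (\<lambda>v t. \<xi> v t \<omega>) y h z
    - \<theta> * (real (sum_list (map snd z)) * h)))"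
proof -
  interpret driven_path "\<lambda>v t. \<xi> v t \<omega>" "\<lambda>v. P v \<omega>" y "Z \<omega>" by (rule assms(1))
  from assms(3,4) show ?thesis
  proof (induction z)
    case (Cons c z)
    have "\<omega> \<in> cell_event h (map fst z) c"
      using Cons.prems assms(2) by (simp add: cell_event_def branch_count_eq[OF assms(1)] in_cell_def)
    moreover have "child_weight q (snd (fst c)) = exp (- q * enn2real (y (snd (fst c))))"
      using Cons.prems by (simp add: child_weight_def)
    ultimately show ?case
      using Cons by (simp add: algebra_simps flip: ennreal_mult exp_add)
  qed simp
qed

text \<open>A measurable majorant \<open>S\<close> and finite sets of slots appear because neither
  the finiteness of the population nor the measurability of the sum over it has been established at
  this point. The parameter \<open>\<theta>\<close> discounts the time spent along a path and makes
  the sum over cells converge.\<close>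

theorem first_moment:
  assumes q: "0 \<le> q" and t: "0 \<le> t" and \<kappa>: "0 \<le> \<kappa>" and \<theta>: "0 < \<theta>" "4 * exp 1 * m \<le> \<theta>" and m: "0 \<le> m"
    and le: "(\<Sum>i. ennreal (child_weight q i)) \<le> ennreal m"
  obtains S where "S \<in> borel_measurable M" "(\<integral>\<^sup>+\<omega>. S \<omega> \<partial>M) \<le> ennreal (2 * exp ((\<theta> - \<kappa> * q powr \<alpha>) * t))"
    "AE \<omega> in M. \<forall>A. finite A \<and> (\<forall>v\<in>A. born (\<lambda>v. P v \<omega>) v \<and> birth_time (\<lambda>v. P v \<omega>) v \<le> t) \<longrightarrow>
      (\<Sum>v\<in>A. ennreal (exp (- q * trajectory (\<lambda>v t. \<xi> v t \<omega>) (\<lambda>v. P v \<omega>) v t))) \<le> S \<omega>"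
proof -
  \<comment> \<open>A cell length small enough for both \<open>\<theta> * h\<close> and
    \<open>\<kappa> * q powr \<alpha> * h\<close> to be at most 1.\<close>
  define h where "h = 1 / (\<theta> + \<kappa> * q powr \<alpha>)"
  have pos: "0 < \<theta> + \<kappa> * q powr \<alpha>" using \<theta> \<kappa> by (simp add: add_pos_nonneg)
  then have h: "0 < h" "h * \<theta> \<le> 1" "h * (\<kappa> * q powr \<alpha>) \<le> 1"
    using \<theta> \<kappa> by (auto simp: h_def field_simps)
  \<comment> \<open>The cells of a realised path take at most time \<open>t\<close>, so the factor
    \<open>exp (\<theta> * t)\<close> makes up for the discount.\<close>
  define F where "F z \<omega> = ennreal (exp (\<theta> * t)) *
    (path_weight q \<theta> h z \<omega> * ennreal (exp (- q * \<xi> (map fst z) (final_time h t z) \<omega>)))" for z \<omega>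
  have F_meas: "F z \<in> borel_measurable M" for z
    unfolding F_def
    by (rule borel_measurable_times_ennreal[OF borel_measurable_const nn_integral_path_weight_le(1)[OF h(1) q \<kappa>]])
  define S where "S \<omega> = (\<integral>\<^sup>+z. F z \<omega> \<partial>count_space UNIV)" for \<omega>
  have "S \<in> borel_measurable M"
    unfolding S_def by (intro borel_measurable_nn_integral_count_space F_meas)
  moreover have "(\<integral>\<^sup>+\<omega>. S \<omega> \<partial>M) \<le> ennreal (2 * exp ((\<theta> - \<kappa> * q powr \<alpha>) * t))"
  proof -
    have "(\<integral>\<^sup>+\<omega>. S \<omega> \<partial>M) = (\<integral>\<^sup>+z. \<integral>\<^sup>+\<omega>. F z \<omega> \<partial>M \<partial>count_space UNIV)"
      unfolding S_def by (rule nn_integral_count_space_nn_integral) (auto intro: F_meas)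
    also have "\<dots> \<le> (\<integral>\<^sup>+z. ennreal (exp (\<theta> * t)) * (ennreal (exp (- (t * (\<kappa> * q powr \<alpha>)))) * mean_weight q \<theta> h z) \<partial>count_space UNIV)"
      unfolding F_def using nn_integral_path_weight_le[OF h(1) q \<kappa>]
      by (intro nn_integral_mono, subst nn_integral_cmult) (auto intro!: mult_left_mono)
    also have "\<dots> = ennreal (exp (\<theta> * t)) * ennreal (exp (- (t * (\<kappa> * q powr \<alpha>)))) * (\<integral>\<^sup>+z. mean_weight q \<theta> h z \<partial>count_space UNIV)"
      by (simp add: nn_integral_cmult mult.assoc)
    also have "\<dots> \<le> ennreal (exp (\<theta> * t)) * ennreal (exp (- (t * (\<kappa> * q powr \<alpha>)))) * 2"
      using nn_integral_mean_factor_le[OF h \<theta> m le]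
      by (intro mult_left_mono nn_integral_list_weights_le_2[where w = "mean_factor q \<theta> h"]) auto
    also have "\<dots> = ennreal (exp (\<theta> * t) * exp (- (t * (\<kappa> * q powr \<alpha>))) * 2)"
      by (simp add: ennreal_mult)
    also have "exp (\<theta> * t) * exp (- (t * (\<kappa> * q powr \<alpha>))) * 2 = 2 * exp ((\<theta> - \<kappa> * q powr \<alpha>) * t)"
      by (simp add: algebra_simps flip: exp_add)
    finally show ?thesis .
  qed
  moreover have "AE \<omega> in M. \<forall>A. finite A \<and> (\<forall>v\<in>A. born (\<lambda>v. P v \<omega>) v \<and> birth_time (\<lambda>v. P v \<omega>) v \<le> t) \<longrightarrow>
      (\<Sum>v\<in>A. ennreal (exp (- q * trajectory (\<lambda>v t. \<xi> v t \<omega>) (\<lambda>v. P v \<omega>) v t))) \<le> S \<omega>"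
    using AE_driven_path AE_space
  proof eventually_elim
    case (elim \<omega>)
    interpret driven_path "\<lambda>v t. \<xi> v t \<omega>" "\<lambda>v. P v \<omega>" y "Z \<omega>" by (rule elim)
    show ?case
    proof (intro allI impI, elim conjE)
      fix A assume A: "finite A" "\<forall>v\<in>A. born (\<lambda>v. P v \<omega>) v \<and> B v \<le> t"
      have "\<exists>z. map fst z = v \<and> ennreal (exp (- q * X v t)) \<le> F z \<omega>" if "v \<in> A" for v
      proof -
        have "B v \<le> t" and born: "born (\<lambda>v. P v \<omega>) v" using A that by auto
        then obtain z where z: "map fst z = v" "in_cells h z" "real (sum_list (map snd z)) * h \<le> t"
          "skeleton h z + \<xi> v (max 0 (t - real (sum_list (map snd z) + length z) * h)) \<omega> \<le> X v t"
          using trajectory_ge_skeleton[OF h(1), of v t] by blast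
        have "F z \<omega> = ennreal (exp (\<theta> * t + (- q * skeleton h z - \<theta> * (real (sum_list (map snd z)) * h))
            + - q * \<xi> v (final_time h t z) \<omega>))"
          unfolding F_def path_weight_eq[OF elim z(2) born[folded z(1)]]
          by (simp add: z(1) algebra_simps flip: ennreal_mult exp_add)
        moreover have "- q * X v t \<le> - q * (skeleton h z + \<xi> v (final_time h t z) \<omega>)"
          using z(4) q by (intro mult_left_mono_neg) (auto simp: final_time_def)
        moreover have "0 \<le> \<theta> * (t - real (sum_list (map snd z)) * h)" using \<theta> z(3) by simp
        ultimately show ?thesis using z(1) by (intro exI[of _ z]) (auto simp: algebra_simps intro!: ennreal_leI)
      qed
      then obtain z where z: "\<And>v. v \<in> A \<Longrightarrow> map fst (z v) = v"
        "\<And>v. v \<in> A \<Longrightarrow> ennreal (exp (- q * X v t)) \<le> F (z v) \<omega>" by metis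
      \<comment> \<open>The first components of a cell path recover the slot, so different particles
        are charged to different terms of \<open>S\<close>.\<close>
      have inj: "inj_on z A" using z(1) by (metis inj_onI)
      have "(\<Sum>v\<in>A. ennreal (exp (- q * X v t))) \<le> (\<Sum>v\<in>A. F (z v) \<omega>)"
        using z by (intro sum_mono)
      also have "\<dots> = (\<Sum>x\<in>z ` A. F x \<omega>)" using inj by (simp add: sum.reindex)
      also have "\<dots> = (\<integral>\<^sup>+x. F x \<omega> * indicator (z ` A) x \<partial>count_space UNIV)"
        using A(1) by (simp add: nn_integral_count_space_finite flip: nn_integral_count_space_indicator)
      also have "\<dots> \<le> S \<omega>" unfolding S_def by (intro nn_integral_mono) (auto simp: indicator_def)
      finally show "(\<Sum>v\<in>A. ennreal (exp (- q * X v t))) \<le> S \<omega>" .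
    qed
  qed
  ultimately show ?thesis by (rule that)
qed

lemma finite_children: "finite {i. y i < \<infinity>}"
proof -
  obtain N where N: "\<And>n. n \<ge> N \<Longrightarrow> log_config \<beta> n > ennreal a"
    using config_space_eventually_above[OF log_config_in_config_space[OF beta], of "ennreal a"] by auto
  have "{i. y i < \<infinity>} \<subseteq> insert 0 {..<N}"
  proof
    fix i assume "i \<in> {i. y i < \<infinity>}"
    then show "i \<in> insert 0 {..<N}" using N[of i] by (auto simp: y_def trunc_def not_less split: if_splits)
  qed
  then show ?thesis by (rule finite_subset) simp
qed

text \<open>With \<open>q = 0\<close> the exponential moment counts particles, and truncation leaves
  only finitely many children per branching. Integer times suffice because particles never
  die.\<close>

lemma AE_finite_population:
  assumes \<kappa>: "0 \<le> \<kappa>"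
  shows "AE \<omega> in M. \<forall>t. finite (population (Z \<omega>) t)"
proof -
  let ?C = "{i. 1 \<le> i \<and> y i < \<infinity>}"
  define m where "m = real (card ?C)"
  have C: "finite ?C" by (rule finite_subset[OF _ finite_children]) auto
  have "(\<Sum>i. ennreal (child_weight 0 i)) = (\<Sum>i\<in>?C. ennreal (child_weight 0 i))"
    using C by (intro suminf_finite) (auto simp: child_weight_def)
  also have "\<dots> = ennreal m"
    by (simp add: child_weight_def m_def ennreal_of_nat_eq_real_of_nat)
  finally have le: "(\<Sum>i. ennreal (child_weight 0 i)) \<le> ennreal m" by simp
  define \<theta> where "\<theta> = 4 * exp 1 * m + 1"
  have \<theta>: "0 < \<theta>" "4 * exp 1 * m \<le> \<theta>" "0 \<le> m" by (auto simp: \<theta>_def m_def add_nonneg_pos)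
  have "AE \<omega> in M. finite (population (Z \<omega>) (real n))" for n :: nat
  proof -
    obtain S where S: "S \<in> borel_measurable M" "(\<integral>\<^sup>+\<omega>. S \<omega> \<partial>M) \<le> ennreal (2 * exp ((\<theta> - \<kappa> * 0 powr \<alpha>) * real n))"
      "AE \<omega> in M. \<forall>A. finite A \<and> (\<forall>v\<in>A. born (\<lambda>v. P v \<omega>) v \<and> birth_time (\<lambda>v. P v \<omega>) v \<le> real n) \<longrightarrow>
        (\<Sum>v\<in>A. ennreal (exp (- 0 * trajectory (\<lambda>v t. \<xi> v t \<omega>) (\<lambda>v. P v \<omega>) v (real n)))) \<le> S \<omega>"
      using first_moment[of 0 "real n" \<theta> m] le \<theta> \<kappa> by auto
    have "AE \<omega> in M. S \<omega> \<noteq> \<infinity>"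
      using S(1,2) by (intro nn_integral_noteq_infinite) (auto simp: top_unique)
    with S(3) AE_driven_path show ?thesis
    proof eventually_elim
      case (elim \<omega>)
      interpret driven_path "\<lambda>v t. \<xi> v t \<omega>" "\<lambda>v. P v \<omega>" y "Z \<omega>" by (rule elim)
      let ?V = "{v. born (\<lambda>v. P v \<omega>) v \<and> B v \<le> real n}"
      have "finite ?V"
      proof (rule ccontr)
        assume inf: "infinite ?V"
        obtain k where k: "S \<omega> < of_nat k" using elim ennreal_Ex_less_of_nat by (auto simp: less_top)
        obtain A where A: "A \<subseteq> ?V" "finite A" "card A = k" using infinite_arbitrarily_large[OF inf] by blast
        then have "of_nat k \<le> S \<omega>" using elim(1)[rule_format, of A] by auto
        then show False using k by simp
      qed
      then have "finite (particle_name (\<lambda>v. P v \<omega>) ` ?V)" by simp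
      moreover have "population (Z \<omega>) (real n) \<subseteq> particle_name (\<lambda>v. P v \<omega>) ` ?V"
      proof
        fix u assume u: "u \<in> population (Z \<omega>) (real n)"
        then have "u \<in> particles (Z \<omega>)" by (simp add: population_def)
        then obtain v where "u = particle_name (\<lambda>v. P v \<omega>) v" "born (\<lambda>v. P v \<omega>) v"
          by (rule particlesE) blast
        then show "u \<in> particle_name (\<lambda>v. P v \<omega>) ` ?V" using u by (auto simp: population_def)
      qed
      ultimately show ?case by (rule finite_subset[rotated])
    qed
  qed
  then have "AE \<omega> in M. \<forall>n. finite (population (Z \<omega>) (real n))" by (simp add: AE_all_countable)
  then show ?thesis
  proof eventually_elim
    case (elim \<omega>)
    show ?case
    proof
      fix t
      obtain n :: nat where "t \<le> real n" using real_arch_simple by blast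
      then have "population (Z \<omega>) t \<subseteq> population (Z \<omega>) (real n)" by (auto simp: population_def)
      then show "finite (population (Z \<omega>) t)" using elim finite_subset by blast
    qed
  qed
qed

text \<open>A particle at or below \<open>b\<close> contributes at least
  \<open>exp (- (q * b))\<close> to the majorant \<open>S\<close>, so Markov's inequality applies.
  The exceptional event is defined through \<open>S\<close>, whose measurability is at hand.\<close>

lemma leftmost_exceeds:
  assumes "0 \<le> q" "0 \<le> t" "0 \<le> \<kappa>" "0 < \<theta>" "4 * exp 1 * m \<le> \<theta>" "0 \<le> m"
    and "(\<Sum>i. ennreal (child_weight q i)) \<le> ennreal m"
  obtains F where "F \<in> events" "prob F \<le> 2 * exp (q * b + (\<theta> - \<kappa> * q powr \<alpha>) * t)"
    "AE \<omega> in M. \<omega> \<notin> F \<longrightarrow> (\<forall>u\<in>population (Z \<omega>) t. b < position (Z \<omega>) u t)"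
proof -
  obtain S where S [measurable]: "S \<in> borel_measurable M"
    and int: "(\<integral>\<^sup>+\<omega>. S \<omega> \<partial>M) \<le> ennreal (2 * exp ((\<theta> - \<kappa> * q powr \<alpha>) * t))"
    and AE: "AE \<omega> in M. \<forall>A. finite A \<and> (\<forall>v\<in>A. born (\<lambda>v. P v \<omega>) v \<and> birth_time (\<lambda>v. P v \<omega>) v \<le> t) \<longrightarrow>
      (\<Sum>v\<in>A. ennreal (exp (- q * trajectory (\<lambda>v t. \<xi> v t \<omega>) (\<lambda>v. P v \<omega>) v t))) \<le> S \<omega>"
    using first_moment[OF assms] by blast
  define F where "F = {\<omega> \<in> space M. 1 \<le> ennreal (exp (q * b)) * S \<omega>}"
  have "F \<in> events" unfolding F_def by measurable
  moreover have "prob F \<le> 2 * exp (q * b + (\<theta> - \<kappa> * q powr \<alpha>) * t)"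
  proof -
    have "emeasure M F \<le> ennreal (exp (q * b)) * (\<integral>\<^sup>+\<omega>. S \<omega> * indicator (space M) \<omega> \<partial>M)"
      unfolding F_def by (rule nn_integral_Markov_inequality) auto
    also have "(\<integral>\<^sup>+\<omega>. S \<omega> * indicator (space M) \<omega> \<partial>M) = (\<integral>\<^sup>+\<omega>. S \<omega> \<partial>M)"
      by (intro nn_integral_cong) auto
    also have "ennreal (exp (q * b)) * \<dots> \<le> ennreal (exp (q * b)) * ennreal (2 * exp ((\<theta> - \<kappa> * q powr \<alpha>) * t))"
      by (intro mult_left_mono int) auto
    also have "\<dots> = ennreal (2 * exp (q * b + (\<theta> - \<kappa> * q powr \<alpha>) * t))"
      by (simp add: exp_add mult_ac flip: ennreal_mult)
    finally show ?thesis by (simp add: emeasure_eq_measure)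
  qed
  moreover have "AE \<omega> in M. \<omega> \<notin> F \<longrightarrow> (\<forall>u\<in>population (Z \<omega>) t. b < position (Z \<omega>) u t)"
    using AE AE_driven_path AE_space
  proof eventually_elim
    case (elim \<omega>)
    interpret driven_path "\<lambda>v t. \<xi> v t \<omega>" "\<lambda>v. P v \<omega>" y "Z \<omega>" by (rule elim)
    show ?case
    proof (intro impI ballI)
      fix u assume "\<omega> \<notin> F" and u: "u \<in> population (Z \<omega>) t"
      then have "u \<in> particles (Z \<omega>)" by (simp add: population_def)
      then obtain v where v: "u = particle_name (\<lambda>v. P v \<omega>) v" "born (\<lambda>v. P v \<omega>) v"
        "\<And>t. 0 \<le> t \<Longrightarrow> position (Z \<omega>) u t = X v t" by (rule particlesE) blast
      show "b < position (Z \<omega>) u t"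
      proof (rule ccontr)
        assume "\<not> b < position (Z \<omega>) u t"
        then have "X v t \<le> b" using v assms(2) by simp
        then have "q * X v t \<le> q * b" using assms(1) by (intro mult_left_mono)
        moreover have "ennreal (exp (- q * X v t)) \<le> S \<omega>"
          using elim(1)[rule_format, of "{v}"] v u by (simp add: population_def)
        ultimately have "ennreal (exp (q * b)) * ennreal (exp (- (q * b))) \<le> ennreal (exp (q * b)) * S \<omega>"
          by (intro mult_left_mono) (auto intro: order_trans[rotated] ennreal_leI)
        then have "1 \<le> ennreal (exp (q * b)) * S \<omega>" by (simp flip: ennreal_mult exp_add)
        then show False using \<open>\<omega> \<notin> F\<close> elim by (simp add: F_def)
      qed
    qed
  qed
  ultimately show ?thesis by (rule that)
qed

section \<open>Children of the first branching\<close>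

text \<open>The lower tail comes from the Laplace transform. With
  \<open>s = t * (\<kappa> * q powr \<alpha>)\<close>, splitting the expectation at \<open>b\<close>
  shows that \<open>exp (- s)\<close> is at most the probability plus
  \<open>exp (- (q * b))\<close>, and \<open>q * b\<close> is at least \<open>2 * s\<close>.\<close>

lemma prob_subordinator_le:
  assumes "0 \<le> t" "0 \<le> q" and b: "2 * (t * (\<kappa> * q powr \<alpha>)) \<le> q * b"
  shows "exp (- (t * (\<kappa> * q powr \<alpha>))) * (1 - exp (- (t * (\<kappa> * q powr \<alpha>)))) \<le> prob {\<omega> \<in> space M. \<xi> v t \<omega> \<le> b}"
proof -
  let ?s = "t * (\<kappa> * q powr \<alpha>)"
  have [measurable]: "\<xi> v t \<in> borel_measurable M"
    using measurable_noise_subordinator[OF assms(1)] by (rule measurable_from_noise)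
  have "ennreal (exp (- ?s)) = (\<integral>\<^sup>+\<omega>. ennreal (exp (- q * \<xi> v t \<omega>)) \<partial>M)"
    using nn_integral_exp_subordinator[OF assms(1,2)] by simp
  also have "\<dots> \<le> (\<integral>\<^sup>+\<omega>. indicator {\<omega> \<in> space M. \<xi> v t \<omega> \<le> b} \<omega> + ennreal (exp (- (2 * ?s))) \<partial>M)"
  proof (intro nn_integral_mono_AE, use AE_driven_path AE_space in eventually_elim)
    case (elim \<omega>)
    interpret driven_path "\<lambda>v t. \<xi> v t \<omega>" "\<lambda>v. P v \<omega>" y "Z \<omega>" by (rule elim)
    have "0 \<le> \<xi> v t \<omega>" using xi_mono[of 0 t v] assms(1) by simp
    show ?case
    proof (cases "\<xi> v t \<omega> \<le> b")
      case True
      have "exp (- q * \<xi> v t \<omega>) \<le> 1" using \<open>0 \<le> \<xi> v t \<omega>\<close> assms(2) by simp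
      then have "ennreal (exp (- q * \<xi> v t \<omega>)) \<le> 1" by (simp add: ennreal_le_1)
      then show ?thesis using True elim by (simp add: add_increasing2)
    next
      case False
      then have "q * b \<le> q * \<xi> v t \<omega>" using assms(2) by (intro mult_left_mono) auto
      then show ?thesis using False b by (auto intro!: ennreal_leI)
    qed
  qed
  also have "\<dots> = ennreal (prob {\<omega> \<in> space M. \<xi> v t \<omega> \<le> b} + exp (- (2 * ?s)))"
    by (subst nn_integral_add) (auto simp: emeasure_eq_measure prob_space ennreal_plus)
  finally have "exp (- ?s) \<le> prob {\<omega> \<in> space M. \<xi> v t \<omega> \<le> b} + exp (- (2 * ?s))"
    by (subst (asm) ennreal_le_iff) auto
  moreover have "exp (- (2 * ?s)) = exp (- ?s) * exp (- ?s)" by (simp flip: exp_add)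
  ultimately show ?thesis by (simp add: algebra_simps)
qed

text \<open>Independence turns the probability into a product, and each factor is at most
  \<open>1 - p \<le> exp (- p)\<close>, with \<open>p\<close> the lower tail bound for a single
  subordinator.\<close>

lemma prob_all_subordinators_large:
  assumes "0 \<le> t" "0 \<le> q" and b: "2 * (t * (\<kappa> * q powr \<alpha>)) \<le> q * b" and "finite V"
  shows "{\<omega> \<in> space M. \<forall>v\<in>V. b < \<xi> v t \<omega>} \<in> events"
    and "prob {\<omega> \<in> space M. \<forall>v\<in>V. b < \<xi> v t \<omega>}
      \<le> exp (- (real (card V) * (exp (- (t * (\<kappa> * q powr \<alpha>))) * (1 - exp (- (t * (\<kappa> * q powr \<alpha>)))))))"
proof -
  let ?p = "exp (- (t * (\<kappa> * q powr \<alpha>))) * (1 - exp (- (t * (\<kappa> * q powr \<alpha>))))"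
  let ?A = "{\<omega> \<in> space M. \<forall>v\<in>V. b < \<xi> v t \<omega>}"
  have [measurable]: "\<xi> v t \<in> borel_measurable M" for v
    using measurable_noise_subordinator[OF assms(1)] by (rule measurable_from_noise)
  show A: "?A \<in> events" using assms(4) by measurable
  define F :: "slot + slot \<Rightarrow> 'w \<Rightarrow> ennreal" where
    "F j = (case j of Inl v \<Rightarrow> indicator {\<omega> \<in> space M. b < \<xi> v t \<omega>} | Inr v \<Rightarrow> (\<lambda>_. 1))" for j
  have F_meas: "F (Inl v) \<in> borel_measurable (noise_algebra (Inl v))" for v
  proof -
    have [measurable]: "\<xi> v t \<in> borel_measurable (noise_algebra (Inl v))"
      by (rule measurable_noise_subordinator) fact
    have "{\<omega> \<in> space (noise_algebra (Inl v)). b < \<xi> v t \<omega>} \<in> sets (noise_algebra (Inl v))" by measurable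
    then show ?thesis by (simp add: F_def)
  qed
  have "emeasure M ?A = (\<integral>\<^sup>+\<omega>. indicator ?A \<omega> \<partial>M)" using A by simp
  also have "\<dots> = (\<integral>\<^sup>+\<omega>. (\<Prod>j\<in>Inl ` V. F j \<omega>) \<partial>M)"
  proof (intro nn_integral_cong)
    fix \<omega> assume "\<omega> \<in> space M"
    then have "(\<Prod>v\<in>V. F (Inl v) \<omega>) = (\<Prod>v\<in>V. if b < \<xi> v t \<omega> then 1 else 0)"
      by (intro prod.cong) (auto simp: F_def)
    also have "\<dots> = indicator ?A \<omega>"
      using assms(4) \<open>\<omega> \<in> space M\<close> by (auto simp: indicator_def)
    finally show "indicator ?A \<omega> = (\<Prod>j\<in>Inl ` V. F j \<omega>)" by (simp add: prod.reindex)
  qed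
  also have "\<dots> = (\<Prod>j\<in>Inl ` V. \<integral>\<^sup>+\<omega>. F j \<omega> \<partial>M)"
    using assms(4) F_meas by (intro nn_integral_prod_independent) auto
  also have "\<dots> = (\<Prod>v\<in>V. ennreal (prob {\<omega> \<in> space M. b < \<xi> v t \<omega>}))"
    by (simp add: prod.reindex F_def emeasure_eq_measure)
  also have "\<dots> \<le> (\<Prod>v\<in>V. ennreal (exp (- ?p)))"
  proof (intro prod_mono_ennreal ennreal_leI)
    fix v
    have "prob {\<omega> \<in> space M. b < \<xi> v t \<omega>} = prob (space M - {\<omega> \<in> space M. \<xi> v t \<omega> \<le> b})"
      by (intro arg_cong[where f = prob]) auto
    also have "\<dots> = 1 - prob {\<omega> \<in> space M. \<xi> v t \<omega> \<le> b}" by (intro prob_compl) measurable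
    also have "\<dots> \<le> 1 - ?p" using prob_subordinator_le[OF assms(1-3)] by simp
    also have "\<dots> \<le> exp (- ?p)" using exp_ge_add_one_self[of "- ?p"] by simp
    finally show "prob {\<omega> \<in> space M. b < \<xi> v t \<omega>} \<le> exp (- ?p)" .
  qed
  also have "\<dots> = ennreal (exp (- (real (card V) * ?p)))"
    by (simp add: ennreal_power flip: exp_of_nat_mult)
  finally show "prob ?A \<le> exp (- (real (card V) * ?p))" by (simp add: emeasure_eq_measure)
qed

end

section \<open>Comparison of truncation levels\<close>

text \<open>Different levels may be driven by different noises, so a comparison can use only what a
  particle system shows by itself. These are the pathwise facts that survive forgetting the
  noise.\<close>

definition regular_system :: "particle_system \<Rightarrow> bool" where
  "regular_system Z \<longleftrightarrow> [] \<in> particles Z \<and>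
     (\<forall>u\<in>particles Z. \<forall>s t. 0 \<le> s \<and> s \<le> t \<longrightarrow> position Z u s \<le> position Z u t) \<and>
     (\<forall>u\<in>particles Z. \<forall>s\<ge>0. \<exists>w\<in>population Z s. position Z w s = position Z u s) \<and>
     (\<forall>u\<in>particles Z. \<forall>c w t. suffix (c # w) u \<and> name_time u \<le> t \<longrightarrow>
        dist (position Z (c # w) (fst c)) (Lim (at_left (fst c)) (position Z w)) \<le> position Z u t)"

lemma (in driven_path) regular_system: "regular_system Z"
  unfolding regular_system_def
  using root_in_particles position_mono ancestor_in_population distance_at_birth_le_position by blast

lemma regular_systemD:
  assumes "regular_system Z"
  shows "[] \<in> particles Z"
    and "u \<in> particles Z \<Longrightarrow> 0 \<le> s \<Longrightarrow> s \<le> t \<Longrightarrow> position Z u s \<le> position Z u t"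
    and "u \<in> particles Z \<Longrightarrow> 0 \<le> s \<Longrightarrow> \<exists>w\<in>population Z s. position Z w s = position Z u s"
    and "u \<in> particles Z \<Longrightarrow> suffix (c # w) u \<Longrightarrow> name_time u \<le> t \<Longrightarrow>
      dist (position Z (c # w) (fst c)) (Lim (at_left (fst c)) (position Z w)) \<le> position Z u t"
  using assms unfolding regular_system_def by blast+

definition inverse_square_sum :: real where
  "inverse_square_sum = (\<Sum>i. 1 / (real (Suc i))\<^sup>2)"

lemma inverse_square_sums: "(\<lambda>i. 1 / (real (Suc i))\<^sup>2) sums inverse_square_sum"
  unfolding inverse_square_sum_def using inverse_squares_sums sums_summable
  by (intro summable_sums) (auto simp: add.commute)

lemma inverse_square_sum_nonneg: "0 \<le> inverse_square_sum"
  unfolding inverse_square_sum_def by (intro suminf_nonneg sums_summable[OF inverse_square_sums]) auto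

context truncated_system
begin

lemma AE_regular_system: "AE \<omega> in M. regular_system (Z \<omega>)"
  using AE_driven_path by eventually_elim (rule driven_path.regular_system)

text \<open>With \<open>L = ln (i + 1)\<close> and \<open>L powr \<beta> < a\<close> one has
  \<open>L \<le> a powr (1 / \<beta> - 1) * L powr \<beta>\<close>, where \<open>\<beta> < 1\<close>
  makes the exponent of \<open>a\<close> positive. Each weight is therefore at most
  \<open>exp (- (2 * L))\<close>, a bound that does not depend on \<open>a\<close>.\<close>

lemma sum_child_weight_le:
  assumes "\<beta> < 1" and q: "q = 2 * a powr (1 / \<beta> - 1)"
  shows "(\<Sum>i. ennreal (child_weight q i)) \<le> ennreal inverse_square_sum"
proof -
  have a: "0 < a" using level by (rule le_less_trans[rotated]) auto
  have "child_weight q i \<le> 1 / (real (Suc i))\<^sup>2" for i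
  proof (cases "1 \<le> i \<and> y i < \<infinity>")
    case True
    define L where "L = ln (real (Suc i))"
    have L: "0 < L" using True by (simp add: L_def)
    have La: "L powr \<beta> < a" using True y_finite_iff[of i] by (simp add: L_def)
    have "L = (L powr \<beta>) powr (1 / \<beta> - 1) * L powr \<beta>"
      using L beta by (simp add: powr_powr algebra_simps flip: powr_add)
    also have "\<dots> \<le> a powr (1 / \<beta> - 1) * L powr \<beta>"
      using La beta assms(1) by (intro mult_right_mono powr_mono2) auto
    finally have "2 * L \<le> q * L powr \<beta>" by (simp add: q)
    moreover have "enn2real (y i) = L powr \<beta>" using True y_eq[of i] by (simp add: L_def)
    ultimately have "child_weight q i \<le> exp (- (2 * L))" using True by (simp add: child_weight_def)
    also have "\<dots> = 1 / (real (Suc i))\<^sup>2"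
      using exp_double[of L] by (simp add: exp_minus L_def inverse_eq_divide)
    finally show ?thesis .
  next
    case False
    then show ?thesis by (simp only: child_weight_def if_False) simp
  qed
  then have "(\<Sum>i. ennreal (child_weight q i)) \<le> (\<Sum>i. ennreal (1 / (real (Suc i))\<^sup>2))"
    by (intro suminf_le ennreal_leI) auto
  also have "\<dots> = ennreal inverse_square_sum"
    using inverse_square_sums by (intro suminf_ennreal_eq) auto
  finally show ?thesis .
qed

text \<open>One \<open>b\<close> pays for the offset of the child and one for its subordinator. The
  branching time is described as the least birth time of a child of the root, in terms of names
  only, so that it can be compared with other truncation levels.\<close>

lemma near_child:
  assumes t: "0 \<le> t" "0 \<le> q" and b: "2 * (t * (\<kappa> * q powr \<alpha>)) \<le> q * b"
    and n: "ln (real n) powr \<beta> \<le> b" "b < a"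
  obtains F where "F \<in> events"
    "prob F \<le> exp (- (real (n - 1) * (exp (- (t * (\<kappa> * q powr \<alpha>))) * (1 - exp (- (t * (\<kappa> * q powr \<alpha>)))))))"
    "AE \<omega> in M. \<omega> \<notin> F \<longrightarrow> (\<exists>s>0. \<exists>i. [(s, i)] \<in> particles (Z \<omega>) \<and>
       (\<forall>s' i'. [(s', i')] \<in> particles (Z \<omega>) \<longrightarrow> s \<le> s') \<and>
       (s \<le> t \<longrightarrow> position (Z \<omega>) [(s, i)] t \<le> position (Z \<omega>) [] s + 2 * b))"
proof -
  \<comment> \<open>Child \<open>i\<close> of the first branching has offset
    \<open>ln (i + 1) powr \<beta>\<close>; for \<open>i < n\<close> this is at most
    \<open>b\<close> and hence below the level.\<close>
  define V :: "slot set" where "V = (\<lambda>i. [(0, i)]) ` {1..<n}"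
  have V: "finite V" "card V = n - 1"
    by (auto simp: V_def card_image inj_on_def)
  define F where "F = {\<omega> \<in> space M. \<forall>v\<in>V. b < \<xi> v t \<omega>}"
  have "F \<in> events" "prob F \<le> exp (- (real (n - 1) * (exp (- (t * (\<kappa> * q powr \<alpha>))) * (1 - exp (- (t * (\<kappa> * q powr \<alpha>)))))))"
    unfolding F_def using prob_all_subordinators_large[OF t b V(1)] V(2) by auto
  moreover have "AE \<omega> in M. \<omega> \<notin> F \<longrightarrow> (\<exists>s>0. \<exists>i. [(s, i)] \<in> particles (Z \<omega>) \<and>
       (\<forall>s' i'. [(s', i')] \<in> particles (Z \<omega>) \<longrightarrow> s \<le> s') \<and>
       (s \<le> t \<longrightarrow> position (Z \<omega>) [(s, i)] t \<le> position (Z \<omega>) [] s + 2 * b))"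
    using AE_driven_path AE_space
  proof eventually_elim
    case (elim \<omega>)
    interpret driven_path "\<lambda>v t. \<xi> v t \<omega>" "\<lambda>v. P v \<omega>" y "Z \<omega>" by (rule elim)
    show ?case
    proof
      assume "\<omega> \<notin> F"
      then obtain i where i: "1 \<le> i" "i < n" "\<xi> [(0, i)] t \<omega> \<le> b"
        using elim by (auto simp: F_def V_def not_less)
      have "ln (real (Suc i)) powr \<beta> \<le> ln (real n) powr \<beta>"
        using i beta by (intro powr_mono2) auto
      then have le: "ln (real (Suc i)) powr \<beta> \<le> b" using n by simp
      then have fin: "y i < \<infinity>" using y_finite_iff[OF i(1)] n by simp
      then have yi: "enn2real (y i) \<le> b" using le by (simp add: y_eq)
      have "position (Z \<omega>) [(T [] 0, i)] t \<le> position (Z \<omega>) [] (T [] 0) + 2 * b" if "T [] 0 \<le> t"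
      proof -
        \<comment> \<open>Monotonicity allows the fixed time \<open>t\<close> in place of the random
          remaining time, which keeps the estimate for \<open>F\<close> free of the branching
          time.\<close>
        have "\<xi> [(0, i)] (t - T [] 0) \<omega> \<le> \<xi> [(0, i)] t \<omega>"
          using that T_pos[of "[]" 0] by (intro xi_mono) auto
        then show ?thesis using first_child_position_le[OF i(1) fin that] yi i by simp
      qed
      then show "\<exists>s>0. \<exists>i. [(s, i)] \<in> particles (Z \<omega>) \<and>
         (\<forall>s' i'. [(s', i')] \<in> particles (Z \<omega>) \<longrightarrow> s \<le> s') \<and>
         (s \<le> t \<longrightarrow> position (Z \<omega>) [(s, i)] t \<le> position (Z \<omega>) [] s + 2 * b)"
        using T_pos first_child_in_particles[OF i(1) fin] first_branching_le
        by (intro exI[of _ "T [] 0"] exI[of _ i] conjI) auto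
    qed
  qed
  ultimately show ?thesis by (rule that)
qed

text \<open>A child at one fixed level bounds the first branching time at all higher levels.\<close>

lemma AE_ex_child: "AE \<omega> in M. \<exists>s\<ge>0. [(s, 1)] \<in> particles (Z \<omega>)"
  using AE_driven_path
proof eventually_elim
  case (elim \<omega>)
  interpret driven_path "\<lambda>v t. \<xi> v t \<omega>" "\<lambda>v. P v \<omega>" y "Z \<omega>" by (rule elim)
  have "y 1 < \<infinity>" using y_in_Q_star by (simp add: Q_star_def)
  then show ?case
    using first_child_in_particles[of 1] T_pos[of "[]" 0] by (intro exI[of _ "T [] 0"]) simp
qed

end

text \<open>One realisation across all levels. Regularity and finiteness are assumed on the set
  \<open>D\<close>, which contains all natural numbers and is therefore cofinal; pruning relates
  arbitrary levels above \<open>a1\<close>.\<close>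

locale particle_tower =
  fixes a1 :: real and D :: "real set" and Z :: "real \<Rightarrow> particle_system" and Y :: particle_system
  assumes a1: "0 \<le> a1"
    and D_nat: "real n \<in> D"
    and regular: "a \<in> D \<Longrightarrow> a1 < a \<Longrightarrow> regular_system (Z a)"
    and finite_population: "a \<in> D \<Longrightarrow> a1 < a \<Longrightarrow> finite (population (Z a) t)"
    and pruned: "a1 < a \<Longrightarrow> a \<le> a' \<Longrightarrow> pruned a (Z a') (Z a)"
    and particles_Y: "particles Y = (\<Union>a\<in>{a1<..}. particles (Z a))"
    and position_Y: "a1 < a \<Longrightarrow> u \<in> particles (Z a) \<Longrightarrow> 0 \<le> t \<Longrightarrow> position Y u t = position (Z a) u t"
begin

lemma particles_mono: "a1 < a \<Longrightarrow> a \<le> a' \<Longrightarrow> particles (Z a) \<subseteq> particles (Z a')"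
  using pruned[of a a'] by (auto simp: pruned_def)

lemma particle_level:
  assumes "u \<in> particles Y"
  obtains a' where "a' \<in> D" "a \<le> a'" "a1 < a'" "u \<in> particles (Z a')"
proof -
  obtain a2 where a2: "a1 < a2" "u \<in> particles (Z a2)" using assms by (auto simp: particles_Y)
  obtain n :: nat where "max a a2 \<le> real n" using real_arch_simple by blast
  then show ?thesis using that[of "real n"] a2 particles_mono[of a2 "real n"] D_nat by auto
qed

text \<open>At a higher level in \<open>D\<close> that contains the particle, no offset in its line
  reaches \<open>a\<close>, because each is bounded by the position at time \<open>t\<close>.
  Pruning to level \<open>a\<close> therefore keeps it.\<close>

lemma below_level:
  assumes "a1 < a" "u \<in> population Y t" "0 \<le> t" "position Y u t < a"
  shows "u \<in> population (Z a) t"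
proof -
  have u: "u \<in> particles Y" "name_time u \<le> t" using assms(2) by (auto simp: population_def)
  obtain a' where a': "a' \<in> D" "a \<le> a'" "a1 < a'" "u \<in> particles (Z a')"
    using particle_level[OF u(1)] .
  have "position (Z a') u t < a" using position_Y[OF a'(3,4)] assms by simp
  then have "\<not> a \<le> dist (position (Z a') (c # w) (fst c)) (Lim (at_left (fst c)) (position (Z a') w))"
    if "suffix (c # w) u" for c w
    using regular_systemD(4)[OF regular[OF a'(1,3)] a'(4) that u(2)] by linarith
  then show ?thesis
    using pruned[OF assms(1) a'(2)] a'(4) u(2) by (auto simp: pruned_def population_def)
qed

lemma root_in_particles: "[] \<in> particles Y"
proof -
  obtain n :: nat where "a1 < real n" using reals_Archimedean2 by blast
  then show ?thesis using regular_systemD(1)[OF regular[OF D_nat, of n]] by (auto simp: particles_Y)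
qed

lemma root_in_population: "0 \<le> t \<Longrightarrow> [] \<in> population Y t"
  using root_in_particles by (simp add: population_def)

lemma position_mono:
  assumes "u \<in> particles Y" "0 \<le> s" "s \<le> t"
  shows "position Y u s \<le> position Y u t"
proof -
  obtain a' where a': "a' \<in> D" "0 \<le> a'" "a1 < a'" "u \<in> particles (Z a')"
    using particle_level[OF assms(1)] .
  then show ?thesis
    using regular_systemD(2)[OF regular[OF a'(1,3)] a'(4)] assms position_Y[OF a'(3,4)] by simp
qed

lemma ancestor_in_population:
  assumes "u \<in> particles Y" "0 \<le> s"
  shows "\<exists>w\<in>population Y s. position Y w s = position Y u s"
proof -
  obtain a' where a': "a' \<in> D" "0 \<le> a'" "a1 < a'" "u \<in> particles (Z a')"
    using particle_level[OF assms(1)] .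
  obtain w where w: "w \<in> population (Z a') s" "position (Z a') w s = position (Z a') u s"
    using regular_systemD(3)[OF regular[OF a'(1,3)] a'(4) assms(2)] by blast
  then have "w \<in> particles (Z a')" by (simp add: population_def)
  then show ?thesis
    using w a' assms(2) position_Y[OF a'(3)] by (intro bexI[of _ w]) (auto simp: population_def particles_Y)
qed

text \<open>The population may be infinite, so a least position is not automatic. Only particles
  below an integer \<open>n\<close> exceeding the position of the root compete, and these lie in the
  finite population of level \<open>n\<close>.\<close>

lemma leftmost_attained:
  assumes t: "0 \<le> t"
  shows "\<exists>u\<in>population Y t. leftmost Y t = position Y u t"
    and "\<forall>u\<in>population Y t. leftmost Y t \<le> position Y u t"
proof -
  let ?S = "(\<lambda>u. position Y u t) ` population Y t"
  let ?x = "position Y [] t"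
  obtain n :: nat where n: "max a1 ?x < real n" using reals_Archimedean2 by blast
  let ?A = "{u \<in> population Y t. position Y u t < real n}"
  have "?A \<subseteq> population (Z (real n)) t" using below_level[of "real n" _ t] n t by auto
  then have fin: "finite ((\<lambda>u. position Y u t) ` ?A)"
    using finite_population[OF D_nat, of n t] n by (intro finite_imageI) (auto intro: finite_subset)
  have "[] \<in> ?A" using root_in_population[OF t] n by simp
  then have ne: "(\<lambda>u. position Y u t) ` ?A \<noteq> {}" by blast
  define m where "m = Min ((\<lambda>u. position Y u t) ` ?A)"
  obtain v where v: "v \<in> ?A" "m = position Y v t" using Min_in[OF fin ne] by (auto simp: m_def)
  have le: "m \<le> position Y u t" if "u \<in> population Y t" for u
  proof (cases "position Y u t < real n")
    case True
    then show ?thesis using that fin by (simp add: m_def)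
  next
    case False
    then show ?thesis using v by simp
  qed
  have "leftmost Y t = m"
    unfolding leftmost_def by (rule Least_equality) (use v le in auto)
  then show "\<exists>u\<in>population Y t. leftmost Y t = position Y u t"
    "\<forall>u\<in>population Y t. leftmost Y t \<le> position Y u t"
    using v le by auto
qed

lemma leftmost_mono:
  assumes "0 \<le> s" "s \<le> t"
  shows "leftmost Y s \<le> leftmost Y t"
proof -
  obtain u where u: "u \<in> population Y t" "leftmost Y t = position Y u t"
    using leftmost_attained(1)[of t] assms by auto
  then have p: "u \<in> particles Y" by (simp add: population_def)
  obtain w where "w \<in> population Y s" "position Y w s = position Y u s"
    using ancestor_in_population[OF p assms(1)] by blast
  then show ?thesis
    using leftmost_attained(2)[OF assms(1)] position_mono[OF p assms] u by force
qed

lemma leftmost_ge: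
  assumes "a1 < a" "0 \<le> t" "\<forall>u\<in>population (Z a) t. a < position (Z a) u t"
  shows "a \<le> leftmost Y t"
proof (rule ccontr)
  assume less: "\<not> a \<le> leftmost Y t"
  obtain u where u: "u \<in> population Y t" "leftmost Y t = position Y u t"
    using leftmost_attained(1)[OF assms(2)] by auto
  then have "u \<in> population (Z a) t" using below_level[OF assms(1)] assms(2) less by simp
  then have "a < position Y u t"
    using assms position_Y[of a u t] by (auto simp: population_def)
  then show False using less u by simp
qed

text \<open>The child born at time \<open>r\<close> at level \<open>a\<close> also exists at level
  \<open>a'\<close>, so the first branching there happens by time \<open>r\<close>. The near child
  thus starts from a root position that is bounded independently of \<open>t\<close>.\<close>

lemma leftmost_le:
  assumes "a1 < a" "a \<le> a'" "a' \<in> D"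
    and r: "[(r, 1)] \<in> particles (Z a)" "r \<le> t"
    and s: "0 < s" "[(s, i)] \<in> particles (Z a')" "\<forall>s' i'. [(s', i')] \<in> particles (Z a') \<longrightarrow> s \<le> s'"
    and le: "s \<le> t \<longrightarrow> position (Z a') [(s, i)] t \<le> position (Z a') [] s + b"
  shows "leftmost Y t \<le> position Y [] r + b"
proof -
  have a': "a1 < a'" using assms by simp
  have root: "[] \<in> particles (Z a')" using regular_systemD(1)[OF regular[OF assms(3) a']] .
  have sr: "s \<le> r" using s(3) r(1) particles_mono[OF assms(1,2)] by blast
  have "[(s, i)] \<in> population Y t" using s a' sr r by (auto simp: population_def particles_Y)
  then have "leftmost Y t \<le> position Y [(s, i)] t" using leftmost_attained(2)[of t] s sr r by auto
  also have "\<dots> = position (Z a') [(s, i)] t" using position_Y[OF a' s(2)] s sr r by simp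
  also have "\<dots> \<le> position (Z a') [] s + b" using le sr r by simp
  also have "position (Z a') [] s = position Y [] s" using position_Y[OF a' root] s by simp
  also have "\<dots> \<le> position Y [] r" using position_mono[OF root_in_particles] s sr by simp
  finally show ?thesis by simp
qed

end

section \<open>Choice of parameters\<close>

context
  fixes \<alpha> \<beta> \<gamma> \<delta> :: real
  assumes alpha: "0 < \<alpha>" "\<alpha> < 1" and beta: "0 < \<beta>" "\<beta> < 1"
    and gamma: "\<gamma> = \<beta> / (\<alpha> * \<beta> + 1 - \<alpha>)" and delta: "\<delta> = 1 / (\<alpha> * \<beta> + 1 - \<alpha>)"
begin

lemma exponent_denominator: "0 < \<alpha> * \<beta> + 1 - \<alpha>" "\<alpha> * \<beta> + 1 - \<alpha> < 1"
proof -
  have "0 < \<alpha> * \<beta>" "\<alpha> * \<beta> < \<alpha>" using alpha beta by auto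
  then show "0 < \<alpha> * \<beta> + 1 - \<alpha>" "\<alpha> * \<beta> + 1 - \<alpha> < 1" using alpha by linarith+
qed

lemma gamma_pos: "0 < \<gamma>"
  using exponent_denominator beta by (simp add: gamma)

lemma delta_gt_1: "1 < \<delta>"
  using exponent_denominator by (simp add: delta)

text \<open>\<open>\<delta>\<close> is the common exponent of the exponential rates. The first
  identity gives the order of \<open>a powr (1 / \<beta>)\<close> for \<open>a\<close> of order
  \<open>n powr \<gamma>\<close>, the second that of \<open>n * q powr \<alpha>\<close> in the lower
  bound, the third that of \<open>q * b\<close> in the upper bound; the fourth matches the powers of
  the constant \<open>c\<close>.\<close>

lemma exponents:
  "\<gamma> * (1 / \<beta>) = \<delta>" "\<gamma> * ((1 / \<beta> - 1) * \<alpha>) + 1 = \<delta>" "\<gamma> + (1 - \<gamma>) * (1 / (1 - \<alpha>)) = \<delta>"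
  "1 / \<beta> = 1 / \<gamma> + (1 / \<beta> - 1) * \<alpha>"
proof -
  have ne: "\<alpha> * \<beta> + 1 - \<alpha> \<noteq> 0" "\<beta> \<noteq> 0" "1 - \<alpha> \<noteq> 0" using exponent_denominator beta alpha by auto
  show "\<gamma> * (1 / \<beta>) = \<delta>" using ne by (simp add: gamma delta)
  show "\<gamma> * ((1 / \<beta> - 1) * \<alpha>) + 1 = \<delta>"
    using ne by (simp add: gamma delta divide_simps) (simp add: algebra_simps)
  show "\<gamma> + (1 - \<gamma>) * (1 / (1 - \<alpha>)) = \<delta>"
    using ne by (simp add: gamma delta divide_simps) (simp add: algebra_simps)
  show "1 / \<beta> = 1 / \<gamma> + (1 / \<beta> - 1) * \<alpha>"
    using ne by (simp add: gamma divide_simps) (simp add: algebra_simps)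
qed

lemma eventually_linear_less_power:
  assumes "0 < A"
  shows "eventually (\<lambda>n. K * real n \<le> A * real n powr \<delta>) sequentially"
proof -
  have "eventually (\<lambda>x::real. K * x \<le> A * x powr \<delta>) at_top"
    using assms delta_gt_1 by real_asymp
  then show ?thesis by (rule eventually_compose_filterlim[OF _ filterlim_real_sequentially])
qed

lemma lower_bound_parameters:
  assumes \<kappa>: "0 < (\<kappa>::real)"
  obtains c where "0 < c"
    "\<And>\<theta>. eventually (\<lambda>n. 2 * (c * real n powr \<gamma>) powr (1 / \<beta> - 1) * (c * real n powr \<gamma>)
       + (\<theta> - \<kappa> * (2 * (c * real n powr \<gamma>) powr (1 / \<beta> - 1)) powr \<alpha>) * real n \<le> - real n) sequentially"
proof -
  \<comment> \<open>Chosen so that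
    \<open>\<kappa> * 2 powr \<alpha> = 4 * c powr (1 / \<gamma>)\<close>. The gain from the
    subordinators is then \<open>2 * A * n powr \<delta>\<close>, twice the cost
    \<open>A * n powr \<delta>\<close> of Markov's inequality, and the surplus absorbs every linear
    term because \<open>\<delta> > 1\<close>.\<close>
  define c where "c = (\<kappa> * 2 powr \<alpha> / 4) powr \<gamma>"
  have c: "0 < c" using \<kappa> by (simp add: c_def)
  define A where "A = 2 * c powr (1 / \<beta>)"
  have A: "0 < A" using c by (simp add: A_def)
  have c': "\<kappa> * 2 powr \<alpha> = 4 * c powr (1 / \<gamma>)"
    using \<kappa> gamma_pos by (simp add: c_def powr_powr)
  have "eventually (\<lambda>n. 2 * (c * real n powr \<gamma>) powr (1 / \<beta> - 1) * (c * real n powr \<gamma>)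
       + (\<theta> - \<kappa> * (2 * (c * real n powr \<gamma>) powr (1 / \<beta> - 1)) powr \<alpha>) * real n \<le> - real n) sequentially" for \<theta>
    using eventually_linear_less_power[OF A, of "\<theta> + 1"] eventually_gt_at_top[of 0]
  proof eventually_elim
    case (elim n)
    define a where "a = c * real n powr \<gamma>"
    have a: "0 < a" using c elim by (simp add: a_def)
    have "2 * a powr (1 / \<beta> - 1) * a = 2 * a powr (1 / \<beta>)"
      using a powr_add[of a "1 / \<beta> - 1" 1] by simp
    also have "\<dots> = A * real n powr \<delta>"
      using c elim exponents(1) by (simp add: a_def powr_mult powr_powr A_def)
    finally have 1: "2 * a powr (1 / \<beta> - 1) * a = A * real n powr \<delta>" .
    have "\<kappa> * (2 * a powr (1 / \<beta> - 1)) powr \<alpha> * real n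
      = \<kappa> * 2 powr \<alpha> * (c powr ((1 / \<beta> - 1) * \<alpha>) * (real n powr (\<gamma> * ((1 / \<beta> - 1) * \<alpha>)) * real n powr 1))"
      using a c elim by (simp add: a_def powr_mult powr_powr mult.assoc)
    also have "\<dots> = 4 * (c powr (1 / \<gamma>) * c powr ((1 / \<beta> - 1) * \<alpha>)) * real n powr \<delta>"
    proof -
      have "real n powr (\<gamma> * ((1 / \<beta> - 1) * \<alpha>)) * real n powr 1 = real n powr \<delta>"
        unfolding powr_add[symmetric] exponents(2) ..
      then show ?thesis unfolding c' by (simp only: mult.assoc)
    qed
    also have "c powr (1 / \<gamma>) * c powr ((1 / \<beta> - 1) * \<alpha>) = c powr (1 / \<beta>)"
      unfolding powr_add[symmetric] exponents(4)[symmetric] ..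
    finally have 2: "\<kappa> * (2 * a powr (1 / \<beta> - 1)) powr \<alpha> * real n = 2 * A * real n powr \<delta>"
      by (simp add: A_def)
    have "2 * a powr (1 / \<beta> - 1) * a + (\<theta> - \<kappa> * (2 * a powr (1 / \<beta> - 1)) powr \<alpha>) * real n
      = \<theta> * real n - A * real n powr \<delta>"
      using 1 2 by (simp add: left_diff_distrib)
    also have "\<dots> \<le> - real n" using elim by (simp add: algebra_simps)
    finally show ?case by (simp add: a_def)
  qed
  then show ?thesis using c that by blast
qed

lemma upper_bound_parameters:
  assumes \<kappa>: "0 < (\<kappa>::real)"
  obtains C :: real and q :: "nat \<Rightarrow> real" and k :: "nat \<Rightarrow> nat" where "0 < C"
    "eventually (\<lambda>n. 0 \<le> q n \<and> 2 * (real n * (\<kappa> * q n powr \<alpha>)) \<le> q n * (C * real n powr \<gamma>) \<and>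
       ln (real (k n)) powr \<beta> \<le> C * real n powr \<gamma> \<and>
       real n \<le> real (k n - 1) * (exp (- (real n * (\<kappa> * q n powr \<alpha>))) * (1 - exp (- (real n * (\<kappa> * q n powr \<alpha>)))))) sequentially"
proof -
  \<comment> \<open>\<open>s1\<close> is the value at \<open>C = 1\<close> of the constant
    \<open>s0\<close> below, which decreases in \<open>C\<close>. Taking
    \<open>C powr (1 / \<beta>) = s1 + 1\<close> makes the exponential rate of the number of
    children exceed the cost \<open>s0\<close> of one slow subordinator by at least 1.\<close>
  define s1 where "s1 = (2 * \<kappa>) powr (1 / (1 - \<alpha>)) / 2"
  define C where "C = (s1 + 1) powr \<beta>"
  have s1: "0 \<le> s1" by (simp add: s1_def)
  have C: "1 \<le> C" "C powr (1 / \<beta>) = s1 + 1"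
    using s1 beta by (auto simp: C_def powr_powr intro: ge_one_powr_ge_zero)
  define s0 where "s0 = C * (2 * \<kappa> / C) powr (1 / (1 - \<alpha>)) / 2"
  have s0: "0 < s0" "s0 \<le> s1"
  proof -
    show "0 < s0" using C \<kappa> by (simp add: s0_def)
    have "s0 = s1 * C powr (1 - 1 / (1 - \<alpha>))"
      using C \<kappa> by (simp add: s0_def s1_def powr_divide powr_diff mult_ac)
    moreover have "C powr (1 - 1 / (1 - \<alpha>)) \<le> C powr 0"
      using C alpha by (intro powr_mono) (auto simp: field_simps)
    ultimately show "s0 \<le> s1" using s1 C mult_left_mono[of "C powr (1 - 1 / (1 - \<alpha>))" 1 s1] by simp
  qed
  define b where "b n = C * real n powr \<gamma>" for n
  \<comment> \<open>The solution of \<open>2 * n * \<kappa> * q powr \<alpha> = q * b\<close>, the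
    equality case in the hypothesis of the tail estimate.\<close>
  define q where "q n = (2 * real n * \<kappa> / b n) powr (1 / (1 - \<alpha>))" for n
  define k where "k n = nat \<lfloor>exp (b n powr (1 / \<beta>))\<rfloor>" for n
  \<comment> \<open>Used at \<open>x = n powr \<delta>\<close>. One unit of the 2 accounts for the
    floor in \<open>k n\<close>, the other for the passage to \<open>k n - 1\<close>.\<close>
  have "eventually (\<lambda>x::real. x \<le> (exp ((s1 + 1) * x) - 2) * (exp (- (s0 * x)) * (1 - exp (- (s0 * x))))) at_top"
  proof -
    have "eventually (\<lambda>x::real. exp (- (s0 * x)) \<le> 1 / 2) at_top" using s0 by real_asymp
    moreover have "eventually (\<lambda>x::real. x \<le> (exp x - 2) / 2) at_top" by real_asymp
    ultimately show ?thesis using eventually_ge_at_top[of 0]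
    proof eventually_elim
      case (elim x)
      have le1: "exp (- (s0 * x)) \<le> 1" using s0 elim by simp
      have "x \<le> (exp x - 2) / 2" by fact
      also have "\<dots> \<le> (exp x - 2) * (1 - exp (- (s0 * x)))"
        using elim mult_left_mono[of "1 / 2" "1 - exp (- (s0 * x))" "exp x - 2"] by simp
      also have "exp x - 2 \<le> (exp ((s1 + 1) * x) - 2) * exp (- (s0 * x))"
      proof -
        have "exp x \<le> exp ((s1 + 1) * x - s0 * x)"
          using s0 elim by (simp add: algebra_simps mult_right_mono)
        also have "\<dots> = exp ((s1 + 1) * x) * exp (- (s0 * x))" by (simp flip: exp_add)
        finally show ?thesis using le1 unfolding left_diff_distrib by linarith
      qed
      finally show ?case using le1 by (simp add: mult.assoc mult_right_mono)
    qed
  qed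
  moreover have "filterlim (\<lambda>n. real n powr \<delta>) at_top sequentially"
    using delta_gt_1
    by (intro filterlim_compose[OF real_powr_at_top filterlim_real_sequentially]) simp
  ultimately have "eventually (\<lambda>n. real n powr \<delta> \<le> (exp ((s1 + 1) * real n powr \<delta>) - 2) *
      (exp (- (s0 * real n powr \<delta>)) * (1 - exp (- (s0 * real n powr \<delta>))))) sequentially"
    by (rule eventually_compose_filterlim)
  then have "eventually (\<lambda>n. 0 \<le> q n \<and> 2 * (real n * (\<kappa> * q n powr \<alpha>)) \<le> q n * b n \<and>
       ln (real (k n)) powr \<beta> \<le> b n \<and>
       real n \<le> real (k n - 1) * (exp (- (real n * (\<kappa> * q n powr \<alpha>))) * (1 - exp (- (real n * (\<kappa> * q n powr \<alpha>)))))) sequentially"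
    using eventually_gt_at_top[of 0]
  proof eventually_elim
    case (elim n)
    have b: "0 < b n" using C elim by (simp add: b_def)
    have q: "0 < q n" using b \<kappa> elim by (simp add: q_def)
    have "q n = q n powr (1 - \<alpha>) * q n powr \<alpha>" using q by (simp flip: powr_add)
    also have "q n powr (1 - \<alpha>) = 2 * real n * \<kappa> / b n"
      using b \<kappa> elim alpha by (simp add: q_def powr_powr)
    finally have "q n * b n = (2 * real n * \<kappa> / b n * q n powr \<alpha>) * b n" by simp
    then have qb: "2 * (real n * (\<kappa> * q n powr \<alpha>)) = q n * b n"
      using b by (simp add: field_simps)
    have "q n = (2 * \<kappa> / C * real n powr (1 - \<gamma>)) powr (1 / (1 - \<alpha>))"
      using elim C by (simp add: q_def b_def powr_diff field_simps)
    also have "\<dots> = (2 * \<kappa> / C) powr (1 / (1 - \<alpha>)) * real n powr ((1 - \<gamma>) * (1 / (1 - \<alpha>)))"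
      using \<kappa> C elim by (subst powr_mult) (auto simp: powr_powr)
    finally have "q n * b n / 2 = s0 * (real n powr \<gamma> * real n powr ((1 - \<gamma>) * (1 / (1 - \<alpha>))))"
      by (simp add: b_def s0_def)
    then have s: "real n * (\<kappa> * q n powr \<alpha>) = s0 * real n powr \<delta>"
      using qb unfolding powr_add[symmetric] exponents(3) by simp
    have exp1: "b n powr (1 / \<beta>) = (s1 + 1) * real n powr \<delta>"
      using C elim exponents(1) by (simp add: b_def powr_mult powr_powr)
    have floor: "1 \<le> \<lfloor>exp (b n powr (1 / \<beta>))\<rfloor>" by simp
    then have "real (k n) = of_int \<lfloor>exp (b n powr (1 / \<beta>))\<rfloor>" "1 \<le> k n"
      unfolding k_def by linarith+
    moreover from this have "real (k n - 1) = real (k n) - 1" by simp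
    ultimately have k1: "1 \<le> real (k n)" "real (k n) \<le> exp (b n powr (1 / \<beta>))"
      "exp (b n powr (1 / \<beta>)) - 2 \<le> real (k n - 1)"
      using floor by linarith+
    have "ln (real (k n)) \<le> ln (exp (b n powr (1 / \<beta>)))"
      using k1 by (subst ln_le_cancel_iff) auto
    then have "ln (real (k n)) \<le> b n powr (1 / \<beta>)" by simp
    then have "ln (real (k n)) powr \<beta> \<le> (b n powr (1 / \<beta>)) powr \<beta>"
      using k1 beta by (intro powr_mono2) auto
    also have "\<dots> = b n" using b beta by (simp add: powr_powr)
    finally have ln: "ln (real (k n)) powr \<beta> \<le> b n" .
    have "real n powr 1 \<le> real n powr \<delta>" using elim delta_gt_1 by (intro powr_mono) auto
    then have "real n \<le> real n powr \<delta>" using elim by simp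
    also have "\<dots> \<le> (exp (b n powr (1 / \<beta>)) - 2) * (exp (- (s0 * real n powr \<delta>)) * (1 - exp (- (s0 * real n powr \<delta>))))"
      using elim by (simp add: exp1)
    also have "\<dots> \<le> real (k n - 1) * (exp (- (s0 * real n powr \<delta>)) * (1 - exp (- (s0 * real n powr \<delta>))))"
      using k1 s0 by (intro mult_right_mono mult_nonneg_nonneg) auto
    finally show ?case using q qb ln by (simp add: s)
  qed
  then show ?thesis using C that[of C q k] by (simp add: b_def)
qed

end

section \<open>From integer times to real times\<close>

lemma Liminf_Limsup_power_growth:
  fixes f :: "real \<Rightarrow> real"
  assumes mono: "\<And>s t. 0 \<le> s \<Longrightarrow> s \<le> t \<Longrightarrow> f s \<le> f t" and "0 < \<gamma>" "0 < c"
    and lower: "eventually (\<lambda>n. c * real n powr \<gamma> \<le> f (real n)) sequentially"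
    and upper: "eventually (\<lambda>n. f (real n) \<le> K * real n powr \<gamma>) sequentially"
  shows "0 < Liminf at_top (\<lambda>t. ereal (f t / t powr \<gamma>)) \<and>
      Liminf at_top (\<lambda>t. ereal (f t / t powr \<gamma>)) \<le> Limsup at_top (\<lambda>t. ereal (f t / t powr \<gamma>)) \<and>
      Limsup at_top (\<lambda>t. ereal (f t / t powr \<gamma>)) < \<infinity>"
proof (intro conjI)
  obtain N where N: "\<And>n. n \<ge> N \<Longrightarrow> c * real n powr \<gamma> \<le> f (real n) \<and> f (real n) \<le> K * real n powr \<gamma>"
    using eventually_conj[OF lower upper] by (auto simp: eventually_sequentially)
  have lo: "c * (1 / 2) powr \<gamma> \<le> f t / t powr \<gamma>" if t: "t \<ge> real N + 2" for t
  proof -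
    \<comment> \<open>For \<open>t \<ge> 2\<close> the floor is at least \<open>t / 2\<close>, and
      the ceiling used later is at most \<open>2 * t\<close>, so passing to integers costs only a
      factor \<open>2 powr \<gamma>\<close>.\<close>
    define n where "n = nat \<lfloor>t\<rfloor>"
    have n: "N \<le> n" "real n \<le> t" "t / 2 \<le> real n" using t unfolding n_def by linarith+
    have "(c * (1 / 2) powr \<gamma>) * t powr \<gamma> = c * (t / 2) powr \<gamma>"
      using t by (simp add: powr_mult[symmetric])
    also have "\<dots> \<le> c * real n powr \<gamma>"
      using n t assms by (intro mult_left_mono powr_mono2) auto
    also have "\<dots> \<le> f (real n)" using N n by auto
    also have "\<dots> \<le> f t" using n by (intro mono) auto
    finally show ?thesis using t by (simp add: field_simps)
  qed
  have hi: "f t / t powr \<gamma> \<le> \<bar>K\<bar> * 2 powr \<gamma>" if t: "t \<ge> real N + 2" for t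
  proof -
    define n where "n = nat \<lceil>t\<rceil>"
    have n: "N \<le> n" "t \<le> real n" "real n \<le> 2 * t" using t unfolding n_def by linarith+
    have "f t \<le> f (real n)" using n t by (intro mono) auto
    also have "\<dots> \<le> K * real n powr \<gamma>" using N n by auto
    also have "\<dots> \<le> \<bar>K\<bar> * real n powr \<gamma>" by (intro mult_right_mono) auto
    also have "\<dots> \<le> \<bar>K\<bar> * (2 * t) powr \<gamma>"
      using n t assms by (intro mult_left_mono powr_mono2) auto
    also have "\<dots> = (\<bar>K\<bar> * 2 powr \<gamma>) * t powr \<gamma>" using t by (simp add: powr_mult)
    finally show ?thesis using t by (simp add: field_simps)
  qed
  have "ereal (c * (1 / 2) powr \<gamma>) \<le> Liminf at_top (\<lambda>t. ereal (f t / t powr \<gamma>))"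
    by (intro Liminf_bounded eventually_mono[OF eventually_ge_at_top[of "real N + 2"]]) (simp add: lo)
  moreover have "0 < ereal (c * (1 / 2) powr \<gamma>)" using assms by simp
  ultimately show "0 < Liminf at_top (\<lambda>t. ereal (f t / t powr \<gamma>))" by (rule less_le_trans[rotated])
  have "Limsup at_top (\<lambda>t. ereal (f t / t powr \<gamma>)) \<le> ereal (\<bar>K\<bar> * 2 powr \<gamma>)"
    by (intro Limsup_bounded eventually_mono[OF eventually_ge_at_top[of "real N + 2"]]) (simp add: hi)
  then show "Limsup at_top (\<lambda>t. ereal (f t / t powr \<gamma>)) < \<infinity>" by (rule le_less_trans) simp
  show "Liminf at_top (\<lambda>t. ereal (f t / t powr \<gamma>)) \<le> Limsup at_top (\<lambda>t. ereal (f t / t powr \<gamma>))"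
    by (rule Liminf_le_Limsup) simp
qed

lemma (in prob_space) AE_eventually_not_in:
  assumes "\<And>n. F n \<in> events" "eventually (\<lambda>n. prob (F n) \<le> 2 * exp (- real n)) sequentially"
  shows "AE \<omega> in M. eventually (\<lambda>n. \<omega> \<notin> F n) sequentially"
proof -
  have "summable (\<lambda>n. 2 * exp (- real n))"
  proof -
    have "exp (- real n) = exp (-1) ^ n" for n by (simp flip: exp_of_nat_mult)
    then show ?thesis by (intro summable_mult) (simp add: summable_geometric_iff)
  qed
  then have "summable (\<lambda>n. prob (F n))"
    by (rule summable_comparison_test_ev[rotated]) (use assms(2) in \<open>auto elim!: eventually_mono\<close>)
  then have "AE \<omega> in M. eventually (\<lambda>n. \<omega> \<in> space M - F n) sequentially"
    using assms(1) by (intro borel_cantelli_AE1) (auto simp: emeasure_eq_measure)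
  then show ?thesis by eventually_elim (auto elim!: eventually_mono)
qed

section \<open>Growth of the leftmost position\<close>

theorem corollary1p6:
  fixes \<alpha> \<beta> \<gamma> :: real and M :: "'w measure" and Y :: "'w \<Rightarrow> particle_system"
  assumes "0 < \<alpha>" "\<alpha> < 1" "0 < \<beta>" "\<beta> < 1"
    and "\<gamma> = \<beta> / (\<alpha> * \<beta> + 1 - \<alpha>)"
    and "prob_space M"
    and "branching_subordinator M 0 (Lambda_ri \<alpha> \<beta>) Y"
  shows "AE \<omega> in M.
      0 < Liminf at_top (\<lambda>t. ereal (leftmost (Y \<omega>) t / t powr \<gamma>)) \<and>
      Liminf at_top (\<lambda>t. ereal (leftmost (Y \<omega>) t / t powr \<gamma>))
        \<le> Limsup at_top (\<lambda>t. ereal (leftmost (Y \<omega>) t / t powr \<gamma>)) \<and>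
      Limsup at_top (\<lambda>t. ereal (leftmost (Y \<omega>) t / t powr \<gamma>)) < \<infinity>"
proof -
  interpret prob_space M by fact
  let ?\<Lambda> = "Lambda_ri \<alpha> \<beta>"
  define \<kappa> where "\<kappa> = stable_exponent \<alpha>"
  have \<kappa>: "0 < \<kappa>"
    using stable_exponent_pos assms by (simp add: \<kappa>_def branching_subordinator_def)
  have \<gamma>: "0 < \<gamma>" using gamma_pos[OF assms(1-5) refl] .
  obtain a0 Ya where a0: "0 \<le> a0"
    and truncated: "\<And>a. a > a0 \<Longrightarrow> truncated_branching_subordinator M 0 ?\<Lambda> a (Ya a)"
    and pruned: "AE \<omega> in M. \<forall>a a'. a0 < a \<and> a \<le> a' \<longrightarrow> pruned a (Ya a' \<omega>) (Ya a \<omega>)"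
    and union: "AE \<omega> in M. particles (Y \<omega>) = (\<Union>a\<in>{a0<..}. particles (Ya a \<omega>)) \<and>
      (\<forall>a>a0. \<forall>u\<in>particles (Ya a \<omega>). \<forall>t\<ge>0. position (Y \<omega>) u t = position (Ya a \<omega>) u t)"
    using assms(7) unfolding branching_subordinator_def by blast
  \<comment> \<open>Above \<open>a0\<close> the truncated systems exist; above
    \<open>ln 2 powr \<beta>\<close> they satisfy the assumption \<open>level\<close> of
    \<open>truncated_system\<close>.\<close>
  define a1 where "a1 = max a0 (ln 2 powr \<beta>)"
  have a1: "0 \<le> a1" "a0 \<le> a1" using a0 by (auto simp: a1_def)
  have system: "\<exists>\<xi> P. truncated_system M \<alpha> \<beta> a \<xi> P (Ya a)" if "a1 < a" for a
    using truncated[of a] that assms(1-4) prob_space_axioms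
    unfolding truncated_branching_subordinator_def truncated_system_def truncated_system_axioms_def a1_def
    by auto

  \<comment> \<open>A single value serves all levels, since \<open>inverse_square_sum\<close> bounds
    the child weights at each of them.\<close>
  define \<theta> where "\<theta> = 4 * exp 1 * inverse_square_sum + 1"
  have \<theta>: "0 < \<theta>" "4 * exp 1 * inverse_square_sum \<le> \<theta>"
    using inverse_square_sum_nonneg by (auto simp: \<theta>_def add_nonneg_pos)
  obtain c where c: "0 < c" and lower: "\<And>\<theta>. eventually (\<lambda>n.
      2 * (c * real n powr \<gamma>) powr (1 / \<beta> - 1) * (c * real n powr \<gamma>)
       + (\<theta> - \<kappa> * (2 * (c * real n powr \<gamma>) powr (1 / \<beta> - 1)) powr \<alpha>) * real n \<le> - real n) sequentially"
    using lower_bound_parameters[OF assms(1-5) refl \<kappa>] by blast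
  obtain C q k where C: "0 < C" and upper: "eventually (\<lambda>n. 0 \<le> q n \<and>
       2 * (real n * (\<kappa> * q n powr \<alpha>)) \<le> q n * (C * real n powr \<gamma>) \<and>
       ln (real (k n)) powr \<beta> \<le> C * real n powr \<gamma> \<and>
       real n \<le> real (k n - 1) * (exp (- (real n * (\<kappa> * q n powr \<alpha>))) * (1 - exp (- (real n * (\<kappa> * q n powr \<alpha>)))))) sequentially"
    using upper_bound_parameters[OF assms(1-5) refl \<kappa>] by blast
  define L where "L n = c * real n powr \<gamma>" for n
  define U where "U n = C * real n powr \<gamma>" for n
  have power_at_top: "filterlim (\<lambda>n. real n powr \<gamma>) at_top sequentially"
    using \<gamma> by (intro filterlim_compose[OF real_powr_at_top filterlim_real_sequentially])
  have L_top: "filterlim L at_top sequentially" and U_top: "filterlim U at_top sequentially"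
    unfolding L_def U_def using c C power_at_top
    by (auto intro: filterlim_tendsto_pos_mult_at_top[OF tendsto_const])

  define low_ok where "low_ok n \<longleftrightarrow> a1 < L n \<and> 2 * L n powr (1 / \<beta> - 1) * L n
    + (\<theta> - \<kappa> * (2 * L n powr (1 / \<beta> - 1)) powr \<alpha>) * real n \<le> - real n" for n
  define low where "low n \<omega> \<longleftrightarrow>
    (\<forall>u\<in>population (Ya (L n) \<omega>) (real n). L n < position (Ya (L n) \<omega>) u (real n))" for n \<omega>
  \<comment> \<open>The estimate is available only for large \<open>n\<close>. With
    \<open>low_ok n\<close> inside, an event exists for every \<open>n\<close>, which yields a full
    sequence for the Borel--Cantelli lemma.\<close>
  have "\<exists>F. F \<in> events \<and>
    (low_ok n \<longrightarrow> prob F \<le> 2 * exp (- real n) \<and> (AE \<omega> in M. \<omega> \<notin> F \<longrightarrow> low n \<omega>))" for n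
  proof (cases "low_ok n")
    case True
    then obtain \<xi> P where "truncated_system M \<alpha> \<beta> (L n) \<xi> P (Ya (L n))"
      using system unfolding low_ok_def by blast
    then interpret truncated_system M \<alpha> \<beta> "L n" \<xi> P "Ya (L n)" .
    let ?q = "2 * L n powr (1 / \<beta> - 1)"
    have "0 \<le> ?q" "0 \<le> real n" "0 \<le> stable_exponent \<alpha>" using \<kappa> by (auto simp: \<kappa>_def)
    then obtain F where F: "F \<in> events" "prob F \<le> 2 * exp (?q * L n + (\<theta> - \<kappa> * ?q powr \<alpha>) * real n)"
      "AE \<omega> in M. \<omega> \<notin> F \<longrightarrow> low n \<omega>"
      using leftmost_exceeds[of ?q "real n" \<theta> inverse_square_sum "L n"] \<theta>
        inverse_square_sum_nonneg sum_child_weight_le[OF assms(4) refl] unfolding \<kappa>_def low_def by blast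
    note F(2)
    also have "2 * exp (?q * L n + (\<theta> - \<kappa> * ?q powr \<alpha>) * real n) \<le> 2 * exp (- real n)"
      using True unfolding low_ok_def by simp
    finally show ?thesis using F(1,3) by (intro exI[of _ F]) simp
  qed auto
  then obtain F1 where F1: "\<And>n. F1 n \<in> events"
    "\<And>n. low_ok n \<Longrightarrow> prob (F1 n) \<le> 2 * exp (- real n)"
    "\<And>n. low_ok n \<Longrightarrow> AE \<omega> in M. \<omega> \<notin> F1 n \<longrightarrow> low n \<omega>"
    by metis
  obtain N1 where N1: "\<And>n. n \<ge> N1 \<Longrightarrow> low_ok n"
    using eventually_conj[OF filterlim_at_top_dense[THEN iffD1, rule_format, OF L_top, of a1] lower[of \<theta>]]
    unfolding low_ok_def L_def eventually_sequentially by blast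
  have avoid1: "AE \<omega> in M. eventually (\<lambda>n. \<omega> \<notin> F1 n) sequentially"
    using F1(1,2) N1 by (intro AE_eventually_not_in) (auto simp: eventually_sequentially)
  have F1_AE: "AE \<omega> in M. \<forall>n. n \<ge> N1 \<longrightarrow> \<omega> \<notin> F1 n \<longrightarrow> low n \<omega>"
    unfolding AE_all_countable using F1(3) N1 by (auto intro!: AE_impI)

  define high_ok where "high_ok n \<longleftrightarrow> a1 < U n \<and> 0 \<le> q n \<and>
    2 * (real n * (\<kappa> * q n powr \<alpha>)) \<le> q n * U n \<and> ln (real (k n)) powr \<beta> \<le> U n \<and>
    real n \<le> real (k n - 1) * (exp (- (real n * (\<kappa> * q n powr \<alpha>))) * (1 - exp (- (real n * (\<kappa> * q n powr \<alpha>)))))" for n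
  \<comment> \<open>The level \<open>U n + 1\<close> lies strictly above \<open>U n\<close>, so that
    children at distance at most \<open>U n\<close> survive truncation.\<close>
  define high where "high n \<omega> \<longleftrightarrow> (\<exists>s>0. \<exists>i. [(s, i)] \<in> particles (Ya (U n + 1) \<omega>) \<and>
    (\<forall>s' i'. [(s', i')] \<in> particles (Ya (U n + 1) \<omega>) \<longrightarrow> s \<le> s') \<and>
    (s \<le> real n \<longrightarrow> position (Ya (U n + 1) \<omega>) [(s, i)] (real n) \<le> position (Ya (U n + 1) \<omega>) [] s + 2 * U n))" for n \<omega>
  have "\<exists>F. F \<in> events \<and>
    (high_ok n \<longrightarrow> prob F \<le> 2 * exp (- real n) \<and> (AE \<omega> in M. \<omega> \<notin> F \<longrightarrow> high n \<omega>))" for n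
  proof (cases "high_ok n")
    case True
    then have "a1 < U n + 1" by (simp add: high_ok_def)
    then obtain \<xi> P where "truncated_system M \<alpha> \<beta> (U n + 1) \<xi> P (Ya (U n + 1))" using system by blast
    then interpret truncated_system M \<alpha> \<beta> "U n + 1" \<xi> P "Ya (U n + 1)" .
    have "0 \<le> real n" "0 \<le> q n" "2 * (real n * (stable_exponent \<alpha> * q n powr \<alpha>)) \<le> q n * U n"
      "ln (real (k n)) powr \<beta> \<le> U n" "U n < U n + 1"
      using True by (auto simp: high_ok_def \<kappa>_def)
    from near_child[OF this] obtain F where F: "F \<in> events"
      "prob F \<le> exp (- (real (k n - 1) * (exp (- (real n * (\<kappa> * q n powr \<alpha>))) * (1 - exp (- (real n * (\<kappa> * q n powr \<alpha>)))))))"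
      "AE \<omega> in M. \<omega> \<notin> F \<longrightarrow> high n \<omega>"
      unfolding \<kappa>_def high_def by blast
    note F(2)
    also have "exp (- (real (k n - 1) * (exp (- (real n * (\<kappa> * q n powr \<alpha>))) * (1 - exp (- (real n * (\<kappa> * q n powr \<alpha>)))))))
      \<le> exp (- real n)" using True unfolding high_ok_def by simp
    also have "\<dots> \<le> 2 * exp (- real n)" by simp
    finally show ?thesis using F(1,3) by (intro exI[of _ F]) simp
  qed auto
  then obtain F2 where F2: "\<And>n. F2 n \<in> events"
    "\<And>n. high_ok n \<Longrightarrow> prob (F2 n) \<le> 2 * exp (- real n)"
    "\<And>n. high_ok n \<Longrightarrow> AE \<omega> in M. \<omega> \<notin> F2 n \<longrightarrow> high n \<omega>"
    by metis
  obtain N2 where N2: "\<And>n. n \<ge> N2 \<Longrightarrow> high_ok n"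
    using eventually_conj[OF filterlim_at_top_dense[THEN iffD1, rule_format, OF U_top, of a1] upper]
    unfolding high_ok_def U_def eventually_sequentially by blast
  have avoid2: "AE \<omega> in M. eventually (\<lambda>n. \<omega> \<notin> F2 n) sequentially"
    using F2(1,2) N2 by (intro AE_eventually_not_in) (auto simp: eventually_sequentially)
  have F2_AE: "AE \<omega> in M. \<forall>n. n \<ge> N2 \<longrightarrow> \<omega> \<notin> F2 n \<longrightarrow> high n \<omega>"
    unfolding AE_all_countable using F2(3) N2 by (auto intro!: AE_impI)

  \<comment> \<open>Countably many levels suffice for the almost sure statements: those of the two
    estimates, and the natural numbers, which are cofinal.\<close>
  define D where "D = range real \<union> range L \<union> range (\<lambda>n. U n + 1)"
  have "countable D" by (simp add: D_def)
  then have levels: "AE \<omega> in M. \<forall>a\<in>D. a1 < a \<longrightarrow> regular_system (Ya a \<omega>) \<and>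
      (\<forall>t. finite (population (Ya a \<omega>) t)) \<and> (\<exists>s\<ge>0. [(s, 1)] \<in> particles (Ya a \<omega>))"
  proof (subst AE_ball_countable, assumption, intro ballI)
    fix a
    show "AE \<omega> in M. a1 < a \<longrightarrow> regular_system (Ya a \<omega>) \<and>
      (\<forall>t. finite (population (Ya a \<omega>) t)) \<and> (\<exists>s\<ge>0. [(s, 1)] \<in> particles (Ya a \<omega>))"
    proof (rule AE_impI)
      assume "a1 < a"
      then obtain \<xi> P where "truncated_system M \<alpha> \<beta> a \<xi> P (Ya a)" using system by blast
      then interpret truncated_system M \<alpha> \<beta> a \<xi> P "Ya a" .
      have "0 \<le> stable_exponent \<alpha>" using \<kappa> by (simp add: \<kappa>_def)
      from AE_regular_system AE_finite_population[OF this] AE_ex_child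
      show "AE \<omega> in M. regular_system (Ya a \<omega>) \<and>
        (\<forall>t. finite (population (Ya a \<omega>) t)) \<and> (\<exists>s\<ge>0. [(s, 1)] \<in> particles (Ya a \<omega>))"
        by eventually_elim blast
    qed
  qed

  from levels pruned union avoid1 F1_AE avoid2 F2_AE show ?thesis
  proof eventually_elim
    case (elim \<omega>)
    note outer = elim
    have mono: "particles (Ya a \<omega>) \<subseteq> particles (Ya a' \<omega>)" if "a0 < a" "a \<le> a'" for a a'
      using elim(2) that by (auto simp: pruned_def)
    \<comment> \<open>Levels between \<open>a0\<close> and \<open>a1\<close> add nothing, since
      particle sets grow with the level.\<close>
    have "(\<Union>a\<in>{a0<..}. particles (Ya a \<omega>)) = (\<Union>a\<in>{a1<..}. particles (Ya a \<omega>))"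
    proof (intro equalityI UN_least)
      fix a assume "a \<in> {a0<..}"
      then have "particles (Ya a \<omega>) \<subseteq> particles (Ya (max a (a1 + 1)) \<omega>)" by (intro mono) auto
      then show "particles (Ya a \<omega>) \<subseteq> (\<Union>a\<in>{a1<..}. particles (Ya a \<omega>))"
        by (rule order_trans) (auto intro!: UN_upper)
    qed (use a1 in \<open>auto intro!: UN_upper\<close>)
    then interpret particle_tower a1 D "\<lambda>a. Ya a \<omega>" "Y \<omega>"
      by unfold_locales (use elim(1-3) a1 in \<open>auto simp: D_def\<close>)
    have "eventually (\<lambda>n. c * real n powr \<gamma> \<le> leftmost (Y \<omega>) (real n)) sequentially"
      using elim(4) eventually_ge_at_top[of N1]
    proof eventually_elim
      case (elim n)
      then have "low n \<omega>" using outer(5) by blast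
      then show ?case
        using leftmost_ge[of "L n" "real n"] N1[OF elim(2)] by (simp add: L_def low_def low_ok_def)
    qed
    moreover
    \<comment> \<open>\<open>m\<close> and \<open>r\<close> are fixed before \<open>n\<close>. For
      large \<open>n\<close> the root's position at time \<open>r\<close> is at most
      \<open>n powr \<gamma>\<close>, which accounts for the \<open>+ 1\<close> in
      \<open>2 * C + 1\<close>.\<close>
    obtain m :: nat where m: "a1 < real m" using reals_Archimedean2 by blast
    obtain r where r: "0 \<le> r" "[(r, 1)] \<in> particles (Ya (real m) \<omega>)"
      using elim(1) m by (auto simp: D_def)
    have "eventually (\<lambda>n. leftmost (Y \<omega>) (real n) \<le> (2 * C + 1) * real n powr \<gamma>) sequentially"
      using elim(6) eventually_ge_at_top[of N2] eventually_ge_at_top[of "nat \<lceil>r\<rceil>"]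
        filterlim_at_top[THEN iffD1, rule_format, OF U_top, of "real m"]
        filterlim_at_top[THEN iffD1, rule_format, OF power_at_top, of "position (Y \<omega>) [] r"]
    proof eventually_elim
      case (elim n)
      obtain s i where s: "0 < s" "[(s, i)] \<in> particles (Ya (U n + 1) \<omega>)"
        "\<forall>s' i'. [(s', i')] \<in> particles (Ya (U n + 1) \<omega>) \<longrightarrow> s \<le> s'"
        "s \<le> real n \<longrightarrow> position (Ya (U n + 1) \<omega>) [(s, i)] (real n) \<le> position (Ya (U n + 1) \<omega>) [] s + 2 * U n"
        using outer(7) elim(1,2) unfolding high_def by blast
      have "U n + 1 \<in> D" by (simp add: D_def)
      moreover have "real m \<le> U n + 1" "r \<le> real n" using elim by linarith+
      ultimately have "leftmost (Y \<omega>) (real n) \<le> position (Y \<omega>) [] r + 2 * U n"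
        using leftmost_le[OF m _ _ r(2) _ s] by blast
      then show ?case using elim(5) by (simp add: U_def algebra_simps)
    qed
    ultimately show ?case
      using leftmost_mono \<gamma> c
      by (intro Liminf_Limsup_power_growth[where f = "leftmost (Y \<omega>)" and c = c and K = "2 * C + 1"])
  qed
qed

end
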